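(* Let $\Omega\subset\mathbb{R}^3$ be a bounded convex polytopal domain (no periodic boundaries) partitioned into a mesh $\mathcal{T}^h$ with set of interior facets $\mathcal{F}^h$, let $\mathrm{Re}>0$, and let the finite-dimensional spaces $\mathbb{A}_0,\mathbb{W}_0,\mathbb{U}_0,\mathbb{P}$ form a discrete Stokes complex with strongly imposed boundary conditions, as described in the context. Let $(\alpha,\boldsymbol\omega,\mathbf{u},p)$ be a solution, with values in $\mathbb{A}_0\times\mathbb{W}_0\times\mathbb{U}_0\times\mathbb{P}$ at each time $t$, of $$0=(\boldsymbol\omega,\nabla\beta),$$ $$(\operatorname{curl}\boldsymbol\omega,\operatorname{curl}\boldsymbol\chi)=2(\varepsilon\mathbf{u},\varepsilon\operatorname{curl}\boldsymbol\chi)-(\nabla\alpha,\boldsymbol\chi),$$ $$(\partial_t\mathbf{u},\mathbf{v})=(\mathbf{u}\times\boldsymbol\omega,\mathbf{v})+\left(\tfrac12|\mathbf{u}|^2+p,\operatorname{div}\mathbf{v}\right)-\tfrac{2}{\mathrm{Re}}(\varepsilon\mathbf{u},\varepsilon\mathbf{v}),$$ $$0=(\operatorname{div}\mathbf{u},q),$$ for all $(\beta,\boldsymbol\chi,\mathbf{v},q)\in\mathbb{A}_0\times\mathbb{W}_0\times\mathbb{U}_0\times\mathbb{P}$. Then the enstrophy $\mathcal{E}(\mathbf{u}):=\|\varepsilon\mathbf{u}\|^2$ satisfies $$\partial_t\mathcal{E}=\left(\int_\Omega\boldsymbol\omega\cdot\varepsilon\mathbf{u}\cdot\boldsymbol\omega+\frac12\int_{\mathcal{F}^h}[\![\,|\boldsymbol\omega|^2\,\mathbf{n}\,]\!]\cdot\mathbf{u}-\int_{\mathcal{T}^h}\boldsymbol\omega\cdot\nabla\big[\mathbf{u}\cdot\boldsymbol\omega\big]\right)-\frac{1}{\mathrm{Re}}\|\operatorname{curl}\boldsymbol\omega\|^2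 .$$
   Context: $(\cdot,\cdot)$ and $\|\cdot\|$ denote the $L^2(\Omega)$ inner product and norm; $\varepsilon\mathbf{u}:=\operatorname{sym}\operatorname{grad}\mathbf{u}$ is the symmetric gradient; $\mathbf{n}$ is an outward unit normal. For a differential operator $\mathrm{d}$, $H(\mathrm{d}):=\{u\in L^2:\mathrm{d}u\in L^2\}$; boldface denotes vector-valued fields/spaces. $H^1_0$, $\mathbf{H}_0(\operatorname{curl})$, $\mathbf{H}_0(\operatorname{div})$ are the subspaces of $H^1$, $\mathbf{H}(\operatorname{curl})$, $\mathbf{H}(\operatorname{div})$ with, respectively, $u=0$, $\mathbf{u}\times\mathbf{n}=\mathbf{0}$, $\mathbf{u}\cdot\mathbf{n}=0$ on $\partial\Omega$. Discrete Stokes complex: finite-dimensional (finite element) spaces $\mathbb{A}_0\subset H^1_0$, $\mathbb{W}_0\subset\mathbf{H}(\operatorname{grad}\operatorname{curl})\cap\mathbf{H}_0(\operatorname{curl})$, $\mathbb{U}_0\subset\mathbf{H}^1\cap\mathbf{H}_0(\operatorname{div})$, $\mathbb{P}\subset L^2$ with $\nabla\mathbb{A}_0\subset\mathbb{W}_0$, $\operatorname{curl}\mathbb{W}_0\subset\mathbb{U}_0$, $\operatorname{div}\mathbb{U}_0\subset\mathbb{P}$, consisting of functions smooth (up to the boundary) on each cell of $\mathcal{T}^h$. Standing assumption on the complex: its discrete cohomology is that of the domain, i.e. the space of discrete harmonic $k$-forms (elements of the $k$-th space in the kernel of the outgoing map and $L^2$-orthogonal to the image of the incoming map) has dimension equal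 to the Betti number $b_{3-k}(\Omega)$. For the contractible domains considered here, this means in particular that every $\mathbf{u}\in\mathbb{U}_0$ with $\operatorname{div}\mathbf{u}=0$ equals $\operatorname{curl}\boldsymbol\psi$ for some $\boldsymbol\psi\in\mathbb{W}_0$. Broken integrals: $\int_{\mathcal{T}^h}:=\sum_{K\in\mathcal{T}^h}\int_K$ and $\int_{\mathcal{F}^h}:=\sum_{F\in\mathcal{F}^h}\int_F$. On an interior facet shared by two cells, with $\pm$ denoting the traces from the two cells and $\mathbf{n}_\pm$ their outward unit normals, $[\![\,|\boldsymbol\omega|^2\mathbf{n}\,]\!]:=|\boldsymbol\omega_+|^2\mathbf{n}_++|\boldsymbol\omega_-|^2\mathbf{n}_-$. Solutions are assumed to be continuously differentiable in time in the $\mathbf{u}$ component. *)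

theory Defs
  imports "HOL-Analysis.Analysis" "HOL-Homology.Homology"
begin

text \<open>
  Elements of $L^2$-type spaces are represented by functions on the whole of space; only their
  values on the domain matter, and the weak operators, integrals and dimensions below depend on
  them only up to equality almost everywhere.
\<close>

definition l2_fun :: "(real^3) set \<Rightarrow> (real^3 \<Rightarrow> 'b::euclidean_space) \<Rightarrow> bool" where
  "l2_fun \<Omega> f \<longleftrightarrow>
     f \<in> borel_measurable (lebesgue_on \<Omega>) \<and> integrable (lebesgue_on \<Omega>) (\<lambda>x. (norm (f x))\<^sup>2)"

text \<open>For matrix fields the inner product of \<^typ>\<open>real^3^3\<close> is the Frobenius product.\<close>

definition l2_inner ::
  "(real^3) set \<Rightarrow> (real^3 \<Rightarrow> 'b::euclidean_space) \<Rightarrow> (real^3 \<Rightarrow> 'b) \<Rightarrow> real" where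
  "l2_inner \<Omega> f g = (LINT x|lebesgue_on \<Omega>. f x \<bullet> g x)"

definition l2_norm :: "(real^3) set \<Rightarrow> (real^3 \<Rightarrow> 'b::euclidean_space) \<Rightarrow> real" where
  "l2_norm \<Omega> f = sqrt (l2_inner \<Omega> f f)"


section \<open>Classical derivatives and smooth functions\<close>

definition partial :: "3 \<Rightarrow> (real^3 \<Rightarrow> 'b::real_normed_vector) \<Rightarrow> real^3 \<Rightarrow> 'b" where
  "partial i f x = frechet_derivative f (at x) (axis i 1)"

definition grad :: "(real^3 \<Rightarrow> real) \<Rightarrow> real^3 \<Rightarrow> real^3" where
  "grad f x = (\<chi> i. partial i f x)"

definition curl :: "(real^3 \<Rightarrow> real^3) \<Rightarrow> real^3 \<Rightarrow> real^3" where
  "curl v x = vector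
     [partial 2 v x $ 3 - partial 3 v x $ 2,
      partial 3 v x $ 1 - partial 1 v x $ 3,
      partial 1 v x $ 2 - partial 2 v x $ 1]"

primrec Ck :: "nat \<Rightarrow> (real^3 \<Rightarrow> 'b::real_normed_vector) \<Rightarrow> bool" where
  "Ck 0 f \<longleftrightarrow> continuous_on UNIV f"
| "Ck (Suc k) f \<longleftrightarrow>
     f differentiable_on UNIV \<and> (\<forall>v. Ck k (\<lambda>x. frechet_derivative f (at x) v))"

definition smooth :: "(real^3 \<Rightarrow> 'b::real_normed_vector) \<Rightarrow> bool" where
  "smooth f \<longleftrightarrow> (\<forall>k. Ck k f)"

definition test_fun :: "(real^3) set \<Rightarrow> (real^3 \<Rightarrow> 'b::real_normed_vector) \<Rightarrow> bool" where
  "test_fun \<Omega> \<phi> \<longleftrightarrow>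
     smooth \<phi> \<and> compact (closure {x. \<phi> x \<noteq> 0}) \<and> closure {x. \<phi> x \<noteq> 0} \<subseteq> \<Omega>"


section \<open>Weak derivatives in $L^2$\<close>

definition has_weak_grad :: "(real^3) set \<Rightarrow> (real^3 \<Rightarrow> real) \<Rightarrow> (real^3 \<Rightarrow> real^3) \<Rightarrow> bool" where
  "has_weak_grad \<Omega> f g \<longleftrightarrow> l2_fun \<Omega> f \<and> l2_fun \<Omega> g \<and>
     (\<forall>\<phi>. test_fun \<Omega> \<phi> \<longrightarrow>
        (LINT x|lebesgue_on \<Omega>. f x *\<^sub>R grad \<phi> x) = - (LINT x|lebesgue_on \<Omega>. \<phi> x *\<^sub>R g x))"

definition has_weak_curl :: "(real^3) set \<Rightarrow> (real^3 \<Rightarrow> real^3) \<Rightarrow> (real^3 \<Rightarrow> real^3) \<Rightarrow> bool" where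
  "has_weak_curl \<Omega> v w \<longleftrightarrow> l2_fun \<Omega> v \<and> l2_fun \<Omega> w \<and>
     (\<forall>\<phi>. test_fun \<Omega> \<phi> \<longrightarrow> l2_inner \<Omega> v (curl \<phi>) = l2_inner \<Omega> w \<phi>)"

definition has_weak_div :: "(real^3) set \<Rightarrow> (real^3 \<Rightarrow> real^3) \<Rightarrow> (real^3 \<Rightarrow> real) \<Rightarrow> bool" where
  "has_weak_div \<Omega> v d \<longleftrightarrow> l2_fun \<Omega> v \<and> l2_fun \<Omega> d \<and>
     (\<forall>\<phi>. test_fun \<Omega> \<phi> \<longrightarrow> l2_inner \<Omega> v (grad \<phi>) = - l2_inner \<Omega> d \<phi>)"

text \<open>Row \<open>i\<close> of \<open>J\<close> is the gradient of the component \<open>i\<close>.\<close>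

definition has_weak_jac :: "(real^3) set \<Rightarrow> (real^3 \<Rightarrow> real^3) \<Rightarrow> (real^3 \<Rightarrow> real^3^3) \<Rightarrow> bool" where
  "has_weak_jac \<Omega> v J \<longleftrightarrow> (\<forall>i. has_weak_grad \<Omega> (\<lambda>x. v x $ i) (\<lambda>x. J x $ i))"

text \<open>
  Weak derivatives are unique up to null sets, so the choice of a representative is immaterial
  in every place where the following operators are used.
\<close>

definition wgrad :: "(real^3) set \<Rightarrow> (real^3 \<Rightarrow> real) \<Rightarrow> real^3 \<Rightarrow> real^3" where
  "wgrad \<Omega> f = (SOME g. has_weak_grad \<Omega> f g)"

definition wcurl :: "(real^3) set \<Rightarrow> (real^3 \<Rightarrow> real^3) \<Rightarrow> real^3 \<Rightarrow> real^3" where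
  "wcurl \<Omega> v = (SOME w. has_weak_curl \<Omega> v w)"

definition wdiv :: "(real^3) set \<Rightarrow> (real^3 \<Rightarrow> real^3) \<Rightarrow> real^3 \<Rightarrow> real" where
  "wdiv \<Omega> v = (SOME d. has_weak_div \<Omega> v d)"

definition wjac :: "(real^3) set \<Rightarrow> (real^3 \<Rightarrow> real^3) \<Rightarrow> real^3 \<Rightarrow> real^3^3" where
  "wjac \<Omega> v = (SOME J. has_weak_jac \<Omega> v J)"

definition sym_grad :: "(real^3) set \<Rightarrow> (real^3 \<Rightarrow> real^3) \<Rightarrow> real^3 \<Rightarrow> real^3^3" where
  "sym_grad \<Omega> v x = (1/2) *\<^sub>R (wjac \<Omega> v x + transpose (wjac \<Omega> v x))"


section \<open>Sobolev spaces\<close>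

definition H_grad :: "(real^3) set \<Rightarrow> (real^3 \<Rightarrow> real) set" where
  "H_grad \<Omega> = {f. \<exists>g. has_weak_grad \<Omega> f g}"

definition H_curl :: "(real^3) set \<Rightarrow> (real^3 \<Rightarrow> real^3) set" where
  "H_curl \<Omega> = {v. \<exists>w. has_weak_curl \<Omega> v w}"

definition H_div :: "(real^3) set \<Rightarrow> (real^3 \<Rightarrow> real^3) set" where
  "H_div \<Omega> = {v. \<exists>d. has_weak_div \<Omega> v d}"

definition H1_vec :: "(real^3) set \<Rightarrow> (real^3 \<Rightarrow> real^3) set" where
  "H1_vec \<Omega> = {v. \<exists>J. has_weak_jac \<Omega> v J}"

definition H_grad_curl :: "(real^3) set \<Rightarrow> (real^3 \<Rightarrow> real^3) set" where
  "H_grad_curl \<Omega> = {v. \<exists>w J. has_weak_curl \<Omega> v w \<and> has_weak_jac \<Omega> w J}"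

text \<open>
  The boundary traces of $H^1$, $H(\mathrm{curl})$ and $H(\mathrm{div})$ functions are the
  functionals defined by Green's formula: for $\varphi$ smooth up to the boundary the three
  expressions below are $\int_{\partial\Omega} f\varphi\,n$,
  $\int_{\partial\Omega} (n\times v)\cdot\varphi$ and $\int_{\partial\Omega} (v\cdot n)\varphi$.
\<close>

definition grad_trace :: "(real^3) set \<Rightarrow> (real^3 \<Rightarrow> real) \<Rightarrow> (real^3 \<Rightarrow> real) \<Rightarrow> real^3" where
  "grad_trace \<Omega> f \<phi> = (LINT x|lebesgue_on \<Omega>. \<phi> x *\<^sub>R wgrad \<Omega> f x + f x *\<^sub>R grad \<phi> x)"

definition curl_trace :: "(real^3) set \<Rightarrow> (real^3 \<Rightarrow> real^3) \<Rightarrow> (real^3 \<Rightarrow> real^3) \<Rightarrow> real" where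
  "curl_trace \<Omega> v \<phi> = l2_inner \<Omega> (wcurl \<Omega> v) \<phi> - l2_inner \<Omega> v (curl \<phi>)"

definition div_trace :: "(real^3) set \<Rightarrow> (real^3 \<Rightarrow> real^3) \<Rightarrow> (real^3 \<Rightarrow> real) \<Rightarrow> real" where
  "div_trace \<Omega> v \<phi> = l2_inner \<Omega> (wdiv \<Omega> v) \<phi> + l2_inner \<Omega> v (grad \<phi>)"

definition H0_grad :: "(real^3) set \<Rightarrow> (real^3 \<Rightarrow> real) set" where
  "H0_grad \<Omega> = {f \<in> H_grad \<Omega>. \<forall>\<phi>. smooth \<phi> \<longrightarrow> grad_trace \<Omega> f \<phi> = 0}"

definition H0_curl :: "(real^3) set \<Rightarrow> (real^3 \<Rightarrow> real^3) set" where
  "H0_curl \<Omega> = {v \<in> H_curl \<Omega>. \<forall>\<phi>. smooth \<phi> \<longrightarrow> curl_trace \<Omega> v \<phi> = 0}"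

definition H0_div :: "(real^3) set \<Rightarrow> (real^3 \<Rightarrow> real^3) set" where
  "H0_div \<Omega> = {v \<in> H_div \<Omega>. \<forall>\<phi>. smooth \<phi> \<longrightarrow> div_trace \<Omega> v \<phi> = 0}"


section \<open>Polytopal meshes\<close>

definition polytopal_domain :: "(real^3) set \<Rightarrow> bool" where
  "polytopal_domain \<Omega> \<longleftrightarrow> open \<Omega> \<and> \<Omega> \<noteq> {} \<and> convex \<Omega> \<and> polytope (closure \<Omega>)"

definition mesh_of :: "(real^3) set set \<Rightarrow> (real^3) set \<Rightarrow> bool" where
  "mesh_of \<T> \<Omega> \<longleftrightarrow>
     finite \<T> \<and> (\<forall>K\<in>\<T>. polytope K \<and> interior K \<noteq> {}) \<and> \<Union>\<T> = closure \<Omega> \<and>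
     (\<forall>K\<in>\<T>. \<forall>L\<in>\<T>. K \<inter> L face_of K \<and> K \<inter> L face_of L)"

definition interior_facets :: "(real^3) set set \<Rightarrow> (real^3) set set" where
  "interior_facets \<T> = {F. \<exists>K\<in>\<T>. \<exists>L\<in>\<T>. K \<noteq> L \<and> F facet_of K \<and> F facet_of L}"

definition facet_normal :: "(real^3) set \<Rightarrow> (real^3) set \<Rightarrow> real^3" where
  "facet_normal K F =
     (THE n. norm n = 1 \<and> (\<exists>b. (\<forall>x\<in>F. n \<bullet> x = b) \<and> (\<forall>x\<in>K. n \<bullet> x \<le> b)))"

definition piecewise_smooth :: "(real^3) set set \<Rightarrow> (real^3 \<Rightarrow> 'b::real_normed_vector) \<Rightarrow> bool" where
  "piecewise_smooth \<T> f \<longleftrightarrow> (\<forall>K\<in>\<T>. \<exists>g. smooth g \<and> (\<forall>x\<in>interior K. f x = g x))"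

definition trace_from :: "(real^3) set \<Rightarrow> (real^3 \<Rightarrow> 'b::real_normed_vector) \<Rightarrow> real^3 \<Rightarrow> 'b" where
  "trace_from S f x = Lim (at x within S) f"

text \<open>On an interior facet the sum below has exactly two terms.\<close>

definition normal_jump ::
  "(real^3) set set \<Rightarrow> ((real^3) set \<Rightarrow> real^3 \<Rightarrow> real) \<Rightarrow> (real^3) set \<Rightarrow> real^3 \<Rightarrow> real^3" where
  "normal_jump \<T> g F x = (\<Sum>K\<in>{K\<in>\<T>. F facet_of K}. g K x *\<^sub>R facet_normal K F)"

text \<open>
  The surface measure of a planar facet is planar Lebesgue measure transported by an isometric
  parametrisation of its affine hull; by isometry invariance the choice is immaterial.
\<close>

definition plane_chart :: "(real^3) set \<Rightarrow> real^2 \<Rightarrow> real^3" where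
  "plane_chart F = (SOME \<phi>. (\<forall>y z. dist (\<phi> y) (\<phi> z) = dist y z) \<and> range \<phi> = affine hull F)"

definition facet_integral :: "(real^3) set \<Rightarrow> (real^3 \<Rightarrow> real) \<Rightarrow> real" where
  "facet_integral F f = (LINT y|lebesgue_on (plane_chart F -` F). f (plane_chart F y))"

definition broken_integral :: "(real^3) set set \<Rightarrow> (real^3 \<Rightarrow> real) \<Rightarrow> real" where
  "broken_integral \<T> f = (\<Sum>K\<in>\<T>. LINT x|lebesgue_on K. f x)"

text \<open>
  The two-sided limit of \<open>u\<close> over all cell interiors exists on the facets because a piecewise
  smooth $H^1$ field has equal traces from both sides.
\<close>

definition facet_jump_term ::
  "(real^3) set set \<Rightarrow> (real^3 \<Rightarrow> real^3) \<Rightarrow> (real^3 \<Rightarrow> real^3) \<Rightarrow> real" where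
  "facet_jump_term \<T> \<omega> u =
     (\<Sum>F\<in>interior_facets \<T>. facet_integral F (\<lambda>x.
        normal_jump \<T> (\<lambda>K y. (norm (trace_from (interior K) \<omega> y))\<^sup>2) F x
          \<bullet> trace_from (\<Union>K\<in>\<T>. interior K) u x))"


section \<open>Discrete Stokes complexes\<close>

definition fun_subspace :: "('a \<Rightarrow> 'b::real_vector) set \<Rightarrow> bool" where
  "fun_subspace V \<longleftrightarrow> (\<lambda>_. 0) \<in> V \<and> (\<forall>f\<in>V. \<forall>g\<in>V. (\<lambda>x. f x + g x) \<in> V) \<and>
     (\<forall>c. \<forall>f\<in>V. (\<lambda>x. c *\<^sub>R f x) \<in> V)"

text \<open>Dimension as a space of equivalence classes modulo equality almost everywhere.\<close>

definition has_l2_dim :: "(real^3) set \<Rightarrow> (real^3 \<Rightarrow> 'b::euclidean_space) set \<Rightarrow> nat \<Rightarrow> bool" where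
  "has_l2_dim \<Omega> V n \<longleftrightarrow> (\<exists>B. finite B \<and> card B = n \<and> B \<subseteq> V \<and>
     (\<forall>f\<in>V. \<exists>c. AE x in lebesgue_on \<Omega>. f x = (\<Sum>b\<in>B. c b *\<^sub>R b x)) \<and>
     (\<forall>c. (AE x in lebesgue_on \<Omega>. (\<Sum>b\<in>B. c b *\<^sub>R b x) = 0) \<longrightarrow> (\<forall>b\<in>B. c b = 0)))"

text \<open>
  Torsion-free rank of integral singular homology; finite for the domains considered here.
\<close>

definition betti :: "nat \<Rightarrow> 'a topology \<Rightarrow> nat" where
  "betti k X = (let H = homology_group (int k) X in
     GREATEST n. \<exists>g. (\<forall>i<n. g i \<in> carrier H) \<and>
       (\<forall>c::nat \<Rightarrow> int. finprod H (\<lambda>i. g i [^]\<^bsub>H\<^esub> c i) {..<n} = \<one>\<^bsub>H\<^esub> \<longrightarrow> (\<forall>i<n. c i = 0)))"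

definition fe_space ::
  "(real^3) set \<Rightarrow> (real^3) set set \<Rightarrow> (real^3 \<Rightarrow> 'b::euclidean_space) set \<Rightarrow> bool" where
  "fe_space \<Omega> \<T> V \<longleftrightarrow>
     fun_subspace V \<and> (\<exists>n. has_l2_dim \<Omega> V n) \<and> (\<forall>f\<in>V. piecewise_smooth \<T> f)"

text \<open>Discrete harmonic $k$-forms for $k = 0, 1, 2, 3$.\<close>

definition harmonic0 :: "(real^3) set \<Rightarrow> (real^3 \<Rightarrow> real) set \<Rightarrow> (real^3 \<Rightarrow> real) set" where
  "harmonic0 \<Omega> A = {\<alpha>\<in>A. AE x in lebesgue_on \<Omega>. wgrad \<Omega> \<alpha> x = 0}"

definition harmonic1 ::
  "(real^3) set \<Rightarrow> (real^3 \<Rightarrow> real) set \<Rightarrow> (real^3 \<Rightarrow> real^3) set \<Rightarrow> (real^3 \<Rightarrow> real^3) set" where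
  "harmonic1 \<Omega> A W = {w\<in>W. (AE x in lebesgue_on \<Omega>. wcurl \<Omega> w x = 0) \<and>
                           (\<forall>\<alpha>\<in>A. l2_inner \<Omega> w (wgrad \<Omega> \<alpha>) = 0)}"

definition harmonic2 ::
  "(real^3) set \<Rightarrow> (real^3 \<Rightarrow> real^3) set \<Rightarrow> (real^3 \<Rightarrow> real^3) set \<Rightarrow> (real^3 \<Rightarrow> real^3) set" where
  "harmonic2 \<Omega> W U = {v\<in>U. (AE x in lebesgue_on \<Omega>. wdiv \<Omega> v x = 0) \<and>
                           (\<forall>w\<in>W. l2_inner \<Omega> v (wcurl \<Omega> w) = 0)}"

definition harmonic3 ::
  "(real^3) set \<Rightarrow> (real^3 \<Rightarrow> real^3) set \<Rightarrow> (real^3 \<Rightarrow> real) set \<Rightarrow> (real^3 \<Rightarrow> real) set" where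
  "harmonic3 \<Omega> U P = {q\<in>P. \<forall>v\<in>U. l2_inner \<Omega> q (wdiv \<Omega> v) = 0}"

text \<open>
  The inclusions such as $\nabla A\subseteq W$ are inclusions of spaces of equivalence classes:
  some representative of the weak derivative is an element of the target space.
\<close>

definition stokes_complex ::
  "(real^3) set \<Rightarrow> (real^3) set set \<Rightarrow> (real^3 \<Rightarrow> real) set \<Rightarrow> (real^3 \<Rightarrow> real^3) set \<Rightarrow>
   (real^3 \<Rightarrow> real^3) set \<Rightarrow> (real^3 \<Rightarrow> real) set \<Rightarrow> bool" where
  "stokes_complex \<Omega> \<T> A W U P \<longleftrightarrow>
     fe_space \<Omega> \<T> A \<and> fe_space \<Omega> \<T> W \<and> fe_space \<Omega> \<T> U \<and> fe_space \<Omega> \<T> P \<and>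
     A \<subseteq> H0_grad \<Omega> \<and> W \<subseteq> H_grad_curl \<Omega> \<inter> H0_curl \<Omega> \<and> U \<subseteq> H1_vec \<Omega> \<inter> H0_div \<Omega> \<and>
     (\<forall>q\<in>P. l2_fun \<Omega> q) \<and>
     (\<forall>\<beta>\<in>A. \<exists>w\<in>W. has_weak_grad \<Omega> \<beta> w) \<and>
     (\<forall>w\<in>W. \<exists>v\<in>U. has_weak_curl \<Omega> w v) \<and>
     (\<forall>v\<in>U. \<exists>q\<in>P. has_weak_div \<Omega> v q) \<and>
     has_l2_dim \<Omega> (harmonic0 \<Omega> A) (betti 3 (top_of_set \<Omega>)) \<and>
     has_l2_dim \<Omega> (harmonic1 \<Omega> A W) (betti 2 (top_of_set \<Omega>)) \<and>
     has_l2_dim \<Omega> (harmonic2 \<Omega> W U) (betti 1 (top_of_set \<Omega>)) \<and>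
     has_l2_dim \<Omega> (harmonic3 \<Omega> U P) (betti 0 (top_of_set \<Omega>))"


section \<open>The semi-discrete scheme\<close>

text \<open>
  Time differentiability in the $L^2$ norm; on a finite-dimensional space this is
  differentiability with respect to any norm.
\<close>

definition C1_in_time ::
  "(real^3) set \<Rightarrow> real set \<Rightarrow> (real \<Rightarrow> real^3 \<Rightarrow> real^3) \<Rightarrow> (real \<Rightarrow> real^3 \<Rightarrow> real^3) \<Rightarrow> bool" where
  "C1_in_time \<Omega> I u u' \<longleftrightarrow> (\<forall>t\<in>I. l2_fun \<Omega> (u' t) \<and>
     ((\<lambda>s. l2_norm \<Omega> (\<lambda>x. (u s x - u t x) /\<^sub>R (s - t) - u' t x)) \<longlongrightarrow> 0) (at t within I) \<and>
     ((\<lambda>s. l2_norm \<Omega> (\<lambda>x. u' s x - u' t x)) \<longlongrightarrow> 0) (at t within I))"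

definition scheme_solution ::
  "(real^3) set \<Rightarrow> real \<Rightarrow> real set \<Rightarrow>
   (real^3 \<Rightarrow> real) set \<Rightarrow> (real^3 \<Rightarrow> real^3) set \<Rightarrow> (real^3 \<Rightarrow> real^3) set \<Rightarrow> (real^3 \<Rightarrow> real) set \<Rightarrow>
   (real \<Rightarrow> real^3 \<Rightarrow> real) \<Rightarrow> (real \<Rightarrow> real^3 \<Rightarrow> real^3) \<Rightarrow> (real \<Rightarrow> real^3 \<Rightarrow> real^3) \<Rightarrow>
   (real \<Rightarrow> real^3 \<Rightarrow> real^3) \<Rightarrow> (real \<Rightarrow> real^3 \<Rightarrow> real) \<Rightarrow> bool" where
  "scheme_solution \<Omega> Rey I A W U P \<alpha> \<omega> u u' p \<longleftrightarrow>
     C1_in_time \<Omega> I u u' \<and>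
     (\<forall>t\<in>I. \<alpha> t \<in> A \<and> \<omega> t \<in> W \<and> u t \<in> U \<and> p t \<in> P \<and>
       (\<forall>\<beta>\<in>A. 0 = l2_inner \<Omega> (\<omega> t) (wgrad \<Omega> \<beta>)) \<and>
       (\<forall>\<eta>\<in>W. l2_inner \<Omega> (wcurl \<Omega> (\<omega> t)) (wcurl \<Omega> \<eta>) =
          2 * l2_inner \<Omega> (sym_grad \<Omega> (u t)) (sym_grad \<Omega> (wcurl \<Omega> \<eta>))
          - l2_inner \<Omega> (wgrad \<Omega> (\<alpha> t)) \<eta>) \<and>
       (\<forall>v\<in>U. l2_inner \<Omega> (u' t) v =
          l2_inner \<Omega> (\<lambda>x. cross3 (u t x) (\<omega> t x)) v
          + l2_inner \<Omega> (\<lambda>x. (norm (u t x))\<^sup>2 / 2 + p t x) (wdiv \<Omega> v)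
          - 2 / Rey * l2_inner \<Omega> (sym_grad \<Omega> (u t)) (sym_grad \<Omega> v)) \<and>
       (\<forall>q\<in>P. 0 = l2_inner \<Omega> (wdiv \<Omega> (u t)) q))"

definition enstrophy :: "(real^3) set \<Rightarrow> (real^3 \<Rightarrow> real^3) \<Rightarrow> real" where
  "enstrophy \<Omega> v = (l2_norm \<Omega> (sym_grad \<Omega> v))\<^sup>2"

end

theory Submission
  imports Defs
begin

text \<open>
The enstrophy is a quadratic form in the velocity, so its time derivative is \<open>2 (\<epsilon>u, \<epsilon>v)\<close> with \<open>v\<close> the (projected) time
derivative of \<open>u\<close>. As \<open>u\<close> is divergence free at all times, so is \<open>v\<close>; the domain is contractible, so there are
no discrete harmonic 2-forms and \<open>v\<close> is the curl of some \<open>\<psi>\<close> in the discrete space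
(\<open>divergence_free_imp_curl\<close>). The multiplier \<open>\<alpha>\<close> has zero gradient, which is seen by testing the vorticity equation with
\<open>\<nabla>\<alpha>\<close>. That equation tested with \<open>\<psi>\<close> therefore says \<open>2 (\<epsilon>u, \<epsilon>v) = (curl \<omega>, v)\<close>. Now \<open>curl \<omega>\<close> is an
admissible test function in the momentum equation: the pressure drops out, the viscous term becomes
\<open>- 1/Re |curl \<omega>|\<^sup>2\<close> by the vorticity equation tested with \<open>\<omega>\<close>, and \<open>(u \<times> \<omega>, curl \<omega>)\<close> remains
(\<open>enstrophy_balance\<close>).

The remaining term is evaluated in \<open>nonlinear_term\<close>. On each cell all fields are smooth, and for divergence-free \<open>u\<close>
\<open>(u \<times> \<omega>) \<bullet> curl \<omega> = \<omega> \<bullet> \<epsilon>u \<omega> - \<omega> \<bullet> \<nabla>(u \<bullet> \<omega>) + 1/2 div(|\<omega>|\<^sup>2 u)\<close>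
holds pointwise (\<open>vorticity_identity\<close>). The divergence theorem turns the last summand into fluxes through the
facets of the cells. Since \<open>u\<close> has a weak gradient, its traces from both sides of an interior facet coincide
(\<open>weak_gradient_continuous_across_facets\<close>), and the two fluxes add up to the jump term; on the boundary the normal
trace of \<open>u\<close> is zero (\<open>normal_trace_vanishes\<close>).

Both statements about traces, like the flux computation, rest on the divergence theorem for polytopes (\<open>gauss\<close>). It is
obtained by multiplying the function with a smooth approximation of the indicator of the polytope, a product
of one ramp per facet, and using that a derivative of a function with bounded support integrates to zero; the derivative of the
ramp of a facet concentrates on that facet (\<open>facet_layer_limit\<close>). The identification of weak with classical derivatives inside
a cell is the fundamental lemma of the calculus of variations (\<open>fundamental_lemma\<close>).
\<close>

section \<open>Smooth ramps and integrals of derivatives\<close>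

(* The arrow of exact sequences would make the arrow of limits ambiguous. *)
no_notation exact_seq_arrow (\<open>(\<open>indent=3 notation=\<open>mixfix exact_seq\<close>\<close>_ / \<longlongrightarrow>\<index> _)\<close> [1000, 60])

text \<open>The functions \<open>p(1/s) exp(-1/s)\<close>, extended by zero to \<open>s \<le> 0\<close>, with an arbitrary polynomial \<open>p\<close>.
The polynomial is a parameter because differentiation stays inside this family; hence every member
is infinitely differentiable without any further induction on the shape of its derivatives.\<close>

definition flat_exp :: "real poly \<Rightarrow> real \<Rightarrow> real" where
  "flat_exp p s = (if s \<le> 0 then 0 else poly p (1 / s) * exp (- (1 / s)))"

lemma poly_div_exp_tendsto_0:
  fixes p :: "real poly"
  shows "((\<lambda>x. poly p x * exp (- x)) \<longlongrightarrow> 0) at_top"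
proof -
  have "((\<lambda>x. \<Sum>i\<le>Polynomial.degree p. Polynomial.coeff p i * (x ^ i / exp x)) \<longlongrightarrow> (\<Sum>i\<le>Polynomial.degree p. Polynomial.coeff p i * 0)) at_top"
    by (intro tendsto_sum tendsto_mult tendsto_const tendsto_power_div_exp_0)
  then show ?thesis
    by (simp add: poly_altdef exp_minus sum_distrib_right divide_inverse mult.assoc)
qed

lemma flat_exp_tendsto_0: "(flat_exp p \<longlongrightarrow> 0) (at_right 0)"
proof -
  have "((\<lambda>s. poly p (inverse s) * exp (- inverse s)) \<longlongrightarrow> 0) (at_right 0)"
    by (rule filterlim_compose[OF poly_div_exp_tendsto_0 filterlim_inverse_at_top_right])
  then show ?thesis
    by (rule Lim_transform_eventually)
       (auto simp: flat_exp_def eventually_at_right_less inverse_eq_divide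
             intro!: eventually_mono[OF eventually_at_right_less])
qed

text \<open>For \<open>s > 0\<close> this is the product rule with \<open>d(1/s)/ds = - 1/s\<^sup>2\<close>, which accounts for the factor \<open>[:0,0,1:]\<close>.
At the origin the difference quotient is again a member of the family, namely that of \<open>[:0,1:] * p\<close>,
and tends to zero.\<close>

lemma flat_exp_has_derivative:
  "(flat_exp p has_real_derivative flat_exp ([:0,0,1:] * (p - pderiv p)) s) (at s)"
proof -
  consider "s < 0" | "s = 0" | "s > 0" by linarith
  then show ?thesis
  proof cases
    case 1
    have "((\<lambda>_. 0) has_real_derivative 0) (at s)" by simp
    then have "(flat_exp p has_real_derivative 0) (at s)"
      by (rule has_field_derivative_transform_within_open[of _ _ _ "{..<0}"])
         (use 1 in \<open>auto simp: flat_exp_def\<close>)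
    then show ?thesis using 1 by (simp add: flat_exp_def)
  next
    case 3
    have "((\<lambda>s. poly p (1 / s) * exp (- (1 / s))) has_real_derivative
        (poly (pderiv p) (1/s) * (- 1 / s^2)) * exp (- (1/s)) + poly p (1/s) * (exp (- (1/s)) * (1 / s^2))) (at s)"
      using 3 by (auto intro!: derivative_eq_intros DERIV_chain2[OF poly_DERIV] simp: power2_eq_square)
    then have "(flat_exp p has_real_derivative
        (poly (pderiv p) (1/s) * (- 1 / s^2)) * exp (- (1/s)) + poly p (1/s) * (exp (- (1/s)) * (1 / s^2))) (at s)"
      by (rule has_field_derivative_transform_within_open[of _ _ _ "{0<..}"])
         (use 3 in \<open>auto simp: flat_exp_def\<close>)
    moreover have "(poly (pderiv p) (1/s) * (- 1 / s^2)) * exp (- (1/s)) + poly p (1/s) * (exp (- (1/s)) * (1 / s^2))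
       = flat_exp ([:0,0,1:] * (p - pderiv p)) s"
      using 3 by (simp add: flat_exp_def field_simps power2_eq_square)
    ultimately show ?thesis by simp
  next
    case 2
    \<comment> \<open>dividing by \<open>y\<close> multiplies the polynomial by its argument \<open>1/y\<close>\<close>
    have r: "((\<lambda>y. (flat_exp p y - flat_exp p 0) / (y - 0)) \<longlongrightarrow> 0) (at_right 0)"
      by (rule Lim_transform_eventually[OF flat_exp_tendsto_0[of "[:0,1:] * p"]])
         (auto simp: flat_exp_def intro!: eventually_mono[OF eventually_at_right_less])
    have l: "((\<lambda>y. (flat_exp p y - flat_exp p 0) / (y - 0)) \<longlongrightarrow> 0) (at_left 0)"
      by (rule Lim_transform_eventually[OF tendsto_const])
         (auto simp: flat_exp_def eventually_at_left_field intro!: exI[of _ "-1"])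
    show ?thesis
      using filterlim_split_at[OF l r] 2
      by (simp add: has_field_derivative_iff flat_exp_def)
  qed
qed

lemma continuous_flat_exp: "continuous_on S (flat_exp p)"
  using flat_exp_has_derivative by (meson DERIV_isCont continuous_at_imp_continuous_on)

text \<open>\<open>ramp\<close> rises smoothly from 0 to its supremum 1, so that \<open>ramp (k * s)\<close> approximates the indicator
of \<open>s > 0\<close>, while its derivative is a probability density on \<open>s > 0\<close>.\<close>

abbreviation ramp :: "real \<Rightarrow> real" where "ramp \<equiv> flat_exp 1"
abbreviation ramp' :: "real \<Rightarrow> real" where "ramp' \<equiv> flat_exp [:0,0,1:]"

lemma ramp_has_derivative: "(ramp has_real_derivative ramp' s) (at s)"
  using flat_exp_has_derivative[of 1 s] by simp

lemma ramp_bounds: "0 \<le> ramp s" "ramp s \<le> 1"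
  by (auto simp: flat_exp_def)

lemma ramp_eq_0: "s \<le> 0 \<Longrightarrow> ramp s = 0" and ramp_pos: "s > 0 \<Longrightarrow> ramp s > 0"
  by (auto simp: flat_exp_def)

lemma ramp'_nonneg: "0 \<le> ramp' s"
  by (auto simp: flat_exp_def)

lemma ramp_at_top: "(ramp \<longlongrightarrow> 1) at_top"
proof -
  have "((\<lambda>s::real. exp (- (inverse s))) \<longlongrightarrow> exp (- 0)) at_top"
    by (intro tendsto_intros tendsto_inverse_0_at_top filterlim_ident)
  moreover have "eventually (\<lambda>s. exp (- inverse s) = ramp s) at_top"
    by (rule eventually_mono[OF eventually_gt_at_top[of 0]]) (auto simp: flat_exp_def inverse_eq_divide)
  ultimately show ?thesis
    by (simp add: tendsto_cong)
qed

lemma ramp'_integral: "integrable lborel ramp'" "(LINT s|lborel. ramp' s) = 1"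
proof -
  have measurable_ramp': "ramp' \<in> borel_measurable borel"
    by (intro borel_measurable_continuous_onI continuous_flat_exp)
  have b: "has_bochner_integral lborel (\<lambda>s. ramp' s * indicator {0..} s) 1"
  proof (rule has_bochner_integral_nn_integral)
    have "(\<integral>\<^sup>+x. ennreal (ramp' x) * indicator {0..} x \<partial>lborel) = ennreal (1 - ramp 0)"
      by (rule nn_integral_FTC_atLeast)
         (auto intro!: borel_measurable_continuous_onI continuous_flat_exp
            ramp_has_derivative ramp'_nonneg ramp_at_top)
    then show "(\<integral>\<^sup>+x. ennreal (ramp' x * indicator {0..} x) \<partial>lborel) = ennreal 1"
      by (simp add: ennreal_mult'' ennreal_indicator ramp_eq_0)
  qed (auto intro!: borel_measurable_times measurable_ramp' simp: ramp'_nonneg)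
  have "(\<lambda>s. ramp' s * indicator {0..} s) = ramp'"
    by (auto simp: flat_exp_def indicator_def)
  with b show "integrable lborel ramp'" "(LINT s|lborel. ramp' s) = 1"
    by (auto simp: has_bochner_integral_iff)
qed

lemma integrable_continuous_bounded_support:
  fixes f :: "'a::euclidean_space \<Rightarrow> 'b::euclidean_space"
  assumes "continuous_on UNIV f" "\<And>x. x \<notin> cball 0 R \<Longrightarrow> f x = 0"
  shows "integrable lborel f"
proof -
  have "integrable lborel (\<lambda>x. indicator (cball 0 R) x *\<^sub>R f x)"
    by (intro borel_integrable_compact) (auto intro: continuous_on_subset assms)
  moreover have "(\<lambda>x. indicator (cball 0 R) x *\<^sub>R f x) = f"
    using assms(2) by (auto simp: indicator_def)
  ultimately show ?thesis by (simp only:)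
qed

text \<open>The source of every integration by parts below. The difference quotients
\<open>(g (x + h v) - g x) / h\<close> integrate to zero by translation invariance of Lebesgue measure, and
they converge boundedly, with uniformly bounded supports, to the derivative in direction \<open>v\<close>.\<close>

lemma integral_directional_derivative_eq_0:
  fixes g :: "'a::euclidean_space \<Rightarrow> real"
  assumes der: "\<And>x. (g has_derivative g' x) (at x)"
    and cont: "continuous_on UNIV (\<lambda>x. g' x v)"
    and supp: "\<And>x. x \<notin> cball 0 R \<Longrightarrow> g x = 0"
  shows "(LINT x|lborel. g' x v) = 0"
proof -
  have contg: "continuous_on UNIV g"
    by (intro continuous_at_imp_continuous_on ballI has_derivative_continuous[OF der])
  have supp': "g' x v = 0" if "x \<notin> cball 0 R" for x
  proof -
    have "((\<lambda>_. 0) has_derivative (\<lambda>_. 0)) (at x)" by simp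
    then have "(g has_derivative (\<lambda>_. 0)) (at x)"
      by (rule has_derivative_transform_within_open[of _ _ _ _ "- cball 0 R"])
         (use that supp in \<open>auto simp: open_Compl\<close>)
    then show ?thesis using has_derivative_unique[OF der] by metis
  qed
  have "bounded ((\<lambda>x. g' x v) ` cball 0 R)"
    by (intro compact_imp_bounded compact_continuous_image) (auto intro: continuous_on_subset cont)
  then obtain C where C: "\<And>x. x \<in> cball 0 R \<Longrightarrow> \<bar>g' x v\<bar> \<le> C"
    unfolding bounded_iff by (metis image_eqI real_norm_def)
  define D where "D = max C 0"
  have D: "\<bar>g' x v\<bar> \<le> D" for x
    using C[of x] supp'[of x] by (cases "x \<in> cball 0 R") (auto simp: D_def)
  define h where "h n = 1 / real (Suc n)" for n
  have h: "0 < h n" "h n \<le> 1" for n by (auto simp: h_def)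
  have h0: "h \<longlonglongrightarrow> 0" unfolding h_def by (rule LIMSEQ_Suc[OF lim_1_over_n])
  define q where "q n x = (g (h n *\<^sub>R v + x) - g x) / h n" for n x
  have line: "((\<lambda>t. g (t *\<^sub>R v + x)) has_real_derivative g' (t *\<^sub>R v + x) v) (at t within S)" for t x S
  proof -
    have "((\<lambda>t. g (t *\<^sub>R v + x)) has_derivative (\<lambda>dt. g' (t *\<^sub>R v + x) (dt *\<^sub>R v))) (at t within S)"
      by (rule has_derivative_compose[OF _ der]) (auto intro!: derivative_eq_intros)
    moreover have "(\<lambda>dt. g' (t *\<^sub>R v + x) (dt *\<^sub>R v)) = (*) (g' (t *\<^sub>R v + x) v)"
      using linear_scale[OF has_derivative_linear[OF der]] by (auto simp: mult.commute)
    ultimately show ?thesis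
      unfolding has_field_derivative_def by simp
  qed
  have bound: "norm (q n x) \<le> D * indicator (cball 0 (R + norm v)) x" for n x
  proof (cases "x \<in> cball 0 (R + norm v)")
    case True
    have "norm (g (h n *\<^sub>R v + x) - g (0 *\<^sub>R v + x)) \<le> D * norm (h n - 0)"
      by (rule field_differentiable_bound[of UNIV "\<lambda>t. g (t *\<^sub>R v + x)" "\<lambda>t. g' (t *\<^sub>R v + x) v"])
         (use line D in auto)
    then show ?thesis using True h[of n] by (simp add: q_def divide_simps)
  next
    case False
    have "norm x \<le> norm (h n *\<^sub>R v + x) + norm (h n *\<^sub>R v)"
      using norm_triangle_ineq4[of "h n *\<^sub>R v + x" "h n *\<^sub>R v"] by simp
    moreover have "norm (h n *\<^sub>R v) \<le> norm v" using h[of n] by (simp add: mult_left_le_one_le)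
    moreover have "R + norm v < norm x" "0 \<le> norm v" using False by simp_all
    ultimately have "R < norm x" "R < norm (h n *\<^sub>R v + x)" by linarith+
    then have "x \<notin> cball 0 R" "h n *\<^sub>R v + x \<notin> cball 0 R" by simp_all
    then show ?thesis using False supp by (simp add: q_def)
  qed
  have int: "integrable lborel g"
    by (rule integrable_continuous_bounded_support[OF contg supp])
  have shift: "integrable lborel (\<lambda>x. g (h n *\<^sub>R v + x))" "(LINT x|lborel. g (h n *\<^sub>R v + x)) = (LINT x|lborel. g x)" for n
  proof -
    have m: "g \<in> borel_measurable borel" using contg borel_measurable_continuous_onI by blast
    have "integrable (distr lborel borel ((+) (h n *\<^sub>R v))) g" using int by (simp add: lborel_distr_plus)
    then show "integrable lborel (\<lambda>x. g (h n *\<^sub>R v + x))"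
      by (subst (asm) integrable_distr_eq) (auto simp: m)
    have "(LINT x|distr lborel borel ((+) (h n *\<^sub>R v)). g x) = (LINT x|lborel. g (h n *\<^sub>R v + x))"
      by (rule integral_distr) (auto simp: m)
    then show "(LINT x|lborel. g (h n *\<^sub>R v + x)) = (LINT x|lborel. g x)"
      by (simp add: lborel_distr_plus)
  qed
  have "(\<lambda>n. LINT x|lborel. q n x) \<longlonglongrightarrow> (LINT x|lborel. g' x v)"
  proof (rule integral_dominated_convergence[where w = "\<lambda>x. D * indicator (cball 0 (R + norm v)) x"])
    show "(\<lambda>x. g' x v) \<in> borel_measurable lborel"
      using cont borel_measurable_continuous_onI by auto
    show "q n \<in> borel_measurable lborel" for n
      unfolding q_def using contg
      by (auto intro!: borel_measurable_continuous_onI continuous_intros continuous_on_compose2[OF contg] simp: h_def)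
    show "integrable lborel (\<lambda>x. D * indicator (cball 0 (R + norm v)) x)"
      by (intro integrable_mult_right integrable_real_indicator emeasure_lborel_cball_finite) simp
    show "AE x in lborel. (\<lambda>n. q n x) \<longlonglongrightarrow> g' x v"
    proof (rule AE_I2)
      fix x
      have "((\<lambda>t. (g (t *\<^sub>R v + x) - g (0 *\<^sub>R v + x)) / (t - 0)) \<longlongrightarrow> g' (0 *\<^sub>R v + x) v) (at 0)"
        using line[of x 0 UNIV] by (simp add: has_field_derivative_iff)
      moreover have "filterlim h (at 0) sequentially"
        using h(1) by (intro filterlim_atI h0) (auto intro!: always_eventually simp: less_imp_neq[symmetric])
      ultimately show "(\<lambda>n. q n x) \<longlonglongrightarrow> g' x v"
        unfolding q_def by (auto dest: filterlim_compose)
    qed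
    show "AE x in lborel. norm (q n x) \<le> D * indicator (cball 0 (R + norm v)) x" for n
      using bound by blast
  qed
  moreover have "(LINT x|lborel. q n x) = 0" for n
    unfolding q_def using shift[of n] int by simp
  ultimately show ?thesis by (simp add: LIMSEQ_const_iff)
qed

section \<open>Facets of a solid polytope\<close>

text \<open>Two unit vectors with the same hyperplane agree up to sign. The point \<open>b n\<close> and its shift by the part
of \<open>n'\<close> orthogonal to \<open>n\<close> both lie on the first plane, so that part is orthogonal to \<open>n'\<close> as well, hence zero.\<close>

lemma unit_normals_parallel:
  fixes n n' :: "'a::euclidean_space"
  assumes n: "norm n = 1" and n': "norm n' = 1"
    and sub: "{x. n \<bullet> x = b} \<subseteq> {x. n' \<bullet> x = b'}"
  shows "n' = n \<and> b' = b \<or> n' = - n \<and> b' = - b"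
proof -
  have nn: "n \<bullet> n = 1" "n' \<bullet> n' = 1" using n n' by (auto simp: dot_square_norm)
  define c where "c = n \<bullet> n'"
  have "b *\<^sub>R n \<in> {x. n' \<bullet> x = b'}" using nn by (intro subsetD[OF sub]) auto
  then have p: "n' \<bullet> (b *\<^sub>R n) = b'" by simp
  have "n' \<bullet> (b *\<^sub>R n + (n' - c *\<^sub>R n)) = b'"
    using subsetD[OF sub, of "b *\<^sub>R n + (n' - c *\<^sub>R n)"] nn by (simp add: c_def inner_add inner_diff)
  with p have "n' \<bullet> (n' - c *\<^sub>R n) = 0" by (simp add: inner_add)
  then have c2: "c * c = 1" using nn by (simp add: inner_diff c_def inner_commute)
  have "(n' - c *\<^sub>R n) \<bullet> (n' - c *\<^sub>R n) = 1 - c * c"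
    using nn by (simp add: inner_diff c_def inner_commute algebra_simps)
  with c2 have eq: "n' = c *\<^sub>R n" by simp
  from c2 have "c = 1 \<or> c = - 1" by (simp add: square_eq_1_iff)
  with eq p nn show ?thesis by auto
qed

definition facet_offset :: "(real^3) set \<Rightarrow> (real^3) set \<Rightarrow> real" where
  "facet_offset K F = (THE b. \<forall>x\<in>F. facet_normal K F \<bullet> x = b)"

locale solid_polytope =
  fixes K :: "(real^3) set"
  assumes polytope: "polytope K" and solid: "interior K \<noteq> {}"
begin

lemma convex: "convex K" and compact: "compact K" and polyhedron: "polyhedron K"
  and closed: "closed K" and bounded: "bounded K"
  using polytope polytope_imp_convex polytope_imp_compact polytope_imp_polyhedron
    compact_imp_closed compact_imp_bounded by blast+

lemma finite_facets: "finite {F. F facet_of K}"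
  using finite_polytope_facets polytope by blast

lemma facet_dim: "F facet_of K \<Longrightarrow> aff_dim F = 2"
  using aff_dim_nonempty_interior[OF solid] by (simp add: facet_of_def)

lemma affine_hull_facet_eq:
  assumes "F facet_of K" and n: "n \<noteq> 0" and F: "F \<subseteq> {x. n \<bullet> x = b}"
  shows "affine hull F = {x. n \<bullet> x = b}"
proof (rule affine_dim_equal)
  show "affine hull F \<noteq> {}" using assms(1) by (simp add: facet_of_def)
  show "affine hull F \<subseteq> {x. n \<bullet> x = b}"
    using F affine_hyperplane by (metis hull_minimal)
  show "aff_dim (affine hull F) = aff_dim {x. n \<bullet> x = b}"
    using facet_dim[OF assms(1)] n by (simp add: aff_dim_hyperplane)
qed (auto simp: affine_hyperplane)

text \<open>The affine hull of a facet is a plane, which leaves only the two unit normals \<open>n\<close> and \<open>-n\<close>; if both were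
outward, the polytope would lie in the plane and have no interior.\<close>

lemma facet_normal_unique_existence:
  assumes F: "F facet_of K"
  shows "\<exists>!n. norm n = 1 \<and> (\<exists>b. (\<forall>x\<in>F. n \<bullet> x = b) \<and> (\<forall>x\<in>K. n \<bullet> x \<le> b))"
proof -
  obtain a b where ab: "a \<noteq> 0" "K \<subseteq> {x. a \<bullet> x \<le> b}" "F = K \<inter> {x. a \<bullet> x = b}"
    using facet_of_polyhedron[OF polyhedron F] by metis
  have "norm (a /\<^sub>R norm a) = 1 \<and>
     (\<exists>b. (\<forall>x\<in>F. (a /\<^sub>R norm a) \<bullet> x = b) \<and> (\<forall>x\<in>K. (a /\<^sub>R norm a) \<bullet> x \<le> b))"
  proof (intro conjI exI[of _ "b / norm a"] ballI)
    show "(a /\<^sub>R norm a) \<bullet> x \<le> b / norm a" if "x \<in> K" for x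
      using ab(1,2) that by (auto simp: divide_inverse mult.commute intro: mult_left_mono)
  qed (use ab in \<open>auto simp: divide_inverse\<close>)
  moreover have "n' = n"
    if n: "norm n = 1" and n': "norm n' = 1"
      and b: "\<forall>x\<in>F. n \<bullet> x = b" "\<forall>x\<in>K. n \<bullet> x \<le> b"
      and b': "\<forall>x\<in>F. n' \<bullet> x = b'" "\<forall>x\<in>K. n' \<bullet> x \<le> b'" for n n' b b'
  proof (rule ccontr)
    assume "n' \<noteq> n"
    have "affine hull F = {x. n \<bullet> x = b}" "affine hull F = {x. n' \<bullet> x = b'}"
      by (rule affine_hull_facet_eq[OF F]; use n n' b b' in force)+
    with unit_normals_parallel[OF n n'] \<open>n' \<noteq> n\<close> have "n' = - n" "b' = - b" by auto
    then have "K \<subseteq> {x. n \<bullet> x = b}" using b(2) b'(2) by fastforce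
    then have "interior K \<subseteq> interior {x. n \<bullet> x = b}" by (rule interior_mono)
    moreover have "n \<noteq> 0" using n by auto
    ultimately show False using solid interior_hyperplane by blast
  qed
  ultimately show ?thesis by blast
qed

lemma
  assumes F: "F facet_of K"
  shows norm_facet_normal: "norm (facet_normal K F) = 1"
    and facet_plane: "x \<in> F \<Longrightarrow> facet_normal K F \<bullet> x = facet_offset K F"
    and facet_halfspace: "x \<in> K \<Longrightarrow> facet_normal K F \<bullet> x \<le> facet_offset K F"
proof -
  let ?n = "facet_normal K F"
  obtain b where *: "norm ?n = 1" "\<forall>x\<in>F. ?n \<bullet> x = b" "\<forall>x\<in>K. ?n \<bullet> x \<le> b"
    using theI'[OF facet_normal_unique_existence[OF F]] unfolding facet_normal_def by blast
  obtain y where "y \<in> F" using F by (auto simp: facet_of_def)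
  with * have "facet_offset K F = b"
    unfolding facet_offset_def by (intro the_equality) auto
  with * show "norm ?n = 1" "x \<in> F \<Longrightarrow> ?n \<bullet> x = facet_offset K F"
    "x \<in> K \<Longrightarrow> ?n \<bullet> x \<le> facet_offset K F" by auto
qed

lemma facet_normal_nz: "F facet_of K \<Longrightarrow> facet_normal K F \<noteq> 0"
  using norm_facet_normal by fastforce

lemma affine_hull_facet:
  assumes "F facet_of K"
  shows "affine hull F = {x. facet_normal K F \<bullet> x = facet_offset K F}"
  using affine_hull_facet_eq[OF assms facet_normal_nz[OF assms]] facet_plane[OF assms] by auto

lemma facet_eq:
  assumes F: "F facet_of K"
  shows "F = K \<inter> {x. facet_normal K F \<bullet> x = facet_offset K F}"
proof -
  have "F = K \<inter> affine hull F"
    using face_of_imp_eq_affine_Int[OF convex facet_of_imp_face_of[OF F]] by blast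
  then show ?thesis using affine_hull_facet[OF F] by simp
qed

lemma facet_subset_imp_eq:
  assumes "F facet_of K" "F' facet_of K" "F \<subseteq> F'" shows "F = F'"
proof (rule ccontr)
  assume "F \<noteq> F'"
  have "F face_of F'"
    using assms facet_of_imp_face_of facet_of_imp_subset face_of_subset by metis
  then have "aff_dim F < aff_dim F'"
    using \<open>F \<noteq> F'\<close> assms(2) convex face_of_aff_dim_lt face_of_imp_convex facet_of_imp_face_of by metis
  then show False using facet_dim assms by simp
qed

lemma facet_planes_distinct:
  assumes F: "F facet_of K" "F' facet_of K"
    and "{x. facet_normal K F \<bullet> x = facet_offset K F} \<subseteq> {x. facet_normal K F' \<bullet> x = facet_offset K F'}"
  shows "F = F'"
  using assms(3) facet_eq[OF F(1)] facet_eq[OF F(2)] by (intro facet_subset_imp_eq F) blast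

lemma interior_eq_Diff_facets: "interior K = K - \<Union> {F. F facet_of K}"
  using rel_boundary_of_polyhedron[OF polyhedron] rel_interior_nonempty_interior[OF solid]
    rel_interior_subset[of K] by auto

text \<open>The segment from an interior point to \<open>x\<close> leaves the polytope through some facet; being affine and
negative at the start, \<open>n \<bullet> y - b\<close> for that facet vanishes at the exit point and is positive at \<open>x\<close>.
This turns the facial description of the polytope into the intersection of the half-spaces of its facets.\<close>

lemma outside_violates_facet:
  assumes "x \<notin> K"
  shows "\<exists>F. F facet_of K \<and> facet_normal K F \<bullet> x > facet_offset K F"
proof -
  obtain z where z: "z \<in> interior K" using solid by auto
  have "closed_segment z x \<inter> frontier K \<noteq> {}"
    by (rule connected_Int_frontier) (use z assms interior_subset in auto)
  then obtain y where y: "y \<in> closed_segment z x" "y \<in> frontier K" by auto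
  then have "y \<in> K - interior K" using closed by (simp add: frontier_def)
  then obtain F where F: "F facet_of K" "y \<in> F" using interior_eq_Diff_facets by auto
  obtain s where s: "0 \<le> s" "s \<le> 1" "y = (1 - s) *\<^sub>R z + s *\<^sub>R x"
    using y(1) by (auto simp: in_segment)
  let ?n = "facet_normal K F" and ?b = "facet_offset K F"
  have "?n \<bullet> z \<noteq> ?b"
    using facet_eq[OF F(1)] z interior_eq_Diff_facets F(1) by auto
  then have nz: "?n \<bullet> z < ?b" using facet_halfspace[OF F(1)] z interior_subset by fastforce
  have "(1 - s) * (?n \<bullet> z) + s * (?n \<bullet> x) = ?b"
    using facet_plane[OF F] s(3) by (simp add: inner_add)
  then have e: "s * (?n \<bullet> x - ?b) = (1 - s) * (?b - ?n \<bullet> z)" by (simp add: algebra_simps)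
  have "?n \<bullet> x > ?b"
  proof (rule ccontr)
    assume "\<not> ?n \<bullet> x > ?b"
    then have "s * (?n \<bullet> x - ?b) \<le> 0" using s by (simp add: mult_nonneg_nonpos)
    moreover have "(1 - s) * (?b - ?n \<bullet> z) \<ge> 0" using s nz by simp
    ultimately have "(1 - s) * (?b - ?n \<bullet> z) = 0" using e by linarith
    then have "s = 1" using nz by simp
    then have "y = x" using s by simp
    then show False using y(2) assms closed by (simp add: frontier_def)
  qed
  then show ?thesis using F by blast
qed

lemma mem_iff_halfspaces: "x \<in> K \<longleftrightarrow> (\<forall>F. F facet_of K \<longrightarrow> facet_normal K F \<bullet> x \<le> facet_offset K F)"
  using outside_violates_facet[of x] facet_halfspace[of _ x] by fastforce

lemma interior_iff_halfspaces:
  "x \<in> interior K \<longleftrightarrow> (\<forall>F. F facet_of K \<longrightarrow> facet_normal K F \<bullet> x < facet_offset K F)"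
proof -
  have "x \<in> interior K \<longleftrightarrow> x \<in> K \<and> (\<forall>F. F facet_of K \<longrightarrow> facet_normal K F \<bullet> x \<noteq> facet_offset K F)"
    using interior_eq_Diff_facets facet_eq by blast
  then show ?thesis using mem_iff_halfspaces by (auto simp: less_le)
qed

end

section \<open>The Gauss theorem on a polytope\<close>

text \<open>The chart is chosen by Hilbert choice among the isometric parametrisations of the plane; one such is
\<open>y \<mapsto> b n + f y\<close> with \<open>f\<close> a linear isometry onto the plane through the origin.\<close>

lemma
  fixes n :: "real^3"
  assumes n: "norm n = 1" and F: "affine hull F = {x. n \<bullet> x = b}"
  shows plane_chart_dist: "dist (plane_chart F y) (plane_chart F z) = dist y z"
    and plane_chart_range: "range (plane_chart F) = {x. n \<bullet> x = b}"
proof -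
  have nz: "n \<noteq> 0" using n by auto
  have nn: "n \<bullet> n = 1" using n by (simp add: dot_square_norm)
  obtain f :: "real^2 \<Rightarrow> real^3" where f: "linear f" "range f = {x. n \<bullet> x = 0}"
      "\<And>x. norm (f x) = norm x"
  proof (rule isometry_subspaces[of "UNIV :: (real^2) set" "{x. n \<bullet> x = 0}"])
    show "dim (UNIV :: (real^2) set) = dim {x. n \<bullet> x = 0}"
      using dim_hyperplane[OF nz] by simp
  qed (auto intro: subspace_hyperplane)
  define \<phi> where "\<phi> y = b *\<^sub>R n + f y" for y
  have "dist (\<phi> y) (\<phi> z) = dist y z" for y z
    using f(3)[of "y - z"] by (simp add: \<phi>_def dist_norm linear_diff[OF f(1)])
  moreover have "range \<phi> = {x. n \<bullet> x = b}"
  proof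
    show "range \<phi> \<subseteq> {x. n \<bullet> x = b}"
      using f(2) nn by (auto simp: \<phi>_def inner_add)
    show "{x. n \<bullet> x = b} \<subseteq> range \<phi>"
    proof
      fix x assume "x \<in> {x. n \<bullet> x = b}"
      then have "x - b *\<^sub>R n \<in> range f" using f(2) nn by (simp add: inner_diff)
      then obtain y where "x - b *\<^sub>R n = f y" by auto
      then have "x = \<phi> y" by (simp add: \<phi>_def algebra_simps)
      then show "x \<in> range \<phi>" by auto
    qed
  qed
  ultimately have "(\<forall>y z. dist (\<phi> y) (\<phi> z) = dist y z) \<and> range \<phi> = affine hull F"
    using F by simp
  then have "\<exists>\<phi> :: real^2 \<Rightarrow> real^3. (\<forall>y z. dist (\<phi> y) (\<phi> z) = dist y z) \<and> range \<phi> = affine hull F"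
    by - (rule exI[where x = \<phi>], assumption)
  then have "(\<forall>y z. dist (plane_chart F y) (plane_chart F z) = dist y z) \<and> range (plane_chart F) = affine hull F"
    unfolding plane_chart_def by (rule someI_ex)
  then show "dist (plane_chart F y) (plane_chart F z) = dist y z" "range (plane_chart F) = {x. n \<bullet> x = b}"
    using F by simp_all
qed

text \<open>By polarisation distances determine inner products, and then the squared norms of the defects of
additivity and homogeneity expand to zero.\<close>

lemma isometry_linear_general:
  fixes f :: "'a::real_inner \<Rightarrow> 'b::real_inner"
  assumes f0: "f 0 = 0" and fd: "\<And>x y. dist (f x) (f y) = dist x y"
  shows "linear f" "f v \<bullet> f w = v \<bullet> w"
proof -
  have nf: "norm (f x) = norm x" for x
    using fd[of x 0] f0 by simp
  have ip: "f v \<bullet> f w = v \<bullet> w" for v w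
    unfolding dot_norm_neg using fd[of v w] nf by (simp add: dist_norm)
  then show "f v \<bullet> f w = v \<bullet> w" .
  show "linear f"
  proof
    fix x y c
    have "(f (x + y) - f x - f y) \<bullet> (f (x + y) - f x - f y) = 0"
      by (simp add: inner_diff inner_add ip inner_commute)
    then have "f (x + y) - f x - f y = 0" unfolding inner_eq_zero_iff .
    then show "f (x + y) = f x + f y" by (simp add: algebra_simps)
    have "(f (c *\<^sub>R x) - c *\<^sub>R f x) \<bullet> (f (c *\<^sub>R x) - c *\<^sub>R f x) = 0"
      by (simp add: inner_diff ip inner_commute)
    then show "f (c *\<^sub>R x) = c *\<^sub>R f x" by simp
  qed
qed

lemma lborel_orthogonal:
  fixes f :: "real^3 \<Rightarrow> real^3"
  assumes f: "orthogonal_transformation f"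
  shows "distr lborel borel f = lborel"
proof (rule lborel_eqI[symmetric])
  have lin: "linear f" using f orthogonal_transformation_linear by blast
  then have m: "f \<in> borel_measurable lborel"
    by (simp add: borel_measurable_continuous_onI linear_continuous_on linear_conv_bounded_linear)
  have bij: "bij f" using f orthogonal_transformation_bij by blast
  have f': "orthogonal_transformation (inv_into UNIV f)" using f orthogonal_transformation_inv by blast
  fix l u :: "real^3" assume lu: "\<And>b. b \<in> Basis \<Longrightarrow> l \<bullet> b \<le> u \<bullet> b"
  have v: "f -` box l u = inv_into UNIV f ` box l u" using bij bij_vimage_eq_inv_image by blast
  have b: "f -` box l u \<in> sets borel" using measurable_sets[OF m, of "box l u"] by simp
  have lm: "inv_into UNIV f ` box l u \<in> lmeasurable" by (rule measurable_orthogonal_image[OF f']) simp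
  have "emeasure (distr lborel borel f) (box l u) = emeasure lborel (f -` box l u)"
    by (subst emeasure_distr) (use m in auto)
  also have "\<dots> = emeasure lebesgue (inv_into UNIV f ` box l u)" using b v by simp
  also have "\<dots> = measure lebesgue (inv_into UNIV f ` box l u)" using lm by (simp add: emeasure_eq_measure2)
  also have "\<dots> = measure lebesgue (box l u)" by (simp add: measure_orthogonal_image[OF f'])
  also have "\<dots> = emeasure lborel (box l u)"
    by (simp add: emeasure_eq_measure2)
  finally show "emeasure (distr lborel borel f) (box l u) = ennreal (\<Prod>b\<in>Basis. (u - l) \<bullet> b)"
    using lu by simp
qed simp

lemma Basis_real2: "(Basis :: (real^2) set) = {axis 1 1, axis 2 1}"
  by (auto simp: Basis_vec_def UNIV_2)

lemma Basis_real3: "(Basis :: (real^3) set) = {axis 1 1, axis 2 1, axis 3 1}"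
  by (auto simp: Basis_vec_def UNIV_3)

lemma lborel_real2_times_real:
  "distr lborel borel (\<lambda>(y::real^2, s). vector [y $ 1, y $ 2, s] :: real^3) = lborel" (is "distr _ _ ?J = _")
proof (rule lborel_eqI[symmetric])
  fix l u :: "real^3" assume lu: "\<And>b. b \<in> Basis \<Longrightarrow> l \<bullet> b \<le> u \<bullet> b"
  then have lu': "l $ i \<le> u $ i" for i
    using lu[of "axis i 1"] by (simp add: inner_axis axis_in_Basis_iff)
  have m: "?J \<in> borel_measurable lborel"
  proof -
    have "continuous_on UNIV ?J"
      unfolding case_prod_beta by (subst continuous_on_componentwise) (simp add: Basis_vec_def inner_axis forall_3 continuous_intros)
    then show ?thesis by (simp add: borel_measurable_continuous_onI)
  qed
  have v: "?J -` box l u = box (vector [l $ 1, l $ 2]) (vector [u $ 1, u $ 2]) \<times> box (l $ 3) (u $ 3)"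
    by (auto simp: mem_box_cart forall_3 forall_2)
  have "emeasure (distr lborel borel ?J) (box l u) =
      emeasure lborel (box (vector [l $ 1, l $ 2] :: real^2) (vector [u $ 1, u $ 2]) \<times> box (l $ 3) (u $ 3))"
    by (subst emeasure_distr) (use m v in auto)
  also have "\<dots> = emeasure lborel (box (vector [l $ 1, l $ 2] :: real^2) (vector [u $ 1, u $ 2])) * emeasure lborel (box (l $ 3) (u $ 3))"
    by (simp only: lborel_prod[symmetric], rule lborel.emeasure_pair_measure_Times) auto
  also have "emeasure lborel (box (vector [l $ 1, l $ 2] :: real^2) (vector [u $ 1, u $ 2]))
      = ennreal ((u $ 1 - l $ 1) * (u $ 2 - l $ 2))"
    by (subst emeasure_lborel_box)
       (use lu' in \<open>auto simp: Basis_real2 inner_axis forall_2 axis_eq_axis\<close>)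
  also have "emeasure lborel (box (l $ 3) (u $ 3)) = ennreal (u $ 3 - l $ 3)"
    using lu' by simp
  also have "ennreal ((u $ 1 - l $ 1) * (u $ 2 - l $ 2)) * ennreal (u $ 3 - l $ 3) = ennreal (\<Prod>b\<in>Basis. (u - l) \<bullet> b)"
    using lu' by (simp add: ennreal_mult' mult.assoc Basis_real3 inner_axis axis_eq_axis)
  finally show "emeasure (distr lborel borel ?J) (box l u) = ennreal (\<Prod>b\<in>Basis. (u - l) \<bullet> b)" .
qed simp

text \<open>The coordinates \<open>(y, s) \<mapsto> \<phi> y - s n\<close>, with \<open>s\<close> the depth below the plane, transport Lebesgue measure to Lebesgue
measure, because after identifying the product with three-space they are a rotation followed by a translation.
They reduce integrals over a layer along a facet to iterated integrals.\<close>

lemma lborel_plane_chart: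
  fixes n :: "real^3"
  assumes n: "norm n = 1" and F: "affine hull F = {x. n \<bullet> x = b}"
  defines "S \<equiv> \<lambda>p::(real^2) \<times> real. plane_chart F (fst p) - snd p *\<^sub>R n"
  shows "continuous_on UNIV S" "distr lborel borel S = lborel"
    "norm (S p - plane_chart F 0) = norm p"
    "linear (\<lambda>y. plane_chart F y - plane_chart F 0)"
    "n \<bullet> plane_chart F y = b"
proof -
  let ?\<phi> = "plane_chart F"
  define L where "L y = ?\<phi> y - ?\<phi> 0" for y
  have iso: "linear L" "L v \<bullet> L w = v \<bullet> w" for v w
    using isometry_linear_general(1)[of L] isometry_linear_general(2)[of L v w] plane_chart_dist[OF n F]
    by (simp_all add: L_def dist_norm)
  then show "linear (\<lambda>y. ?\<phi> y - ?\<phi> 0)" by (simp add: L_def[abs_def])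
  have pl: "n \<bullet> ?\<phi> y = b" for y using plane_chart_range[OF n F] by blast
  then show "n \<bullet> ?\<phi> y = b" .
  have orth: "n \<bullet> L y = 0" for y by (simp add: L_def inner_diff pl)
  have nn: "n \<bullet> n = 1" using n by (simp add: dot_square_norm)
  have Seq: "S p = ?\<phi> 0 + (L (fst p) - snd p *\<^sub>R n)" for p by (simp add: S_def L_def)
  have Lc: "continuous_on UNIV L" using iso(1) by (simp add: linear_continuous_on linear_conv_bounded_linear)
  show cS: "continuous_on UNIV S" unfolding Seq
    by (intro continuous_intros continuous_on_compose2[OF Lc]) auto
  show "norm (S p - ?\<phi> 0) = norm p"
  proof -
    have "(L (fst p) - snd p *\<^sub>R n) \<bullet> (L (fst p) - snd p *\<^sub>R n) = p \<bullet> p"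
      using iso(2)[of "fst p" "fst p"] orth[of "fst p"] nn
      by (simp add: inner_diff inner_commute[of "L (fst p)" n] inner_prod_def)
    then show ?thesis by (simp add: Seq norm_eq_sqrt_inner)
  qed
  \<comment> \<open>\<open>J\<close> glues the two coordinates together and \<open>T\<close> is the rotation; \<open>V\<close> recovers the planar part\<close>
  define J where "J = (\<lambda>(y::real^2, s). vector [y $ 1, y $ 2, s] :: real^3)"
  define V where "V z = (vector [z $ 1, z $ 2] :: real^2)" for z :: "real^3"
  define T where "T z = L (V z) - (z $ 3) *\<^sub>R n" for z :: "real^3"
  have V: "linear V"
    by (rule linearI) (auto simp: V_def vec_eq_iff forall_2)
  have "linear T"
    unfolding T_def
    by (intro linear_compose_sub linear_compose[OF V iso(1), unfolded o_def] linear_compose_scale_right)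
       (auto intro!: linearI simp: algebra_simps)
  moreover have "norm (T z) = norm z" for z
  proof -
    have "V z \<bullet> V z + z $ 3 * z $ 3 = z \<bullet> z"
      by (simp add: V_def inner_vec_def sum_2 sum_3)
    then have "T z \<bullet> T z = z \<bullet> z"
      using iso(2)[of "V z" "V z"] orth[of "V z"] nn
      by (simp add: T_def inner_diff inner_commute[of "L (V z)" n])
    then show ?thesis by (simp add: norm_eq_sqrt_inner)
  qed
  ultimately have T: "orthogonal_transformation T" by (simp add: orthogonal_transformation)
  have mT: "T \<in> borel_measurable borel"
    using \<open>linear T\<close> by (simp add: borel_measurable_continuous_onI linear_continuous_on linear_conv_bounded_linear)
  have mJ: "J \<in> borel_measurable borel"
    unfolding J_def case_prod_beta
    by (rule borel_measurable_continuous_onI, subst continuous_on_componentwise)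
       (simp add: Basis_vec_def inner_axis forall_3 continuous_intros)
  have VJ: "V (J p) = fst p" "J p $ 3 = snd p" for p
    by (simp_all add: V_def J_def case_prod_beta vec_eq_iff forall_2)
  have S': "S = (+) (?\<phi> 0) \<circ> (T \<circ> J)"
    by (auto simp: Seq T_def VJ)
  have "distr lborel borel S = distr (distr (distr lborel borel J) borel T) borel ((+) (?\<phi> 0))"
    using mT mJ by (simp add: distr_distr S' o_assoc)
  also have "\<dots> = lborel"
    using lborel_real2_times_real by (simp add: J_def lborel_orthogonal[OF T] lborel_distr_plus)
  finally show "distr lborel borel S = lborel" .
qed

lemma integral_rescale_layer:
  fixes Q :: "'a::euclidean_space \<times> real \<Rightarrow> real"
  assumes r: "r > 0" and Q: "integrable lborel Q" and P: "integrable lborel (\<lambda>p. Q (fst p, snd p / r) / r)"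
  shows "(LINT p|lborel. Q p) = (LINT p|lborel. Q (fst p, snd p / r) / r)"
proof -
  have "(LINT p|lborel. Q p) = (LINT y|lborel. LINT s|lborel. Q (y, s))"
    using lborel_pair.integral_fst'[of Q] Q by (simp add: lborel_prod)
  also have "\<dots> = (LINT y|lborel. LINT s|lborel. Q (y, s / r) / r)"
  proof (rule arg_cong[where f = "integral\<^sup>L lborel"], rule ext)
    fix y
    show "(LINT s|lborel. Q (y, s)) = (LINT s|lborel. Q (y, s / r) / r)"
      using lborel_integral_real_affine[of "1 / r" "\<lambda>s. Q (y, s)" 0] r by simp
  qed
  also have "\<dots> = (LINT p|lborel. Q (fst p, snd p / r) / r)"
    using lborel_pair.integral_fst'[of "\<lambda>p. Q (fst p, snd p / r) / r"] P by (simp add: lborel_prod)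
  finally show ?thesis .
qed

lemma integrable_tensor:
  fixes f :: "'a::euclidean_space \<Rightarrow> real" and g :: "'b::euclidean_space \<Rightarrow> real"
  assumes f: "integrable lborel f" and g: "integrable lborel g"
  shows "integrable lborel (\<lambda>p. f (fst p) * g (snd p))"
    "(LINT p|lborel. f (fst p) * g (snd p)) = (LINT x|lborel. f x) * (LINT y|lborel. g y)"
proof -
  have m: "f \<in> borel_measurable lborel" "g \<in> borel_measurable lborel" using f g by auto
  have "integrable (lborel \<Otimes>\<^sub>M lborel) (\<lambda>p. f (fst p) * g (snd p))"
  proof (rule lborel_pair.Fubini_integrable)
    show "(\<lambda>p. f (fst p) * g (snd p)) \<in> borel_measurable (lborel \<Otimes>\<^sub>M lborel)"
      using m by measurable
    show "integrable lborel (\<lambda>x. LINT y|lborel. norm (f (fst (x, y)) * g (snd (x, y))))"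
      using f by (simp add: abs_mult)
    show "AE x in lborel. integrable lborel (\<lambda>y. f (fst (x, y)) * g (snd (x, y)))"
      using g by simp
  qed
  then show i: "integrable lborel (\<lambda>p. f (fst p) * g (snd p))" by (simp add: lborel_prod)
  show "(LINT p|lborel. f (fst p) * g (snd p)) = (LINT x|lborel. f x) * (LINT y|lborel. g y)"
    using lborel_pair.integral_fst'[of "\<lambda>p. f (fst p) * g (snd p)"] i by (simp add: lborel_prod)
qed

lemma AE_lborel_not_hyperplane:
  fixes a :: "'a::euclidean_space"
  assumes "a \<noteq> 0 \<or> b \<noteq> 0" shows "AE x in lborel. a \<bullet> x \<noteq> b"
proof -
  have "{x. a \<bullet> x = b} \<in> null_sets lebesgue"
    using negligible_hyperplane[OF assms] negligible_iff_null_sets by blast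
  then have "AE x in lebesgue. x \<notin> {x. a \<bullet> x = b}" by (rule AE_not_in)
  then show ?thesis by (simp add: AE_completion_iff)
qed

lemma LINT_lebesgue_on_closed:
  fixes f :: "'a::euclidean_space \<Rightarrow> real"
  assumes "closed S" "continuous_on UNIV f"
  shows "(LINT x|lebesgue_on S. f x) = (LINT x|lborel. indicator S x * f x)"
proof -
  have "(LINT x|lebesgue_on S. f x) = (LINT x|lebesgue. indicator S x * f x)"
    using assms(1) by (subst integral_restrict_space) auto
  also have "\<dots> = (LINT x|lborel. indicator S x * f x)"
    using assms borel_measurable_continuous_onI[OF assms(2)] by (intro integral_completion) simp
  finally show ?thesis .
qed

context solid_polytope begin

text \<open>The heart of the Gauss theorem. The density \<open>r ramp' (r s)\<close> of the depth \<open>s\<close> below the plane of \<open>F\<close> concentrates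
on the plane as \<open>r\<close> grows, while the remaining ramps converge to the indicator of the points satisfying
the inequalities of all other facets, that is, to the indicator of \<open>F\<close> within its plane. In the coordinates
of the plane chart, with the depth rescaled by \<open>r\<close>, this becomes dominated convergence to a product
integral whose second factor is the total mass 1 of \<open>ramp'\<close>.\<close>

lemma facet_layer_limit:
  assumes F: "F facet_of K" and f: "continuous_on UNIV (f :: real^3 \<Rightarrow> real)"
  defines "H \<equiv> \<lambda>r x. f x * (r * ramp' (r * (facet_offset K F - facet_normal K F \<bullet> x))
      * (\<Prod>G\<in>{G. G facet_of K} - {F}. ramp (r * (facet_offset K G - facet_normal K G \<bullet> x))))"
  shows "(\<lambda>k. LINT x|lborel. H (real (Suc k)) x) \<longlonglongrightarrow> facet_integral F f"
    and "k \<ge> 0 \<Longrightarrow> integrable lborel (H k)"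
proof -
  let ?n = "facet_normal K F" and ?b = "facet_offset K F" and ?\<phi> = "plane_chart F"
  let ?FF = "{G. G facet_of K} - {F}"
  define g where "g r x = (\<Prod>G\<in>?FF. ramp (r * (facet_offset K G - facet_normal K G \<bullet> x)))" for r x
  define S where "S p = ?\<phi> (fst p) - snd p *\<^sub>R ?n" for p :: "(real^2) \<times> real"
  note n = norm_facet_normal[OF F] and hull = affine_hull_facet[OF F]
  note chart = lborel_plane_chart[OF n hull, folded S_def]
  have fin: "finite ?FF" using finite_facets by simp
  have H: "H r x = f x * (r * ramp' (r * (?b - ?n \<bullet> x)) * g r x)" for r x by (simp add: H_def g_def)
  have ramp_c: "continuous_on T (\<lambda>x. flat_exp p (h x))" if "continuous_on T h" for T and h :: "'x::topological_space \<Rightarrow> real" and p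
    by (rule continuous_on_compose2[OF continuous_flat_exp that, of UNIV]) simp
  have g_c: "continuous_on UNIV (g r)" for r
    unfolding g_def by (intro continuous_intros ramp_c)
  have H_c: "continuous_on UNIV (H r)" for r
    unfolding H by (intro continuous_intros ramp_c f g_c)
  have g01: "0 \<le> g r x" "g r x \<le> 1" for r x
    unfolding g_def by (auto intro!: prod_nonneg prod_le_1 simp: ramp_bounds)
  obtain R where R: "K \<subseteq> cball 0 R" using bounded unfolding bounded_iff by (auto simp: subset_eq)
  have supp: "x \<in> K" if "ramp' (r * (?b - ?n \<bullet> x)) * g r x \<noteq> 0" "r \<ge> 0" for r x
  proof (rule ccontr)
    assume "x \<notin> K"
    then obtain G where G: "G facet_of K" "facet_normal K G \<bullet> x > facet_offset K G"
      using outside_violates_facet by blast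
    then have neg: "r * (facet_offset K G - facet_normal K G \<bullet> x) \<le> 0"
      using \<open>r \<ge> 0\<close> by (simp add: mult_nonneg_nonpos)
    show False
    proof (cases "G = F")
      case True with neg that show ?thesis by (simp add: flat_exp_def)
    next
      case False
      then have "g r x = 0" unfolding g_def using fin G(1) ramp_eq_0[OF neg] by (auto intro!: prod_zero)
      with that show ?thesis by simp
    qed
  qed
  have H0: "H r x = 0" if "x \<notin> cball 0 R" "r \<ge> 0" for r x
  proof -
    have "x \<notin> K" using that R by auto
    then have "ramp' (r * (?b - ?n \<bullet> x)) * g r x = 0" using supp that(2) by blast
    then show ?thesis by (auto simp: H)
  qed
  show "integrable lborel (H k)" if "k \<ge> 0"
    by (rule integrable_continuous_bounded_support[OF H_c]) (use H0 that in blast)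
  define R' where "R' = R + norm (?\<phi> 0)"
  have S_far: "S p \<notin> cball 0 R" if "norm p > R'" for p
  proof -
    have "norm (S p - ?\<phi> 0) \<le> norm (S p) + norm (?\<phi> 0)" by (rule norm_triangle_ineq4)
    then show ?thesis using chart(3)[of p] that by (simp add: R'_def)
  qed
  have nS: "?n \<bullet> S p = ?b - snd p" for p
    using chart(5)[of "fst p"] n by (simp add: S_def inner_diff dot_square_norm)
  \<comment> \<open>the layer integrand in chart coordinates, with depth measured in units of \<open>1/r\<close>; the Jacobian \<open>1/r\<close> cancels the factor \<open>r\<close>\<close>
  define P where "P r p = f (S (fst p, snd p / r)) * (ramp' (snd p) * g r (S (fst p, snd p / r)))" for r p
  have PQ: "P r p = H r (S (fst p, snd p / r)) / r" if "r > 0" for r p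
    using that nS[of "(fst p, snd p / r)"] by (simp add: P_def H)
  have P_c: "continuous_on UNIV (P r)" if "r > 0" for r
    unfolding P_def using that
    by (intro continuous_intros ramp_c continuous_on_compose2[OF f] continuous_on_compose2[OF g_c] continuous_on_compose2[OF chart(1)]) auto
  have P_far: "P r p = 0" if "r > 0" "norm (fst p) > R' \<or> norm (snd p) > r * R'" for r p
  proof -
    have "norm (snd p) > r * R' \<Longrightarrow> norm (snd p / r) > R'"
      using that(1) by (simp add: pos_less_divide_eq mult.commute)
    then have "norm (fst p, snd p / r) > R'"
      using that norm_fst_le[of "fst p" "snd p / r"] norm_snd_le[of "snd p / r" "fst p"] by linarith
    then show ?thesis using PQ[OF that(1)] H0[OF S_far, of "(fst p, snd p / r)" r] that by simp
  qed
  have P_i: "integrable lborel (P r)" if r: "r > 0" for r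
  proof (rule integrable_continuous_bounded_support[OF P_c[OF r]])
    fix p :: "(real^2) \<times> real" assume p: "p \<notin> cball 0 (R' + r * R')"
    have "norm p \<le> norm (fst p) + norm (snd p)" by (metis norm_Pair_le prod.collapse)
    then show "P r p = 0" using p by (intro P_far r) auto
  qed
  have Q_i: "integrable lborel (\<lambda>p. H r (S p))" if r: "r > 0" for r
  proof (rule integrable_continuous_bounded_support)
    show "continuous_on UNIV (\<lambda>p. H r (S p))" by (intro continuous_on_compose2[OF H_c chart(1)]) auto
    show "H r (S p) = 0" if "p \<notin> cball 0 R'" for p using that r S_far[of p] H0 by auto
  qed
  have eq: "(LINT x|lborel. H r x) = (LINT p|lborel. P r p)" if r: "r > 0" for r
  proof -
    have "(LINT x|lborel. H r x) = (LINT x|distr lborel borel S. H r x)" by (simp add: chart(2))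
    also have "\<dots> = (LINT p|lborel. H r (S p))"
      by (rule integral_distr) (use chart(1) H_c in \<open>auto intro!: borel_measurable_continuous_onI\<close>)
    also have "\<dots> = (LINT p|lborel. P r p)"
    proof -
      have "P r = (\<lambda>p. H r (S (fst p, snd p / r)) / r)" using PQ[OF r] by (rule ext)
      then show ?thesis using integral_rescale_layer[OF r Q_i[OF r]] P_i[OF r] by (simp only:)
    qed
    finally show ?thesis .
  qed
  have "bounded (f ` K)" using compact f
    by (intro compact_imp_bounded compact_continuous_image) (auto intro: continuous_on_subset)
  then obtain C where C: "\<And>x. x \<in> K \<Longrightarrow> norm (f x) \<le> C"
    unfolding bounded_iff by (metis image_eqI)
  define w where "w p = \<bar>C\<bar> * indicator (cball 0 R') (fst p) * ramp' (snd p)" for p :: "(real^2) \<times> real"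
  have w_i: "integrable lborel w" unfolding w_def
    by (intro integrable_tensor(1) ramp'_integral integrable_mult_right integrable_real_indicator emeasure_lborel_cball_finite) simp
  have dom: "norm (P r p) \<le> w p" if r: "r > 0" for r p
  proof (cases "P r p = 0")
    case True then show ?thesis by (simp add: w_def ramp'_nonneg)
  next
    case False
    then have nfar: "norm (fst p) \<le> R'" using P_far[OF r, of p] by force
    have "H r (S (fst p, snd p / r)) \<noteq> 0" using False PQ[OF r, of p] by auto
    then have "ramp' (r * (?b - ?n \<bullet> S (fst p, snd p / r))) * g r (S (fst p, snd p / r)) \<noteq> 0"
      unfolding H by auto
    then have "S (fst p, snd p / r) \<in> K" using r by (intro supp[of r]) auto
    then have "norm (f (S (fst p, snd p / r))) \<le> \<bar>C\<bar>" using C by fastforce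
    moreover have "\<bar>ramp' (snd p) * g r (S (fst p, snd p / r))\<bar> \<le> ramp' (snd p)"
      using g01 ramp'_nonneg by (simp add: abs_mult mult_left_le)
    ultimately have "norm (f (S (fst p, snd p / r))) * \<bar>ramp' (snd p) * g r (S (fst p, snd p / r))\<bar> \<le> \<bar>C\<bar> * ramp' (snd p)"
      by (intro mult_mono) auto
    then show ?thesis using nfar by (simp add: P_def w_def abs_mult)
  qed
  define lim where "lim p = (f (?\<phi> (fst p)) * indicator (?\<phi> -` F) (fst p)) * ramp' (snd p)" for p :: "(real^2) \<times> real"
  \<comment> \<open>points of the plane on the plane of another facet, where the ramp of that facet need not converge, form a null set\<close>
  have generic: "AE p::(real^2) \<times> real in lborel. \<forall>G\<in>?FF. facet_normal K G \<bullet> ?\<phi> (fst p) \<noteq> facet_offset K G"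
  proof (rule AE_ball_countable')
    fix G assume G: "G \<in> ?FF"
    let ?m = "facet_normal K G" and ?d = "facet_offset K G"
    \<comment> \<open>pulled back by the chart, the plane of \<open>G\<close> is a hyperplane \<open>c \<bullet> y = d - e\<close>, unless both planes coincide\<close>
    define c where "c = adjoint (\<lambda>y. ?\<phi> y - ?\<phi> 0) ?m"
    define e where "e = ?m \<bullet> ?\<phi> 0"
    have c: "?m \<bullet> ?\<phi> y = e + c \<bullet> y" for y
      using adjoint_works[OF chart(4), of y ?m] by (simp add: c_def e_def inner_diff inner_commute algebra_simps)
    have "(c, 0::real) \<noteq> 0 \<or> ?d - e \<noteq> 0"
    proof (rule ccontr)
      assume "\<not> ?thesis"
      then have "range ?\<phi> \<subseteq> {x. ?m \<bullet> x = ?d}" using c by (auto simp: zero_prod_def)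
      then have "{x. ?n \<bullet> x = ?b} \<subseteq> {x. ?m \<bullet> x = ?d}" by (simp add: plane_chart_range[OF n hull])
      then show False using facet_planes_distinct[OF F, of G] G by auto
    qed
    from AE_lborel_not_hyperplane[OF this]
    show "AE p::(real^2) \<times> real in lborel. ?m \<bullet> ?\<phi> (fst p) \<noteq> ?d"
      by eventually_elim (auto simp: c inner_prod_def)
  qed (use fin in \<open>simp add: countable_finite\<close>)
  have ptw: "(\<lambda>k. P (real (Suc k)) p) \<longlonglongrightarrow> lim p"
    if gen: "\<forall>G\<in>?FF. facet_normal K G \<bullet> ?\<phi> (fst p) \<noteq> facet_offset K G" for p
  proof (cases "snd p \<le> 0")
    case True then show ?thesis by (simp add: P_def lim_def flat_exp_def)
  next
    case False
    let ?y = "fst p" and ?s = "snd p"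
    have at: "filterlim (\<lambda>k. real (Suc k)) at_top sequentially"
      by (rule filterlim_compose[OF filterlim_real_sequentially filterlim_Suc])
    have "(\<lambda>k. ?\<phi> ?y - (?s / real (Suc k)) *\<^sub>R ?n) \<longlonglongrightarrow> ?\<phi> ?y - 0 *\<^sub>R ?n"
      by (intro tendsto_intros tendsto_divide_0[OF tendsto_const] filterlim_at_top_imp_at_infinity at)
    then have Sk: "(\<lambda>k. S (?y, ?s / real (Suc k))) \<longlonglongrightarrow> ?\<phi> ?y" by (simp add: S_def)
    then have fk: "(\<lambda>k. f (S (?y, ?s / real (Suc k)))) \<longlonglongrightarrow> f (?\<phi> ?y)"
      using f continuous_on_tendsto_compose[OF f Sk] by simp
    have gk: "(\<lambda>k. ramp (real (Suc k) * (facet_offset K G - facet_normal K G \<bullet> S (?y, ?s / real (Suc k)))))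
        \<longlonglongrightarrow> (if facet_normal K G \<bullet> ?\<phi> ?y < facet_offset K G then 1 else 0)" if G: "G \<in> ?FF" for G
    proof -
      let ?e = "\<lambda>k. facet_offset K G - facet_normal K G \<bullet> S (?y, ?s / real (Suc k))"
      have ek: "?e \<longlonglongrightarrow> facet_offset K G - facet_normal K G \<bullet> ?\<phi> ?y"
        by (intro tendsto_intros Sk)
      show ?thesis
      proof (cases "facet_normal K G \<bullet> ?\<phi> ?y < facet_offset K G")
        case True
        then have "filterlim (\<lambda>k. real (Suc k) * ?e k) at_top sequentially"
          by (intro filterlim_at_top_mult_tendsto_pos[OF ek _ at, simplified mult.commute]) auto
        from filterlim_compose[OF ramp_at_top this] True show ?thesis by simp
      next
        case False
        then have "facet_offset K G - facet_normal K G \<bullet> ?\<phi> ?y < 0" using gen G by force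
        from order_tendstoD(2)[OF ek this] have "eventually (\<lambda>k. 0 = ramp (real (Suc k) * ?e k)) sequentially"
          by eventually_elim (simp add: ramp_eq_0 mult_nonneg_nonpos)
        from Lim_transform_eventually[OF tendsto_const this] False show ?thesis by simp
      qed
    qed
    have "(\<lambda>k. g (real (Suc k)) (S (?y, ?s / real (Suc k)))) \<longlonglongrightarrow>
        (\<Prod>G\<in>?FF. if facet_normal K G \<bullet> ?\<phi> ?y < facet_offset K G then 1 else 0)"
      unfolding g_def by (intro tendsto_prod gk)
    also have "(\<Prod>G\<in>?FF. if facet_normal K G \<bullet> ?\<phi> ?y < facet_offset K G then 1 else 0::real) = indicator (?\<phi> -` F) ?y"
    proof -
      have "?\<phi> ?y \<in> F \<longleftrightarrow> ?\<phi> ?y \<in> K" using facet_eq[OF F] chart(5)[of ?y] by blast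
      also have "\<dots> \<longleftrightarrow> (\<forall>G\<in>?FF. facet_normal K G \<bullet> ?\<phi> ?y < facet_offset K G)"
        using mem_iff_halfspaces[of "?\<phi> ?y"] chart(5)[of ?y] gen by (force simp: less_le)
      finally show ?thesis using fin by (auto simp: indicator_def prod_zero_iff split: if_splits)
    qed
    finally have "(\<lambda>k. f (S (?y, ?s / real (Suc k))) * (ramp' ?s * g (real (Suc k)) (S (?y, ?s / real (Suc k)))))
        \<longlonglongrightarrow> f (?\<phi> ?y) * (ramp' ?s * indicator (?\<phi> -` F) ?y)"
      by (intro tendsto_mult fk tendsto_const)
    then show ?thesis by (simp add: P_def lim_def mult_ac)
  qed
  have \<phi>_c: "continuous_on UNIV ?\<phi>"
  proof -
    have "continuous_on UNIV (\<lambda>y::real^2. (y, 0::real))" by (intro continuous_intros)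
    from continuous_on_compose2[OF chart(1) this] show ?thesis by (simp add: S_def)
  qed
  have F_closed: "closed (?\<phi> -` F)"
    using face_of_imp_closed[OF convex closed facet_of_imp_face_of[OF F]] \<phi>_c
    by (simp add: continuous_on_closed_vimage)
  have f\<phi>: "continuous_on UNIV (\<lambda>y. f (?\<phi> y))" by (intro continuous_on_compose2[OF f \<phi>_c]) auto
  have lim_m: "lim \<in> borel_measurable lborel"
  proof -
    have "(\<lambda>p::(real^2)\<times>real. f (?\<phi> (fst p))) \<in> borel_measurable borel"
      by (intro borel_measurable_continuous_onI continuous_on_compose2[OF f\<phi>] continuous_intros) auto
    moreover have "(\<lambda>p::(real^2)\<times>real. indicator (?\<phi> -` F) (fst p) :: real) \<in> borel_measurable borel"
      by (rule measurable_compose[OF _ borel_measurable_indicator[of _ borel]])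
         (use F_closed in \<open>auto intro!: borel_measurable_continuous_onI continuous_intros\<close>)
    moreover have "(\<lambda>p::(real^2)\<times>real. ramp' (snd p)) \<in> borel_measurable borel"
      by (intro borel_measurable_continuous_onI ramp_c continuous_intros)
    ultimately show ?thesis unfolding lim_def by simp
  qed
  have AElim: "AE p in lborel. (\<lambda>k. P (real (Suc k)) p) \<longlonglongrightarrow> lim p"
    using generic by eventually_elim (rule ptw)
  have dct: "(\<lambda>k. LINT p|lborel. P (real (Suc k)) p) \<longlonglongrightarrow> (LINT p|lborel. lim p)"
    by (rule integral_dominated_convergence[where w = w])
       (use lim_m w_i AElim dom P_i borel_measurable_integrable in auto)
  have i1: "integrable lborel (\<lambda>y. f (?\<phi> y) * indicator (?\<phi> -` F) y)"
  proof -
    have "bounded (?\<phi> -` F)"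
    proof (rule bounded_subset[OF bounded_cball])
      show "?\<phi> -` F \<subseteq> cball 0 R'"
      proof
        fix y assume "y \<in> ?\<phi> -` F"
        then have "S (y, 0) \<in> cball 0 R" using facet_of_imp_subset[OF F] R by (auto simp: S_def)
        then show "y \<in> cball 0 R'" using S_far[of "(y, 0)"] by (force simp: norm_Pair)
      qed
    qed
    then have "compact (?\<phi> -` F)" using F_closed compact_eq_bounded_closed by blast
    from borel_integrable_compact[OF this, of "\<lambda>y. f (?\<phi> y)"] f\<phi>
    show ?thesis by (simp add: mult.commute continuous_on_subset)
  qed
  have "(LINT p|lborel. lim p) = (LINT y|lborel. f (?\<phi> y) * indicator (?\<phi> -` F) y) * 1"
    unfolding lim_def by (subst integrable_tensor(2)[OF i1 ramp'_integral(1)]) (simp add: ramp'_integral)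
  also have "\<dots> = facet_integral F f"
    unfolding facet_integral_def by (subst LINT_lebesgue_on_closed[OF F_closed f\<phi>]) (simp add: mult.commute)
  finally show "(\<lambda>k. LINT x|lborel. H (real (Suc k)) x) \<longlonglongrightarrow> facet_integral F f"
    using dct eq by simp
qed

text \<open>The product of the functions \<open>ramp (r (b\<^sub>F - n\<^sub>F \<bullet> x))\<close> over the facets is a smooth approximation of the
indicator of the polytope that vanishes outside it. The derivative of \<open>f\<close> times this product integrates to zero;
by the product rule it consists of the volume term and of one layer term per facet, whose limits are
the facet integrals.\<close>

theorem gauss:
  assumes der: "\<And>x. (f has_derivative f' x) (at x)"
    and cont: "continuous_on UNIV (\<lambda>x. f' x v)"
  shows "(LINT x|lebesgue_on K. f' x v) = (\<Sum>F | F facet_of K. (facet_normal K F \<bullet> v) * facet_integral F f)"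
proof -
  let ?FF = "{F. F facet_of K}"
  define e where "e r F x = r * (facet_offset K F - facet_normal K F \<bullet> x)" for r F x
  define g where "g r x = (\<Prod>F\<in>?FF. ramp (e r F x))" for r x
  define H where "H F r x = f x * (r * ramp' (e r F x) * (\<Prod>G\<in>?FF - {F}. ramp (e r G x)))" for F r x
  note fin = finite_facets
  have f_c: "continuous_on UNIV f"
    by (intro continuous_at_imp_continuous_on ballI has_derivative_continuous[OF der])
  have ramp_c: "continuous_on UNIV (\<lambda>x. flat_exp p (e r F x))" for p r F
    unfolding e_def by (rule continuous_on_compose2[OF continuous_flat_exp, of UNIV]) (auto intro!: continuous_intros)
  have g_c: "continuous_on UNIV (g r)" for r
    unfolding g_def by (intro continuous_intros ramp_c)
  have g01: "0 \<le> g r x" "g r x \<le> 1" for r x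
    unfolding g_def by (auto intro!: prod_nonneg prod_le_1 simp: ramp_bounds)
  have g0: "g r x = 0" if x: "x \<notin> interior K" and r: "r \<ge> 0" for r x
  proof -
    obtain F where F: "F facet_of K" "facet_offset K F - facet_normal K F \<bullet> x \<le> 0"
      using x by (auto simp: interior_iff_halfspaces not_less)
    then have "e r F x \<le> 0" using r by (simp add: e_def mult_nonneg_nonpos)
    then show ?thesis unfolding g_def using fin F(1) ramp_eq_0 by (auto intro!: prod_zero)
  qed
  obtain R where R: "K \<subseteq> cball 0 R" using bounded unfolding bounded_iff by (auto simp: subset_eq)
  have out: "x \<notin> interior K" if "x \<notin> cball 0 R" for x using that R interior_subset[of K] by blast
  have H_i: "integrable lborel (H F r)" "(\<lambda>k. LINT x|lborel. H F (real (Suc k)) x) \<longlonglongrightarrow> facet_integral F f"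
    if "F facet_of K" "r \<ge> 0" for F r
    using facet_layer_limit[OF that(1) f_c] that(2) unfolding H_def[abs_def] e_def by auto
  define G' where "G' r x w = f' x w * g r x - (\<Sum>F\<in>?FF. (facet_normal K F \<bullet> w) * H F r x)" for r x w
  have derG: "((\<lambda>x. f x * g r x) has_derivative G' r x) (at x)" for r x
  proof -
    have "((\<lambda>x. ramp (e r F x)) has_derivative (\<lambda>w. - (r * (facet_normal K F \<bullet> w)) * ramp' (e r F x))) (at x)" for F
      unfolding e_def
      by (rule DERIV_compose_FDERIV[OF ramp_has_derivative]) (auto intro!: derivative_eq_intros simp: algebra_simps)
    then have "(g r has_derivative (\<lambda>w. \<Sum>F\<in>?FF. - (r * (facet_normal K F \<bullet> w)) * ramp' (e r F x) * (\<Prod>G\<in>?FF - {F}. ramp (e r G x)))) (at x)"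
      unfolding g_def by (intro has_derivative_prod)
    from has_derivative_mult[OF der this] show ?thesis
      by (rule has_derivative_eq_rhs)
         (auto simp: G'_def H_def sum_distrib_left sum_negf fun_eq_iff algebra_simps)
  qed
  have fg_c: "continuous_on UNIV (\<lambda>x. f' x v * g r x)" for r by (intro continuous_intros cont g_c)
  have H_c: "continuous_on UNIV (H F r)" for F r
    unfolding H_def by (intro continuous_intros ramp_c f_c)
  have fg_i: "integrable lborel (\<lambda>x. f' x v * g r x)" if "r \<ge> 0" for r
    by (rule integrable_continuous_bounded_support[OF fg_c, of R]) (use out g0 that in auto)
  have step: "(LINT x|lborel. f' x v * g r x) = (\<Sum>F\<in>?FF. (facet_normal K F \<bullet> v) * (LINT x|lborel. H F r x))"
    if r: "r \<ge> 0" for r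
  proof -
    have "(LINT x|lborel. G' r x v) = 0"
    proof (rule integral_directional_derivative_eq_0[OF derG, of r v R])
      show "continuous_on UNIV (\<lambda>x. G' r x v)"
        unfolding G'_def by (intro continuous_intros fg_c H_c)
      show "f x * g r x = 0" if "x \<notin> cball 0 R" for x using g0 out that r by simp
    qed
    moreover have "integrable lborel (\<lambda>x. \<Sum>F\<in>?FF. (facet_normal K F \<bullet> v) * H F r x)"
      using H_i(1)[OF _ r] by (intro Bochner_Integration.integrable_sum integrable_mult_right) auto
    moreover have "(LINT x|lborel. (\<Sum>F\<in>?FF. (facet_normal K F \<bullet> v) * H F r x)) = (\<Sum>F\<in>?FF. (facet_normal K F \<bullet> v) * (LINT x|lborel. H F r x))"
      using H_i(1)[OF _ r] by (subst Bochner_Integration.integral_sum) (auto intro!: integrable_mult_right)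
    ultimately show ?thesis
      unfolding G'_def using fg_i[OF r] by simp
  qed
  have "(\<lambda>k. LINT x|lborel. f' x v * g (real (Suc k)) x) \<longlonglongrightarrow> (\<Sum>F\<in>?FF. (facet_normal K F \<bullet> v) * facet_integral F f)"
    unfolding step[OF of_nat_0_le_iff] using H_i(2) by (intro tendsto_intros) auto
  moreover have "(\<lambda>k. LINT x|lborel. f' x v * g (real (Suc k)) x) \<longlonglongrightarrow> (LINT x|lborel. f' x v * indicator (interior K) x)"
  proof (rule integral_dominated_convergence[where w = "\<lambda>x. indicator K x * norm (f' x v)"])
    have fm: "(\<lambda>x. f' x v) \<in> borel_measurable borel" by (rule borel_measurable_continuous_onI[OF cont])
    then show "(\<lambda>x. f' x v * indicator (interior K) x) \<in> borel_measurable lborel" by simp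
    show "(\<lambda>x. f' x v * g (real (Suc k)) x) \<in> borel_measurable lborel" for k
      using borel_measurable_continuous_onI[OF fg_c] by simp
    show "integrable lborel (\<lambda>x. indicator K x * norm (f' x v))"
      using borel_integrable_compact[OF compact, of "\<lambda>x. norm (f' x v)"]
        continuous_on_subset[OF continuous_on_norm[OF cont], of K] by simp
    show "AE x in lborel. norm (f' x v * g (real (Suc k)) x) \<le> indicator K x * norm (f' x v)" for k
    proof (rule AE_I2)
      fix x show "norm (f' x v * g (real (Suc k)) x) \<le> indicator K x * norm (f' x v)"
        using g0[of x "real (Suc k)"] g01[of "real (Suc k)" x] interior_subset[of K]
        by (cases "x \<in> interior K") (auto simp: abs_mult mult_left_le indicator_def)
    qed
    show "AE x in lborel. (\<lambda>k. f' x v * g (real (Suc k)) x) \<longlonglongrightarrow> f' x v * indicator (interior K) x"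
    proof (rule AE_I2)
      fix x
      show "(\<lambda>k. f' x v * g (real (Suc k)) x) \<longlonglongrightarrow> f' x v * indicator (interior K) x"
      proof (cases "x \<in> interior K")
        case True
        have "(\<lambda>k. ramp (e (real (Suc k)) F x)) \<longlonglongrightarrow> 1" if "F \<in> ?FF" for F
        proof -
          have "0 < facet_offset K F - facet_normal K F \<bullet> x" using True that interior_iff_halfspaces by auto
          moreover have "filterlim (\<lambda>k. real (Suc k)) at_top sequentially"
            by (rule filterlim_compose[OF filterlim_real_sequentially filterlim_Suc])
          ultimately have "filterlim (\<lambda>k. (facet_offset K F - facet_normal K F \<bullet> x) * real (Suc k)) at_top sequentially"
            by (intro filterlim_tendsto_pos_mult_at_top[OF tendsto_const])
          then have "filterlim (\<lambda>k. e (real (Suc k)) F x) at_top sequentially"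
            by (simp only: e_def mult.commute)
          from filterlim_compose[OF ramp_at_top this] show ?thesis .
        qed
        then have "(\<lambda>k. g (real (Suc k)) x) \<longlonglongrightarrow> (\<Prod>F\<in>?FF. 1)"
          unfolding g_def by (intro tendsto_prod)
        then show ?thesis using True by (auto intro!: tendsto_eq_intros)
      next
        case False then show ?thesis using g0 by simp
      qed
    qed
  qed
  ultimately have "(LINT x|lborel. f' x v * indicator (interior K) x) = (\<Sum>F\<in>?FF. (facet_normal K F \<bullet> v) * facet_integral F f)"
    by (rule LIMSEQ_unique[rotated])
  moreover have "(LINT x|lebesgue_on K. f' x v) = (LINT x|lborel. f' x v * indicator (interior K) x)"
  proof -
    have "(LINT x|lebesgue_on K. f' x v) = (LINT x|lebesgue. indicator K x * f' x v)"
      using closed by (subst integral_restrict_space) auto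
    also have "\<dots> = (LINT x|lebesgue. f' x v * indicator (interior K) x)"
    proof (rule integral_cong_AE)
      have fm: "(\<lambda>x. f' x v) \<in> borel_measurable borel" by (rule borel_measurable_continuous_onI[OF cont])
      then have fm': "(\<lambda>x. f' x v) \<in> borel_measurable lebesgue" by (simp add: measurable_completion)
      show "(\<lambda>x. indicator K x * f' x v) \<in> borel_measurable lebesgue"
        "(\<lambda>x. f' x v * indicator (interior K) x) \<in> borel_measurable lebesgue"
        using closed by (intro borel_measurable_times borel_measurable_indicator fm'; simp)+
      have "AE x in lebesgue. x \<notin> frontier K"
        using negligible_convex_frontier[OF convex] by (simp add: negligible_iff_null_sets AE_not_in)
      then show "AE x in lebesgue. indicator K x * f' x v = f' x v * indicator (interior K) x"
        by eventually_elim (use closed interior_subset[of K] in \<open>auto simp: frontier_def indicator_def\<close>)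
    qed
    also have "\<dots> = (LINT x|lborel. f' x v * indicator (interior K) x)"
      using borel_measurable_continuous_onI[OF cont] by (intro integral_completion) simp
    finally show ?thesis .
  qed
  ultimately show ?thesis by simp
qed

end

section \<open>Smooth functions\<close>

text \<open>Iterated directional derivatives are the form in which the classes \<open>Ck\<close> are given, so calculus for smooth functions is
phrased with them.\<close>

abbreviation dderiv :: "'a::real_normed_vector \<Rightarrow> ('a \<Rightarrow> 'b::real_normed_vector) \<Rightarrow> 'a \<Rightarrow> 'b" where
  "dderiv v f x \<equiv> frechet_derivative f (at x) v"

lemma dderiv_eqI: "(f has_derivative f') (at x) \<Longrightarrow> dderiv v f x = f' v"
  using frechet_derivative_at by metis

lemma differentiable_UNIV: "f differentiable_on UNIV \<Longrightarrow> (f has_derivative frechet_derivative f (at x)) (at x)"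
  by (simp add: differentiable_on_def frechet_derivative_works)

lemma Ck_Suc_imp: "Ck (Suc k) f \<Longrightarrow> Ck k f"
proof (induction k arbitrary: f)
  case 0 then show ?case by (simp add: differentiable_imp_continuous_on)
next
  case (Suc k) then show ?case by (metis Ck.simps(2))
qed

lemma Ck_SucI:
  assumes "\<And>x. (f has_derivative f' x) (at x)" "\<And>v. Ck k (\<lambda>x. f' x v)"
  shows "Ck (Suc k) f"
proof -
  have "frechet_derivative f (at x) = f' x" for x
    using frechet_derivative_at[OF assms(1)] by simp
  then show ?thesis using assms by (auto simp: differentiable_on_def intro: differentiableI)
qed

lemma Ck_const: "Ck k (\<lambda>x. c)"
  by (induction k arbitrary: c) auto

lemma Ck_bounded_linear:
  assumes "bounded_linear h" shows "Ck k f \<Longrightarrow> Ck k (\<lambda>x. h (f x))"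
proof (induction k arbitrary: f)
  case 0 then show ?case
    using bounded_linear.continuous_on[OF assms] by auto
next
  case (Suc k)
  show ?case
  proof (rule Ck_SucI)
    show "((\<lambda>x. h (f x)) has_derivative (\<lambda>v. h (dderiv v f x))) (at x)" for x
      using Suc.prems by (intro bounded_linear.has_derivative[OF assms] differentiable_UNIV) simp
    show "Ck k (\<lambda>x. h (dderiv v f x))" for v
      using Suc.prems by (intro Suc.IH) simp
  qed
qed

lemma Ck_add: "Ck k f \<Longrightarrow> Ck k g \<Longrightarrow> Ck k (\<lambda>x. f x + g x)"
proof (induction k arbitrary: f g)
  case 0 then show ?case by (auto intro: continuous_on_add)
next
  case (Suc k)
  show ?case
  proof (rule Ck_SucI)
    show "((\<lambda>x. f x + g x) has_derivative (\<lambda>v. dderiv v f x + dderiv v g x)) (at x)" for x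
      using Suc.prems by (intro has_derivative_add differentiable_UNIV) simp_all
    show "Ck k (\<lambda>x. dderiv v f x + dderiv v g x)" for v
      using Suc.prems by (intro Suc.IH) simp_all
  qed
qed

lemma Ck_mult: "Ck k f \<Longrightarrow> Ck k g \<Longrightarrow> Ck k (\<lambda>x. f x * g x :: real)"
proof (induction k arbitrary: f g)
  case 0 then show ?case by (auto intro: continuous_on_mult)
next
  case (Suc k)
  show ?case
  proof (rule Ck_SucI)
    show "((\<lambda>x. f x * g x) has_derivative (\<lambda>v. f x * dderiv v g x + dderiv v f x * g x)) (at x)" for x
      using Suc.prems by (intro has_derivative_mult differentiable_UNIV) simp_all
    show "Ck k (\<lambda>x. f x * dderiv v g x + dderiv v f x * g x)" for v
      using Suc.prems by (intro Ck_add Suc.IH) (simp_all add: Ck_Suc_imp)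
  qed
qed

lemma Ck_prod: "finite I \<Longrightarrow> (\<And>i. i \<in> I \<Longrightarrow> Ck k (f i)) \<Longrightarrow> Ck k (\<lambda>x. \<Prod>i\<in>I. f i x :: real)"
  by (induction rule: finite_induct) (auto intro: Ck_const Ck_mult)

lemma Ck_flat_exp: "Ck k (\<lambda>x. flat_exp p (a \<bullet> x + b))"
proof (induction k arbitrary: p)
  case 0 show ?case
    by (auto intro!: continuous_on_compose2[OF continuous_flat_exp[of UNIV]] continuous_intros)
next
  case (Suc k)
  show ?case
  proof (rule Ck_SucI)
    show "((\<lambda>x. flat_exp p (a \<bullet> x + b)) has_derivative
       (\<lambda>v. (a \<bullet> v) * flat_exp ([:0,0,1:] * (p - pderiv p)) (a \<bullet> x + b))) (at x)" for x
      by (rule DERIV_compose_FDERIV[OF flat_exp_has_derivative]) (auto intro!: derivative_eq_intros)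
    show "Ck k (\<lambda>x. (a \<bullet> v) * flat_exp ([:0,0,1:] * (p - pderiv p)) (a \<bullet> x + b))" for v
      by (intro Ck_mult Ck_const Suc.IH)
  qed
qed

lemma smooth_has_derivative: "smooth f \<Longrightarrow> (f has_derivative frechet_derivative f (at x)) (at x)"
  unfolding smooth_def by (rule differentiable_UNIV) (metis Ck.simps(2))

lemma smooth_dderiv: "smooth f \<Longrightarrow> smooth (dderiv v f)"
  unfolding smooth_def by (metis Ck.simps(2))

lemma smooth_continuous: "smooth f \<Longrightarrow> continuous_on UNIV f"
  unfolding smooth_def by (metis Ck.simps(1))

lemma smooth_const: "smooth (\<lambda>x. c)"
  and smooth_add: "smooth f \<Longrightarrow> smooth g \<Longrightarrow> smooth (\<lambda>x. f x + g x)"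
  and smooth_mult: "smooth r \<Longrightarrow> smooth s \<Longrightarrow> smooth (\<lambda>x. r x * s x :: real)"
  and smooth_bounded_linear: "bounded_linear h \<Longrightarrow> smooth f \<Longrightarrow> smooth (\<lambda>x. h (f x))"
  unfolding smooth_def using Ck_const Ck_add Ck_mult Ck_bounded_linear by blast+

lemma smooth_component: "smooth f \<Longrightarrow> smooth (\<lambda>x. f x $ i)"
  by (rule smooth_bounded_linear[OF bounded_linear_vec_nth])

lemma smooth_partial: "smooth f \<Longrightarrow> smooth (partial i f)"
  unfolding partial_def[abs_def] by (rule smooth_dderiv)

lemma partial_component:
  assumes "(f has_derivative f') (at x)"
  shows "partial j (\<lambda>x. f x $ i) x = partial j f x $ i"
  unfolding partial_def
  by (subst dderiv_eqI[OF bounded_linear.has_derivative[OF bounded_linear_vec_nth assms]])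
     (simp add: dderiv_eqI[OF assms])

lemma partial_mult:
  assumes "(f has_derivative f') (at x)" "(g has_derivative g') (at x)"
  shows "partial j (\<lambda>x. f x * g x :: real) x = f x * partial j g x + partial j f x * g x"
  unfolding partial_def
  by (subst dderiv_eqI[OF has_derivative_mult[OF assms]]) (simp add: dderiv_eqI[OF assms(1)] dderiv_eqI[OF assms(2)])

text \<open>The second difference along \<open>v\<close> and \<open>w\<close> equals a mixed derivative at an intermediate point, by the mean value
theorem first in direction \<open>v\<close> and then in direction \<open>w\<close>. Since the second difference is symmetric in
\<open>v\<close> and \<open>w\<close>, the symmetry of second derivatives follows by letting the step tend to zero.\<close>

lemma mean_value_mixed_derivative:
  fixes f :: "real^3 \<Rightarrow> real"
  assumes f: "smooth f" and h: "h > 0"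
  shows "\<exists>s t. 0 < s \<and> s < h \<and> 0 < t \<and> t < h \<and>
    f (x + h *\<^sub>R v + h *\<^sub>R w) - f (x + h *\<^sub>R v) - f (x + h *\<^sub>R w) + f x
      = h * h * dderiv w (dderiv v f) (x + s *\<^sub>R v + t *\<^sub>R w)"
proof -
  have line: "((\<lambda>t. g (y + t *\<^sub>R z)) has_real_derivative dderiv z g (y + t *\<^sub>R z)) (at t)"
    if g: "smooth g" for g :: "real^3 \<Rightarrow> real" and y z t
  proof -
    have "((\<lambda>t. g (y + t *\<^sub>R z)) has_derivative (\<lambda>dt. dderiv (dt *\<^sub>R z) g (y + t *\<^sub>R z))) (at t)"
      by (rule has_derivative_compose[OF _ smooth_has_derivative[OF g]]) (auto intro!: derivative_eq_intros)
    moreover have "(\<lambda>dt. dderiv (dt *\<^sub>R z) g (y + t *\<^sub>R z)) = (*) (dderiv z g (y + t *\<^sub>R z))"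
      using linear_scale[OF has_derivative_linear[OF smooth_has_derivative[OF g]]] by (auto simp: mult.commute)
    ultimately show ?thesis unfolding has_field_derivative_def by simp
  qed
  define p where "p s = f (x + h *\<^sub>R w + s *\<^sub>R v) - f (x + s *\<^sub>R v)" for s
  have "(p has_real_derivative dderiv v f (x + h *\<^sub>R w + s *\<^sub>R v) - dderiv v f (x + s *\<^sub>R v)) (at s)" for s
    unfolding p_def by (intro DERIV_diff line f)
  from MVT2[OF h this] obtain s where s: "0 < s" "s < h"
    "p h - p 0 = (h - 0) * (dderiv v f (x + h *\<^sub>R w + s *\<^sub>R v) - dderiv v f (x + s *\<^sub>R v))" by blast
  have "((\<lambda>t. dderiv v f ((x + s *\<^sub>R v) + t *\<^sub>R w)) has_real_derivative dderiv w (dderiv v f) ((x + s *\<^sub>R v) + t *\<^sub>R w)) (at t)" for t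
    by (intro line smooth_dderiv f)
  from MVT2[OF h this] obtain t where t: "0 < t" "t < h"
    "dderiv v f ((x + s *\<^sub>R v) + h *\<^sub>R w) - dderiv v f ((x + s *\<^sub>R v) + 0 *\<^sub>R w) = (h - 0) * dderiv w (dderiv v f) (x + s *\<^sub>R v + t *\<^sub>R w)"
    by blast
  have "x + h *\<^sub>R w + s *\<^sub>R v = x + s *\<^sub>R v + h *\<^sub>R w" "x + h *\<^sub>R w + h *\<^sub>R v = x + h *\<^sub>R v + h *\<^sub>R w"
    by (simp_all add: add_ac)
  with s(3) t(3) have "f (x + h *\<^sub>R v + h *\<^sub>R w) - f (x + h *\<^sub>R v) - f (x + h *\<^sub>R w) + f x
      = h * h * dderiv w (dderiv v f) (x + s *\<^sub>R v + t *\<^sub>R w)"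
    by (simp add: p_def)
  with s t show ?thesis by blast
qed

lemma second_derivative_symmetric:
  fixes f :: "real^3 \<Rightarrow> real"
  assumes f: "smooth f"
  shows "dderiv w (dderiv v f) x = dderiv v (dderiv w f) x"
proof -
  define h where "h n = 1 / real (Suc n)" for n
  have h: "h n > 0" for n by (simp add: h_def)
  have h0: "h \<longlonglongrightarrow> 0" unfolding h_def by (rule LIMSEQ_Suc[OF lim_1_over_n])
  have "\<exists>s t s' t'. \<bar>s\<bar> \<le> h n \<and> \<bar>t\<bar> \<le> h n \<and> \<bar>s'\<bar> \<le> h n \<and> \<bar>t'\<bar> \<le> h n \<and>
     dderiv w (dderiv v f) (x + s *\<^sub>R v + t *\<^sub>R w) = dderiv v (dderiv w f) (x + s' *\<^sub>R w + t' *\<^sub>R v)" for n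
  proof -
    obtain s t where st: "0 < s" "s < h n" "0 < t" "t < h n"
      "f (x + h n *\<^sub>R v + h n *\<^sub>R w) - f (x + h n *\<^sub>R v) - f (x + h n *\<^sub>R w) + f x
        = h n * h n * dderiv w (dderiv v f) (x + s *\<^sub>R v + t *\<^sub>R w)"
      using mean_value_mixed_derivative[OF f h[of n], where x = x and v = v and w = w] by blast
    obtain s' t' where st': "0 < s'" "s' < h n" "0 < t'" "t' < h n"
      "f (x + h n *\<^sub>R w + h n *\<^sub>R v) - f (x + h n *\<^sub>R w) - f (x + h n *\<^sub>R v) + f x
        = h n * h n * dderiv v (dderiv w f) (x + s' *\<^sub>R w + t' *\<^sub>R v)"
      using mean_value_mixed_derivative[OF f h[of n], where x = x and v = w and w = v] by blast
    have swap: "x + h n *\<^sub>R w + h n *\<^sub>R v = x + h n *\<^sub>R v + h n *\<^sub>R w" by (simp add: add_ac)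
    have "(h n * h n) * dderiv w (dderiv v f) (x + s *\<^sub>R v + t *\<^sub>R w) = (h n * h n) * dderiv v (dderiv w f) (x + s' *\<^sub>R w + t' *\<^sub>R v)"
      using st(5) st'(5) unfolding swap by linarith
    then have "dderiv w (dderiv v f) (x + s *\<^sub>R v + t *\<^sub>R w) = dderiv v (dderiv w f) (x + s' *\<^sub>R w + t' *\<^sub>R v)"
      using h[of n] by (simp only: mult_cancel_left) simp
    with st st' show ?thesis by (intro exI[of _ s] exI[of _ t] exI[of _ s'] exI[of _ t']) auto
  qed
  then obtain s t s' t' where st: "\<And>n. \<bar>s n\<bar> \<le> h n" "\<And>n. \<bar>t n\<bar> \<le> h n" "\<And>n. \<bar>s' n\<bar> \<le> h n" "\<And>n. \<bar>t' n\<bar> \<le> h n"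
    and eq: "\<And>n. dderiv w (dderiv v f) (x + s n *\<^sub>R v + t n *\<^sub>R w) = dderiv v (dderiv w f) (x + s' n *\<^sub>R w + t' n *\<^sub>R v)"
    by metis
  have lim0: "r \<longlonglongrightarrow> 0" if "\<And>n. \<bar>r n\<bar> \<le> h n" for r
    by (rule tendsto_rabs_zero_cancel, rule tendsto_sandwich[OF _ _ tendsto_const h0]) (use that in auto)
  have c: "continuous_on UNIV (dderiv a (dderiv b f))" for a b
    by (intro smooth_continuous smooth_dderiv f)
  have l: "(\<lambda>n. dderiv a (dderiv b f) (x + r n *\<^sub>R b + q n *\<^sub>R a)) \<longlonglongrightarrow> dderiv a (dderiv b f) x"
    if "\<And>n. \<bar>r n\<bar> \<le> h n" "\<And>n. \<bar>q n\<bar> \<le> h n" for a b r q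
  proof -
    have "(\<lambda>n. x + r n *\<^sub>R b + q n *\<^sub>R a) \<longlonglongrightarrow> x + 0 *\<^sub>R b + 0 *\<^sub>R a"
      by (intro tendsto_intros lim0 that)
    from continuous_on_tendsto_compose[OF c this] show ?thesis by simp
  qed
  show ?thesis
    using LIMSEQ_unique[OF l[where a = w and b = v, OF st(1,2)] l[where a = v and b = w, OF st(3,4), folded eq]] .
qed

lemma partial_commute: "smooth f \<Longrightarrow> partial i (partial j f) x = partial j (partial i f) (x :: real^3)" for f :: "real^3 \<Rightarrow> real"
  unfolding partial_def[abs_def] by (rule second_derivative_symmetric)

section \<open>Test functions\<close>

lemma test_fun_support_mono:
  assumes \<phi>: "test_fun \<Omega> \<phi>" and "smooth \<psi>" and z: "\<And>x. x \<notin> closure {x. \<phi> x \<noteq> 0} \<Longrightarrow> \<psi> x = 0"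
  shows "test_fun \<Omega> \<psi>"
proof -
  have "{x. \<psi> x \<noteq> 0} \<subseteq> closure {x. \<phi> x \<noteq> 0}" using z by blast
  then have sub: "closure {x. \<psi> x \<noteq> 0} \<subseteq> closure {x. \<phi> x \<noteq> 0}" by (simp add: closure_minimal)
  have "compact (closure {x. \<phi> x \<noteq> 0} \<inter> closure {x. \<psi> x \<noteq> 0})"
    using \<phi> by (intro compact_Int_closed) (auto simp: test_fun_def)
  with sub have "compact (closure {x. \<psi> x \<noteq> 0})" by (simp only: Int_absorb1)
  then show ?thesis using sub \<phi> assms(2) unfolding test_fun_def by blast
qed

lemma test_fun_smooth: "test_fun \<Omega> \<phi> \<Longrightarrow> smooth \<phi>"
  by (simp add: test_fun_def)

lemma test_fun_outside: "test_fun \<Omega> \<phi> \<Longrightarrow> x \<notin> \<Omega> \<Longrightarrow> \<phi> x = 0"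
  using closure_subset[of "{x. \<phi> x \<noteq> 0}"] unfolding test_fun_def by auto

lemma dderiv_eq_0_outside_support:
  assumes "x \<notin> closure {x. \<phi> x \<noteq> 0}" shows "dderiv v \<phi> x = 0"
proof -
  have "((\<lambda>_. 0) has_derivative (\<lambda>_. 0)) (at x)" by simp
  then have "(\<phi> has_derivative (\<lambda>_. 0)) (at x)"
  proof (rule has_derivative_transform_within_open)
    show "open (- closure {x. \<phi> x \<noteq> 0})" by (intro open_Compl closed_closure)
    show "x \<in> - closure {x. \<phi> x \<noteq> 0}" using assms by simp
    show "0 = \<phi> y" if "y \<in> - closure {x. \<phi> x \<noteq> 0}" for y
      using that closure_subset[of "{x. \<phi> x \<noteq> 0}"] by auto
  qed
  then show ?thesis by (rule dderiv_eqI)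
qed

lemma test_fun_dderiv:
  assumes "test_fun \<Omega> \<phi>" shows "test_fun \<Omega> (dderiv v \<phi>)"
proof (rule test_fun_support_mono[OF assms])
  show "smooth (dderiv v \<phi>)" by (rule smooth_dderiv[OF test_fun_smooth[OF assms]])
  show "dderiv v \<phi> x = 0" if "x \<notin> closure {x. \<phi> x \<noteq> 0}" for x
    by (rule dderiv_eq_0_outside_support[OF that])
qed

lemma test_fun_partial: "test_fun \<Omega> \<phi> \<Longrightarrow> test_fun \<Omega> (partial i \<phi>)"
  unfolding partial_def[abs_def] by (rule test_fun_dderiv)

lemma test_fun_bounded_linear:
  assumes "bounded_linear h" "test_fun \<Omega> \<phi>" shows "test_fun \<Omega> (\<lambda>x. h (\<phi> x))"
proof (rule test_fun_support_mono[OF assms(2)])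
  show "smooth (\<lambda>x. h (\<phi> x))" by (rule smooth_bounded_linear[OF assms(1) test_fun_smooth[OF assms(2)]])
  show "h (\<phi> x) = 0" if "x \<notin> closure {x. \<phi> x \<noteq> 0}" for x
  proof -
    have "\<phi> x = 0" using that closure_subset[of "{x. \<phi> x \<noteq> 0}"] by auto
    then show ?thesis using linear_0[OF bounded_linear.linear[OF assms(1)]] by simp
  qed
qed

lemma test_fun_component: "test_fun \<Omega> \<phi> \<Longrightarrow> test_fun \<Omega> (\<lambda>x. \<phi> x $ i)"
  by (rule test_fun_bounded_linear[OF bounded_linear_vec_nth])

lemma test_fun_add:
  assumes "test_fun \<Omega> \<phi>" "test_fun \<Omega> \<psi>" shows "test_fun \<Omega> (\<lambda>x. \<phi> x + \<psi> x)"
proof -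
  have "{x. \<phi> x + \<psi> x \<noteq> 0} \<subseteq> {x. \<phi> x \<noteq> 0} \<union> {x. \<psi> x \<noteq> 0}" by auto
  then have sub: "closure {x. \<phi> x + \<psi> x \<noteq> 0} \<subseteq> closure {x. \<phi> x \<noteq> 0} \<union> closure {x. \<psi> x \<noteq> 0}"
    by (subst closure_Un[symmetric]) (rule closure_mono)
  have "compact ((closure {x. \<phi> x \<noteq> 0} \<union> closure {x. \<psi> x \<noteq> 0}) \<inter> closure {x. \<phi> x + \<psi> x \<noteq> 0})"
    using assms by (intro compact_Int_closed compact_Un) (auto simp: test_fun_def)
  with sub have "compact (closure {x. \<phi> x + \<psi> x \<noteq> 0})" by (simp only: Int_absorb1)
  moreover have "closure {x. \<phi> x + \<psi> x \<noteq> 0} \<subseteq> \<Omega>" using sub assms by (auto simp: test_fun_def)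
  ultimately show ?thesis
    unfolding test_fun_def using smooth_add[OF assms[THEN test_fun_smooth]] by blast
qed

lemma test_fun_vec:
  fixes \<phi> :: "3 \<Rightarrow> real^3 \<Rightarrow> real"
  assumes "\<And>i. test_fun \<Omega> (\<phi> i)" shows "test_fun \<Omega> (\<lambda>x. \<chi> i. \<phi> i x)"
proof -
  have "(\<lambda>x. \<chi> i. \<phi> i x) = (\<lambda>x. (\<phi> 1 x *\<^sub>R axis 1 1 + \<phi> 2 x *\<^sub>R axis 2 1) + \<phi> 3 x *\<^sub>R axis 3 1)"
    by (auto simp: vec_eq_iff forall_3 axis_def)
  moreover have "test_fun \<Omega> (\<lambda>x. \<phi> i x *\<^sub>R c)" for i and c :: "real^3"
    by (rule test_fun_bounded_linear[OF bounded_linear_scaleR_left assms])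
  ultimately show ?thesis by (simp only:) (rule test_fun_add[OF test_fun_add])
qed

lemma test_fun_mono: "test_fun S \<phi> \<Longrightarrow> S \<subseteq> T \<Longrightarrow> test_fun T \<phi>"
  by (auto simp: test_fun_def)

text \<open>Smooth functions vanishing exactly outside the open box, which increase to its indicator as \<open>k\<close> grows.\<close>

definition bump :: "nat \<Rightarrow> real^3 \<Rightarrow> real^3 \<Rightarrow> real^3 \<Rightarrow> real" where
  "bump k a b x = (\<Prod>i\<in>UNIV. ramp (real (Suc k) * (x $ i - a $ i)) * ramp (real (Suc k) * (b $ i - x $ i)))"

lemma bump_bounds: "0 \<le> bump k a b x" "bump k a b x \<le> 1"
  unfolding bump_def by (auto intro!: prod_nonneg prod_le_1 mult_le_one simp: ramp_bounds)

lemma bump_pos_iff: "bump k a b x > 0 \<longleftrightarrow> x \<in> box a b"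
proof -
  have "ramp s = 0 \<longleftrightarrow> s \<le> 0" for s using ramp_pos[of s] ramp_eq_0[of s] by force
  then have "bump k a b x \<noteq> 0 \<longleftrightarrow> x \<in> box a b"
    by (auto simp: bump_def mem_box_cart prod_zero_iff mult_le_0_iff not_le)
  then show ?thesis using bump_bounds(1)[of k a b x] by linarith
qed

lemma bump_eq_0: "x \<notin> box a b \<Longrightarrow> bump k a b x = 0"
  using bump_pos_iff[of k a b x] bump_bounds(1)[of k a b x] by linarith

lemma smooth_bump: "smooth (bump k a b)"
proof -
  have "Ck m (\<lambda>x. ramp ((real (Suc k) *\<^sub>R axis i 1) \<bullet> x + (- real (Suc k) * a $ i)) *
       ramp ((- real (Suc k) *\<^sub>R axis i 1) \<bullet> x + real (Suc k) * b $ i))" for m i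
    by (intro Ck_mult Ck_flat_exp)
  then have "Ck m (\<lambda>x. ramp (real (Suc k) * (x $ i - a $ i)) * ramp (real (Suc k) * (b $ i - x $ i)))" for m i
    by (simp add: inner_axis' algebra_simps)
  then show ?thesis
    unfolding smooth_def bump_def[abs_def] by (intro allI Ck_prod) auto
qed

lemma test_fun_bump: "cbox a b \<subseteq> \<Omega> \<Longrightarrow> test_fun \<Omega> (bump k a b)"
proof -
  assume sub: "cbox a b \<subseteq> \<Omega>"
  have "{x. bump k a b x \<noteq> 0} \<subseteq> cbox a b" using bump_eq_0 box_subset_cbox by blast
  then have c: "closure {x. bump k a b x \<noteq> 0} \<subseteq> cbox a b" by (rule closure_minimal) (rule closed_cbox)
  have "compact (cbox a b \<inter> closure {x. bump k a b x \<noteq> 0})"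
    by (rule compact_Int_closed[OF compact_cbox closed_closure])
  with c have "compact (closure {x. bump k a b x \<noteq> 0})" by (simp only: Int_absorb1)
  then show ?thesis unfolding test_fun_def using smooth_bump c sub by blast
qed

lemma bump_tendsto: "(\<lambda>k. bump k a b x) \<longlonglongrightarrow> indicator (box a b) x"
proof (cases "x \<in> box a b")
  case True
  have r: "(\<lambda>k. ramp (real (Suc k) * c)) \<longlonglongrightarrow> 1" if "c > 0" for c
  proof -
    have "filterlim (\<lambda>k. real (Suc k)) at_top sequentially"
      by (rule filterlim_compose[OF filterlim_real_sequentially filterlim_Suc])
    then have "filterlim (\<lambda>k. c * real (Suc k)) at_top sequentially"
      using that by (intro filterlim_tendsto_pos_mult_at_top[OF tendsto_const])
    from filterlim_compose[OF ramp_at_top this] show ?thesis by (simp only: mult.commute)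
  qed
  have "(\<lambda>k. bump k a b x) \<longlonglongrightarrow> (\<Prod>i\<in>(UNIV::3 set). 1 * 1)"
    unfolding bump_def using True by (intro tendsto_prod tendsto_mult r) (auto simp: mem_box_cart)
  then show ?thesis using True by simp
next
  case False then show ?thesis by (simp add: bump_eq_0)
qed

text \<open>Boxes form an intersection-stable generator of the Borel sets, and the sets over which \<open>g\<close> integrates to zero are closed
under complements and countable disjoint unions; so \<open>g\<close> and 0 define the same signed measure.\<close>

lemma AE_zero_of_box_integrals:
  fixes g :: "real^3 \<Rightarrow> real"
  assumes g: "integrable lebesgue g" and zero: "\<And>a b. (LINT x|lebesgue. indicator (box a b) x * g x) = 0"
    and total: "(LINT x|lebesgue. g x) = 0"
  shows "AE x in lebesgue. g x = 0"
proof -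
  have si: "set_integrable lebesgue A g" if "A \<in> sets lebesgue" for A
    unfolding set_integrable_def using integrable_mult_indicator[OF that g] .
  have borel: "(LINT x:A|lebesgue. g x) = 0" if "A \<in> sets borel" for A
  proof -
    let ?E = "range (\<lambda>(a, b). box a b::(real^3) set)"
    have A: "A \<in> sigma_sets UNIV ?E" using that by (simp add: borel_eq_box)
    have sub: "S \<in> sets lebesgue" if "S \<in> sigma_sets UNIV ?E" for S
    proof -
      have "S \<in> sets borel" using that by (simp add: borel_eq_box)
      then show ?thesis by simp
    qed
    have "Int_stable ?E" by (auto simp: Int_stable_def box_Int_box)
    then show ?thesis
    proof (rule sigma_sets_induct_disjoint[OF _ _ A])
      show "(LINT x:B|lebesgue. g x) = 0" if "B \<in> ?E" for B
        using that zero by (auto simp: set_lebesgue_integral_def)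
      show "(LINT x:{}|lebesgue. g x) = 0" by (simp add: set_lebesgue_integral_def)
      fix B assume B: "B \<in> sigma_sets UNIV ?E" "(LINT x:B|lebesgue. g x) = 0"
      have "(LINT x:(UNIV - B) \<union> B|lebesgue. g x) = (LINT x:(UNIV - B)|lebesgue. g x) + (LINT x:B|lebesgue. g x)"
        using sub[OF B(1)] by (intro set_integral_Un si) auto
      moreover have "(LINT x:(UNIV - B) \<union> B|lebesgue. g x) = 0"
        using total by (simp add: set_lebesgue_integral_def)
      ultimately show "(LINT x:UNIV - B|lebesgue. g x) = 0" using B by simp
    next
      fix B :: "nat \<Rightarrow> _" assume B: "disjoint_family B" "range B \<subseteq> sigma_sets UNIV ?E" "\<And>i. (LINT x:B i|lebesgue. g x) = 0"
      have m: "B i \<in> sets lebesgue" for i using B(2) sub by blast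
      have "(LINT x:(\<Union>i. B i)|lebesgue. g x) = suminf (\<lambda>i. LINT x:B i|lebesgue. g x)"
        using B(1) m by (intro lebesgue_integral_countable_add si) (auto simp: disjoint_family_on_def)
      then show "(LINT x:(\<Union>i. B i)|lebesgue. g x) = 0" using B(3) by simp
    qed auto
  qed
  have "AE x in lebesgue. g x = (\<lambda>_. 0) x"
  proof (rule density_unique_real)
    fix A :: "(real^3) set" assume A: "A \<in> sets lebesgue"
    obtain B N N' where BN: "A = B \<union> N" "N \<subseteq> N'" "N' \<in> null_sets lborel" "B \<in> sets lborel"
      using A by (rule sets_completionE)
    then have "(LINT x:A|lebesgue. g x) = (LINT x:B|lebesgue. g x)"
    proof -
      have "AE x in lebesgue. x \<notin> N'" using null_sets_completionI[OF BN(3)] by (rule AE_not_in)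
      then have ae: "AE x in lebesgue. indicator A x *\<^sub>R g x = indicator B x *\<^sub>R g x"
        by eventually_elim (use BN(1,2) in \<open>auto simp: indicator_def\<close>)
      have "B \<in> sets lebesgue" using BN(4) by simp
      then show ?thesis unfolding set_lebesgue_integral_def
        using A g by (intro integral_cong_AE ae borel_measurable_scaleR borel_measurable_indicator) auto
    qed
    then show "(LINT x:A|lebesgue. g x) = (LINT x:A|lebesgue. 0)"
      using borel[of B] BN(4) by (simp add: set_lebesgue_integral_def)
  qed (use g in auto)
  then show ?thesis by simp
qed

text \<open>Bumps on a closed box inside \<open>S\<close> are admissible test functions converging to the indicator of the open box,
so the integrals of \<open>g\<close> over all such boxes vanish. An open set is a countable union of closed boxes.\<close>

lemma fundamental_lemma:
  fixes g :: "real^3 \<Rightarrow> real"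
  assumes S: "open S" and g: "integrable (lebesgue_on S) g"
    and zero: "\<And>\<phi>. test_fun S \<phi> \<Longrightarrow> (LINT x|lebesgue_on S. g x * \<phi> x) = 0"
  shows "AE x in lebesgue_on S. g x = 0"
proof -
  have Sm: "S \<in> sets lebesgue" using S by simp
  define G where "G x = indicator S x * g x" for x
  have G: "integrable lebesgue G"
    using g Sm by (simp add: integrable_restrict_space G_def[abs_def])
  have box: "(LINT x|lebesgue. indicator (box a b) x * G x) = 0" if ab: "cbox a b \<subseteq> S" for a b
  proof -
    have "(\<lambda>k. LINT x|lebesgue. bump k a b x * G x) \<longlonglongrightarrow> (LINT x|lebesgue. indicator (box a b) x * G x)"
    proof (rule integral_dominated_convergence[where w = "\<lambda>x. norm (G x)"])
      show "(\<lambda>x. indicator (box a b) x * G x) \<in> borel_measurable lebesgue"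
        using G by (intro borel_measurable_times borel_measurable_indicator) auto
      show "(\<lambda>x. bump k a b x * G x) \<in> borel_measurable lebesgue" for k
      proof -
        have "bump k a b \<in> borel_measurable borel"
          by (intro borel_measurable_continuous_onI smooth_continuous smooth_bump)
        then have "bump k a b \<in> borel_measurable lebesgue" by (simp add: measurable_completion)
        then show ?thesis using G by (intro borel_measurable_times) auto
      qed
      show "AE x in lebesgue. (\<lambda>k. bump k a b x * G x) \<longlonglongrightarrow> indicator (box a b) x * G x"
        by (intro AE_I2 tendsto_intros bump_tendsto)
      show "AE x in lebesgue. norm (bump k a b x * G x) \<le> norm (G x)" for k
        using bump_bounds by (intro AE_I2) (simp add: abs_mult mult_left_le_one_le)
    qed (use G in auto)
    moreover have "(LINT x|lebesgue. bump k a b x * G x) = 0" for k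
      using zero[OF test_fun_bump[OF ab], of k] Sm
      by (subst (asm) integral_restrict_space) (auto simp: G_def mult_ac)
    ultimately show ?thesis by (simp add: LIMSEQ_const_iff)
  qed
  have ae: "AE x in lebesgue. x \<in> cbox a b \<longrightarrow> G x = 0" if ab: "cbox a b \<subseteq> S" for a b
  proof -
    have "AE x in lebesgue. indicator (box a b) x * G x = 0"
    proof (rule AE_zero_of_box_integrals)
      show "integrable lebesgue (\<lambda>x. indicator (box a b) x * G x)"
        using integrable_mult_indicator[OF _ G, of "box a b"] by simp
      show "(LINT x|lebesgue. indicator (box a b) x * G x) = 0" by (rule box[OF ab])
      show "(LINT x|lebesgue. indicator (box c d) x * (indicator (box a b) x * G x)) = 0" for c d
      proof -
        \<comment> \<open>the intersection is a box again, and its closure stays in \<open>cbox a b\<close> unless it is empty\<close>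
        obtain c' d' where cd: "box c d \<inter> box a b = box c' d'" "cbox c' d' \<subseteq> cbox a b \<or> box c' d' = {}"
        proof -
          have e: "box c d \<inter> box a b = box (\<Sum>i\<in>Basis. max (c \<bullet> i) (a \<bullet> i) *\<^sub>R i) (\<Sum>i\<in>Basis. min (d \<bullet> i) (b \<bullet> i) *\<^sub>R i)"
            by (rule box_Int_box)
          show ?thesis by (rule that[OF e]) (auto simp: subset_box mem_box)
        qed
        have "(\<lambda>x. indicator (box c d) x * (indicator (box a b) x * G x)) = (\<lambda>x. indicator (box c' d') x * G x)"
          by (auto simp: cd(1)[symmetric] indicator_def)
        then show ?thesis using cd(2) box[of c' d'] ab by auto
      qed
    qed
    moreover have "AE x in lebesgue. x \<notin> cbox a b - box a b"
      by (intro AE_not_in null_sets_completionI null_sets_cbox_Diff_box)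
    ultimately show ?thesis by eventually_elim (auto simp: indicator_def split: if_splits)
  qed
  obtain D where D: "countable D" "D \<subseteq> Pow S" "\<And>X. X \<in> D \<Longrightarrow> \<exists>a b. X = cbox a b" "\<Union>D = S"
    using open_countable_Union_open_cbox[OF S] by metis
  have "AE x in lebesgue. \<forall>X\<in>D. x \<in> X \<longrightarrow> G x = 0"
  proof (rule AE_ball_countable'[OF _ D(1)])
    fix X assume X: "X \<in> D"
    then obtain a b where "X = cbox a b" using D(3) by blast
    then show "AE x in lebesgue. x \<in> X \<longrightarrow> G x = 0" using ae[of a b] X D(2) by auto
  qed
  then have "AE x in lebesgue. x \<in> S \<longrightarrow> g x = 0"
  proof eventually_elim
    case (elim x)
    have "G x = 0" if "x \<in> S" using elim that D(4) by blast
    then show ?case by (simp add: G_def)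
  qed
  then show ?thesis using Sm by (simp add: AE_restrict_space_iff)
qed

section \<open>The inner product of square-integrable functions\<close>

lemma integrable_inner_l2:
  assumes "l2_fun \<Omega> f" "l2_fun \<Omega> g"
  shows "integrable (lebesgue_on \<Omega>) (\<lambda>x. f x \<bullet> g x)"
proof (rule Bochner_Integration.integrable_bound)
  show "integrable (lebesgue_on \<Omega>) (\<lambda>x. (norm (f x))\<^sup>2 + (norm (g x))\<^sup>2)"
    using assms by (intro Bochner_Integration.integrable_add) (auto simp: l2_fun_def)
  show "(\<lambda>x. f x \<bullet> g x) \<in> borel_measurable (lebesgue_on \<Omega>)"
    using assms by (auto simp: l2_fun_def)
  have "norm (a \<bullet> b) \<le> (norm a)\<^sup>2 + (norm b)\<^sup>2" for a b :: 'a
  proof -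
    have "norm (a \<bullet> b) \<le> norm a * norm b" by (simp add: Cauchy_Schwarz_ineq2)
    moreover have "2 * (norm a * norm b) \<le> (norm a)\<^sup>2 + (norm b)\<^sup>2"
      using sum_squares_bound[of "norm a" "norm b"] by simp
    moreover have "0 \<le> norm a * norm b" by simp
    ultimately show ?thesis by linarith
  qed
  then show "AE x in lebesgue_on \<Omega>. norm (f x \<bullet> g x) \<le> norm ((norm (f x))\<^sup>2 + (norm (g x))\<^sup>2)"
    by (intro AE_I2) simp
qed

lemma l2_fun_add:
  assumes "l2_fun \<Omega> f" "l2_fun \<Omega> g" shows "l2_fun \<Omega> (\<lambda>x. f x + g x)"
proof -
  have "(\<lambda>x. (norm (f x + g x))\<^sup>2) = (\<lambda>x. f x \<bullet> f x + 2 * (f x \<bullet> g x) + g x \<bullet> g x)"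
    by (auto simp: power2_norm_eq_inner inner_add inner_commute)
  then have "integrable (lebesgue_on \<Omega>) (\<lambda>x. (norm (f x + g x))\<^sup>2)"
    using assms by (simp only:) (intro Bochner_Integration.integrable_add integrable_mult_right integrable_inner_l2)
  with assms show ?thesis by (auto simp: l2_fun_def)
qed

lemma l2_fun_bounded_linear:
  assumes h: "bounded_linear h" and f: "l2_fun \<Omega> f" shows "l2_fun \<Omega> (\<lambda>x. h (f x))"
proof -
  obtain C where C: "\<And>x. norm (h x) \<le> norm x * C" using bounded_linear.bounded[OF h] by blast
  have m: "(\<lambda>x. h (f x)) \<in> borel_measurable (lebesgue_on \<Omega>)"
  proof (rule measurable_compose[of f _ borel])
    show "f \<in> borel_measurable (lebesgue_on \<Omega>)" using f by (simp add: l2_fun_def)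
    show "h \<in> borel_measurable borel"
      by (rule borel_measurable_continuous_onI[OF linear_continuous_on[OF h]])
  qed
  have "integrable (lebesgue_on \<Omega>) (\<lambda>x. (norm (h (f x)))\<^sup>2)"
  proof (rule Bochner_Integration.integrable_bound)
    show "integrable (lebesgue_on \<Omega>) (\<lambda>x. C\<^sup>2 * (norm (f x))\<^sup>2)"
      using f by (intro integrable_mult_right) (simp add: l2_fun_def)
    show "(\<lambda>x. (norm (h (f x)))\<^sup>2) \<in> borel_measurable (lebesgue_on \<Omega>)"
      using m by simp
    have "(norm (h y))\<^sup>2 \<le> C\<^sup>2 * (norm y)\<^sup>2" for y
      using power_mono[OF C[of y] norm_ge_zero, of 2] by (simp add: power_mult_distrib mult.commute)
    then show "AE x in lebesgue_on \<Omega>. norm ((norm (h (f x)))\<^sup>2) \<le> norm (C\<^sup>2 * (norm (f x))\<^sup>2)"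
      by (intro AE_I2) simp
  qed
  with m show ?thesis by (simp add: l2_fun_def)
qed

lemma l2_fun_scaleR: "l2_fun \<Omega> f \<Longrightarrow> l2_fun \<Omega> (\<lambda>x. c *\<^sub>R f x)"
  by (rule l2_fun_bounded_linear[OF bounded_linear_scaleR_right])

lemma l2_fun_component: "l2_fun \<Omega> f \<Longrightarrow> l2_fun \<Omega> (\<lambda>x. f x $ i)"
  by (rule l2_fun_bounded_linear[OF bounded_linear_vec_nth])

lemma l2_fun_diff: "l2_fun \<Omega> f \<Longrightarrow> l2_fun \<Omega> g \<Longrightarrow> l2_fun \<Omega> (\<lambda>x. f x - g x)"
  using l2_fun_add[of \<Omega> f "\<lambda>x. (- 1) *\<^sub>R g x"] l2_fun_scaleR[of \<Omega> g "- 1"] by simp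

lemma l2_fun_zero: "l2_fun \<Omega> (\<lambda>x. 0)"
  by (simp add: l2_fun_def)

lemma l2_fun_sum: "finite B \<Longrightarrow> (\<And>b. b \<in> B \<Longrightarrow> l2_fun \<Omega> (f b)) \<Longrightarrow> l2_fun \<Omega> (\<lambda>x. \<Sum>b\<in>B. f b x)"
  by (induction rule: finite_induct) (auto intro: l2_fun_add l2_fun_zero)

lemma l2_fun_vec:
  fixes f :: "real^3 \<Rightarrow> ('b::euclidean_space)^3"
  assumes "\<And>i. l2_fun \<Omega> (\<lambda>x. f x $ i)" shows "l2_fun \<Omega> f"
proof -
  have "bounded_linear (\<lambda>y::'b. axis i y :: 'b^3)" for i :: 3
    by (rule linear_conv_bounded_linear[THEN iffD1], rule linearI) (auto simp: vec_eq_iff axis_def)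
  then have "l2_fun \<Omega> (\<lambda>x. axis i (f x $ i) :: 'b^3)" for i :: 3
    by (rule l2_fun_bounded_linear[OF _ assms])
  then have "l2_fun \<Omega> (\<lambda>x. axis 1 (f x $ 1) + axis 2 (f x $ 2) + axis 3 (f x $ 3) :: 'b^3)"
    by (intro l2_fun_add)
  moreover have "(\<lambda>x. axis 1 (f x $ 1) + axis 2 (f x $ 2) + axis 3 (f x $ 3)) = f"
    by (auto simp: vec_eq_iff forall_3 axis_def)
  ultimately show ?thesis by (simp only:)
qed

lemma l2_inner_commute: "l2_inner \<Omega> f g = l2_inner \<Omega> g f"
  by (simp add: l2_inner_def inner_commute)

lemma l2_inner_add_left:
  "l2_fun \<Omega> f \<Longrightarrow> l2_fun \<Omega> g \<Longrightarrow> l2_fun \<Omega> h \<Longrightarrow> l2_inner \<Omega> (\<lambda>x. f x + g x) h = l2_inner \<Omega> f h + l2_inner \<Omega> g h"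
  unfolding l2_inner_def by (simp add: inner_add_left integrable_inner_l2)

lemma l2_inner_diff_left:
  "l2_fun \<Omega> f \<Longrightarrow> l2_fun \<Omega> g \<Longrightarrow> l2_fun \<Omega> h \<Longrightarrow> l2_inner \<Omega> (\<lambda>x. f x - g x) h = l2_inner \<Omega> f h - l2_inner \<Omega> g h"
  unfolding l2_inner_def by (simp add: inner_diff_left integrable_inner_l2)

lemma l2_inner_scaleR_left: "l2_inner \<Omega> (\<lambda>x. c *\<^sub>R f x) g = c * l2_inner \<Omega> f g"
  unfolding l2_inner_def by simp

lemma l2_inner_zero_left: "l2_inner \<Omega> (\<lambda>x. 0) g = 0"
  by (simp add: l2_inner_def)

lemma l2_inner_sum_left:
  assumes "finite B" "\<And>b. b \<in> B \<Longrightarrow> l2_fun \<Omega> (f b)" "l2_fun \<Omega> g"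
  shows "l2_inner \<Omega> (\<lambda>x. \<Sum>b\<in>B. c b *\<^sub>R f b x) g = (\<Sum>b\<in>B. c b * l2_inner \<Omega> (f b) g)"
  using assms(1,2)
proof (induction rule: finite_induct)
  case (insert b B)
  have "l2_inner \<Omega> (\<lambda>x. \<Sum>b\<in>insert b B. c b *\<^sub>R f b x) g = l2_inner \<Omega> (\<lambda>x. c b *\<^sub>R f b x + (\<Sum>b\<in>B. c b *\<^sub>R f b x)) g"
    using insert.hyps by simp
  also have "\<dots> = l2_inner \<Omega> (\<lambda>x. c b *\<^sub>R f b x) g + l2_inner \<Omega> (\<lambda>x. \<Sum>b\<in>B. c b *\<^sub>R f b x) g"
    using insert.prems insert.hyps assms(3) by (intro l2_inner_add_left l2_fun_scaleR l2_fun_sum) auto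
  finally show ?case using insert by (simp add: l2_inner_scaleR_left)
qed (simp add: l2_inner_def)

lemma l2_inner_cong_AE:
  assumes "l2_fun \<Omega> f" "l2_fun \<Omega> f'" "l2_fun \<Omega> g" "AE x in lebesgue_on \<Omega>. f x = f' x"
  shows "l2_inner \<Omega> f g = l2_inner \<Omega> f' g"
  unfolding l2_inner_def
proof (rule integral_cong_AE)
  show "AE x in lebesgue_on \<Omega>. f x \<bullet> g x = f' x \<bullet> g x" using assms(4) by eventually_elim simp
qed (use assms integrable_inner_l2 borel_measurable_integrable in blast)+

lemma l2_inner_self_nonneg: "0 \<le> l2_inner \<Omega> f f"
  unfolding l2_inner_def by (rule Bochner_Integration.integral_nonneg) simp

lemma l2_inner_self_eq_0:
  assumes "l2_fun \<Omega> f" "l2_inner \<Omega> f f = 0" shows "AE x in lebesgue_on \<Omega>. f x = 0"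
proof -
  have "AE x in lebesgue_on \<Omega>. f x \<bullet> f x = 0"
    using integral_nonneg_eq_0_iff_AE[OF integrable_inner_l2[OF assms(1,1)]] assms(2) by (simp add: l2_inner_def)
  then show ?thesis by eventually_elim simp
qed

lemma l2_norm_square: "(l2_norm \<Omega> f)\<^sup>2 = l2_inner \<Omega> f f"
  by (simp add: l2_norm_def l2_inner_self_nonneg)

text \<open>Positivity of the quadratic form \<open>(a f - b g, a f - b g)\<close>, evaluated at \<open>a = (g, g)\<close> and \<open>b = (f, g)\<close>; if \<open>(g, g) = 0\<close>,
a large multiple of \<open>g\<close> forces \<open>(f, g) = 0\<close>. That case occurs for nonzero \<open>g\<close> as well, the inner product being only positive semidefinite on functions.\<close>

lemma l2_Cauchy_Schwarz:
  assumes f: "l2_fun \<Omega> f" and g: "l2_fun \<Omega> g"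
  shows "\<bar>l2_inner \<Omega> f g\<bar> \<le> l2_norm \<Omega> f * l2_norm \<Omega> g"
proof -
  define F G I where "F = l2_inner \<Omega> f f" and "G = l2_inner \<Omega> g g" and "I = l2_inner \<Omega> f g"
  have q: "0 \<le> a * a * F - 2 * a * b * I + b * b * G" for a b
  proof -
    have "l2_inner \<Omega> (\<lambda>x. a *\<^sub>R f x - b *\<^sub>R g x) (\<lambda>x. a *\<^sub>R f x - b *\<^sub>R g x)
       = a * l2_inner \<Omega> f (\<lambda>x. a *\<^sub>R f x - b *\<^sub>R g x) - b * l2_inner \<Omega> g (\<lambda>x. a *\<^sub>R f x - b *\<^sub>R g x)"
      by (subst l2_inner_diff_left) (auto intro!: l2_fun_scaleR l2_fun_diff f g simp: l2_inner_scaleR_left)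
    also have "l2_inner \<Omega> f (\<lambda>x. a *\<^sub>R f x - b *\<^sub>R g x) = a * F - b * I"
      by (subst l2_inner_commute, subst l2_inner_diff_left)
         (auto intro!: l2_fun_scaleR f g simp: l2_inner_scaleR_left F_def I_def l2_inner_commute)
    also have "l2_inner \<Omega> g (\<lambda>x. a *\<^sub>R f x - b *\<^sub>R g x) = a * I - b * G"
      by (subst l2_inner_commute, subst l2_inner_diff_left)
         (auto intro!: l2_fun_scaleR f g simp: l2_inner_scaleR_left G_def I_def l2_inner_commute)
    finally have "l2_inner \<Omega> (\<lambda>x. a *\<^sub>R f x - b *\<^sub>R g x) (\<lambda>x. a *\<^sub>R f x - b *\<^sub>R g x) = a * (a * F - b * I) - b * (a * I - b * G)" .
    moreover have "a * (a * F - b * I) - b * (a * I - b * G) = a * a * F - 2 * a * b * I + b * b * G" by (simp add: algebra_simps)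
    ultimately show ?thesis using l2_inner_self_nonneg[of \<Omega> "\<lambda>x. a *\<^sub>R f x - b *\<^sub>R g x"] by simp
  qed
  have F0: "0 \<le> F" and G0: "0 \<le> G" by (simp_all add: F_def G_def l2_inner_self_nonneg)
  have "I * I \<le> F * G"
  proof (cases "G = 0")
    case True
    have "I = 0"
    proof (rule ccontr)
      assume "I \<noteq> 0"
      \<comment> \<open>the linear coefficient is chosen so that the cross term exceeds \<open>F\<close>\<close>
      then have "0 \<le> F - 2 * (F + 1)" using q[of 1 "(F + 1) / I"] True by simp
      then show False using F0 by simp
    qed
    then show ?thesis using True by simp
  next
    case False
    have "0 \<le> G * (F * G - I * I)" using q[of G I] by (simp add: algebra_simps)
    then show ?thesis using False G0 by (simp add: zero_le_mult_iff)
  qed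
  then have "sqrt (I * I) \<le> sqrt (F * G)" by (rule real_sqrt_le_mono)
  then show ?thesis by (simp add: l2_norm_def F_def G_def I_def real_sqrt_mult)
qed

lemma l2_inner_componentwise:
  fixes f :: "real^3 \<Rightarrow> real^3"
  shows "l2_fun \<Omega> f \<Longrightarrow> l2_fun \<Omega> g \<Longrightarrow> l2_inner \<Omega> f g = (\<Sum>i\<in>UNIV. l2_inner \<Omega> (\<lambda>x. f x $ i) (\<lambda>x. g x $ i))"
  unfolding l2_inner_def inner_vec_def
  by (rule Bochner_Integration.integral_sum) (rule integrable_inner_l2[OF l2_fun_component l2_fun_component])

lemma l2_fun_continuous:
  assumes "bounded \<Omega>" "\<Omega> \<in> sets lebesgue" "continuous_on UNIV (f :: real^3 \<Rightarrow> 'b::euclidean_space)"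
  shows "l2_fun \<Omega> f"
proof -
  have m: "g \<in> borel_measurable (lebesgue_on \<Omega>)" if "continuous_on UNIV g" for g :: "real^3 \<Rightarrow> 'c::euclidean_space"
    using borel_measurable_continuous_onI[OF that] by (intro measurable_restrict_space1) (simp add: measurable_completion)
  have c: "continuous_on UNIV (\<lambda>x. (norm (f x))\<^sup>2)" by (intro continuous_intros assms)
  obtain R where R: "\<Omega> \<subseteq> cball 0 R" using assms(1) unfolding bounded_iff by (auto simp: subset_eq)
  have "bounded ((\<lambda>x. (norm (f x))\<^sup>2) ` cball 0 R)"
    by (intro compact_imp_bounded compact_continuous_image continuous_on_subset[OF c]) auto
  then obtain C where C: "\<And>x. x \<in> cball 0 R \<Longrightarrow> norm ((norm (f x))\<^sup>2) \<le> C"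
    unfolding bounded_iff by (metis image_eqI)
  have "integrable (lebesgue_on \<Omega>) (\<lambda>x. (norm (f x))\<^sup>2)"
  proof (rule Bochner_Integration.integrable_bound)
    have "finite_measure (lebesgue_on \<Omega>)"
      by (rule finite_measure_lebesgue_on[OF bounded_set_imp_lmeasurable[OF assms(1,2)]])
    then show "integrable (lebesgue_on \<Omega>) (\<lambda>x. C)" by (rule finite_measure.integrable_const)
    show "AE x in lebesgue_on \<Omega>. norm ((norm (f x))\<^sup>2) \<le> norm C"
    proof (rule AE_I2)
      fix x assume "x \<in> space (lebesgue_on \<Omega>)"
      then have "x \<in> cball 0 R" using R by auto
      from C[OF this] show "norm ((norm (f x))\<^sup>2) \<le> norm C" by simp
    qed
  qed (rule m[OF c])
  then show ?thesis using m[OF assms(3)] by (simp add: l2_fun_def)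
qed

section \<open>Weak derivatives\<close>

lemma integrable_scaleR_l2:
  fixes r :: "real^3 \<Rightarrow> real"
  assumes "l2_fun \<Omega> r" "l2_fun \<Omega> f"
  shows "integrable (lebesgue_on \<Omega>) (\<lambda>x. r x *\<^sub>R f x)"
proof (rule Bochner_Integration.integrable_bound)
  show "integrable (lebesgue_on \<Omega>) (\<lambda>x. (norm (r x))\<^sup>2 + (norm (f x))\<^sup>2)"
    using assms by (intro Bochner_Integration.integrable_add) (auto simp: l2_fun_def)
  show "(\<lambda>x. r x *\<^sub>R f x) \<in> borel_measurable (lebesgue_on \<Omega>)"
    using assms by (auto simp: l2_fun_def)
  have "norm (a *\<^sub>R b) \<le> (norm a)\<^sup>2 + (norm b)\<^sup>2" for a :: real and b :: 'a
  proof -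
    have "2 * (norm a * norm b) \<le> (norm a)\<^sup>2 + (norm b)\<^sup>2"
      using sum_squares_bound[of "norm a" "norm b"] by simp
    moreover have "0 \<le> norm a * norm b" by simp
    ultimately show ?thesis unfolding norm_scaleR real_norm_def by linarith
  qed
  then show "AE x in lebesgue_on \<Omega>. norm (r x *\<^sub>R f x) \<le> norm ((norm (r x))\<^sup>2 + (norm (f x))\<^sup>2)"
    by (intro AE_I2) simp
qed

lemma l2_inner_restrict:
  assumes "S \<subseteq> \<Omega>" "S \<in> sets lebesgue" "\<Omega> \<in> sets lebesgue" "\<And>x. x \<notin> S \<Longrightarrow> \<phi> x = 0"
  shows "l2_inner \<Omega> f \<phi> = l2_inner S f \<phi>"
proof -
  have eq: "indicator \<Omega> x *\<^sub>R (f x \<bullet> \<phi> x) = indicator S x *\<^sub>R (f x \<bullet> \<phi> x)" for x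
    using assms(1) assms(4)[of x] by (cases "x \<in> S") (auto simp: indicator_def)
  have "l2_inner \<Omega> f \<phi> = (LINT x|lebesgue. indicator \<Omega> x *\<^sub>R (f x \<bullet> \<phi> x))"
    unfolding l2_inner_def using assms(3) by (intro integral_restrict_space) simp
  also have "\<dots> = (LINT x|lebesgue. indicator S x *\<^sub>R (f x \<bullet> \<phi> x))"
    by (simp only: eq)
  also have "\<dots> = l2_inner S f \<phi>"
    unfolding l2_inner_def using assms(2) by (intro integral_restrict_space[symmetric]) simp
  finally show ?thesis .
qed

lemma l2_inner_cong:
  "(\<And>x. x \<in> S \<Longrightarrow> f x = f' x) \<Longrightarrow> (\<And>x. x \<in> S \<Longrightarrow> g x = g' x) \<Longrightarrow> l2_inner S f g = l2_inner S f' g'"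
  unfolding l2_inner_def by (rule Bochner_Integration.integral_cong) auto

lemma integration_by_parts:
  fixes h \<phi> :: "real^3 \<Rightarrow> real"
  assumes h: "smooth h" and \<phi>: "test_fun S \<phi>" and S: "open S"
  shows "l2_inner S h (partial i \<phi>) = - l2_inner S (partial i h) \<phi>"
proof -
  let ?C = "closure {x. \<phi> x \<noteq> 0}"
  note s\<phi> = test_fun_smooth[OF \<phi>]
  obtain R where R: "?C \<subseteq> cball 0 R"
  proof -
    have "bounded ?C" using \<phi> compact_imp_bounded by (auto simp: test_fun_def)
    then show ?thesis using that unfolding bounded_iff by (auto simp: subset_eq)
  qed
  have z: "\<phi> x = 0" if "x \<notin> cball 0 R" for x
    using that R closure_subset[of "{x. \<phi> x \<noteq> 0}"] by auto
  have z': "partial i \<phi> x = 0" if "x \<notin> cball 0 R" for x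
    unfolding partial_def using that R by (intro dderiv_eq_0_outside_support) auto
  have zS: "\<phi> x = 0" "partial i \<phi> x = 0" if "x \<notin> S" for x
    using that test_fun_outside[OF \<phi>] test_fun_outside[OF test_fun_partial[OF \<phi>]] by auto
  have c: "continuous_on UNIV h" "continuous_on UNIV \<phi>" "continuous_on UNIV (partial i h)" "continuous_on UNIV (partial i \<phi>)"
    using h s\<phi> smooth_partial smooth_continuous by blast+
  have i: "integrable lborel (\<lambda>x. h x * partial i \<phi> x)" "integrable lborel (\<lambda>x. partial i h x * \<phi> x)"
    by (rule integrable_continuous_bounded_support[of _ R]; use z z' in \<open>auto intro!: continuous_on_mult c\<close>)+
  have "(LINT x|lborel. h x * partial i \<phi> x + partial i h x * \<phi> x) = 0"
  proof (rule integral_directional_derivative_eq_0[of "\<lambda>x. h x * \<phi> x" "\<lambda>x v. h x * dderiv v \<phi> x + dderiv v h x * \<phi> x" "axis i 1" R, folded partial_def])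
    show "((\<lambda>x. h x * \<phi> x) has_derivative (\<lambda>v. h x * dderiv v \<phi> x + dderiv v h x * \<phi> x)) (at x)" for x
      by (rule has_derivative_mult[OF smooth_has_derivative[OF h] smooth_has_derivative[OF s\<phi>]])
    show "continuous_on UNIV (\<lambda>x. h x * partial i \<phi> x + partial i h x * \<phi> x)"
      by (intro continuous_on_add continuous_on_mult c)
  qed (use z in simp)
  then have eq: "(LINT x|lborel. h x * partial i \<phi> x) + (LINT x|lborel. partial i h x * \<phi> x) = 0"
    using i by simp
  have *: "l2_inner S a b = (LINT x|lborel. a x * b x)"
    if "continuous_on UNIV a" "continuous_on UNIV b" "\<And>x. x \<notin> S \<Longrightarrow> b x = 0" for a b :: "real^3 \<Rightarrow> real"
  proof -
    have "l2_inner S a b = (LINT x|lebesgue. indicator S x * (a x * b x))"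
      unfolding l2_inner_def using S by (subst integral_restrict_space) auto
    also have "\<dots> = (LINT x|lebesgue. a x * b x)"
    proof (rule arg_cong[where f = "integral\<^sup>L lebesgue"], rule ext)
      show "indicator S x * (a x * b x) = a x * b x" for x using that(3)[of x] by (cases "x \<in> S") auto
    qed
    also have "\<dots> = (LINT x|lborel. a x * b x)"
      by (rule integral_completion) (use borel_measurable_continuous_onI[OF continuous_on_mult[OF that(1,2)]] in simp)
    finally show ?thesis .
  qed
  have "l2_inner S h (partial i \<phi>) = (LINT x|lborel. h x * partial i \<phi> x)"
    by (rule *) (use c zS in auto)
  moreover have "l2_inner S (partial i h) \<phi> = (LINT x|lborel. partial i h x * \<phi> x)"
    by (rule *) (use c zS in auto)
  ultimately show ?thesis using eq by linarith
qed

locale bounded_domain =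
  fixes \<Omega> :: "(real^3) set"
  assumes open_domain: "open \<Omega>" and bounded_domain: "bounded \<Omega>"
begin

lemma domain_sets: "\<Omega> \<in> sets lebesgue"
  using open_domain by simp

lemma l2_fun_smooth: "smooth h \<Longrightarrow> l2_fun \<Omega> h"
  by (rule l2_fun_continuous[OF bounded_domain domain_sets smooth_continuous])

lemma l2_fun_test: "test_fun \<Omega> \<phi> \<Longrightarrow> l2_fun \<Omega> \<phi>"
  by (rule l2_fun_smooth[OF test_fun_smooth])

lemma integrable_l2:
  fixes f :: "real^3 \<Rightarrow> real"
  assumes "l2_fun \<Omega> f" shows "integrable (lebesgue_on \<Omega>) f"
  using integrable_inner_l2[OF assms l2_fun_smooth[OF smooth_const[of 1]]] by simp

lemma weak_zero:
  fixes d :: "real^3 \<Rightarrow> real"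
  assumes "l2_fun \<Omega> d" "\<And>\<phi>. test_fun \<Omega> \<phi> \<Longrightarrow> l2_inner \<Omega> d \<phi> = 0"
  shows "AE x in lebesgue_on \<Omega>. d x = 0"
  by (rule fundamental_lemma[OF open_domain integrable_l2[OF assms(1)]])
     (use assms(2) in \<open>simp add: l2_inner_def\<close>)

lemma weak_unique:
  fixes d e :: "real^3 \<Rightarrow> real"
  assumes "l2_fun \<Omega> d" "l2_fun \<Omega> e" "\<And>\<phi>. test_fun \<Omega> \<phi> \<Longrightarrow> l2_inner \<Omega> d \<phi> = l2_inner \<Omega> e \<phi>"
  shows "AE x in lebesgue_on \<Omega>. d x = e x"
proof -
  have "AE x in lebesgue_on \<Omega>. d x - e x = 0"
  proof (rule weak_zero)
    show "l2_fun \<Omega> (\<lambda>x. d x - e x)" by (rule l2_fun_diff[OF assms(1,2)])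
    show "l2_inner \<Omega> (\<lambda>x. d x - e x) \<phi> = 0" if "test_fun \<Omega> \<phi>" for \<phi>
      using l2_inner_diff_left[OF assms(1,2) l2_fun_test[OF that]] assms(3)[OF that] by simp
  qed
  then show ?thesis by eventually_elim simp
qed

lemma AE_vec_eqI:
  fixes d e :: "real^3 \<Rightarrow> 'b^3"
  assumes "\<And>i. AE x in M. d x $ i = e x $ i" shows "AE x in M. d x = e x"
proof -
  have "AE x in M. \<forall>i\<in>(UNIV::3 set). d x $ i = e x $ i"
    by (rule AE_finite_allI) (use assms in auto)
  then show ?thesis by eventually_elim (simp add: vec_eq_iff)
qed

lemma l2_inner_axis:
  fixes f :: "real^3 \<Rightarrow> real^3"
  shows "l2_inner \<Omega> f (\<lambda>x. \<psi> x *\<^sub>R axis i 1) = l2_inner \<Omega> (\<lambda>x. f x $ i) \<psi>"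
  unfolding l2_inner_def by (simp add: inner_axis mult.commute)

lemma test_fun_axis: "test_fun \<Omega> \<psi> \<Longrightarrow> test_fun \<Omega> (\<lambda>x. \<psi> x *\<^sub>R (axis i 1 :: real^3))"
  by (rule test_fun_bounded_linear[OF bounded_linear_scaleR_left])

lemma weak_unique_vec:
  fixes d e :: "real^3 \<Rightarrow> real^3"
  assumes "l2_fun \<Omega> d" "l2_fun \<Omega> e" "\<And>\<phi>. test_fun \<Omega> \<phi> \<Longrightarrow> l2_inner \<Omega> d \<phi> = l2_inner \<Omega> e \<phi>"
  shows "AE x in lebesgue_on \<Omega>. d x = e x"
proof (rule AE_vec_eqI, rule weak_unique)
  fix i
  show "l2_inner \<Omega> (\<lambda>x. d x $ i) \<psi> = l2_inner \<Omega> (\<lambda>x. e x $ i) \<psi>" if "test_fun \<Omega> \<psi>" for \<psi>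
    using assms(3)[OF test_fun_axis[OF that, of i]] by (simp add: l2_inner_axis)
qed (use assms l2_fun_component in blast)+

text \<open>Splits the vector-valued defining identity into scalar ones, which can be handled by the \<open>L\<^sup>2\<close> inner product.\<close>

lemma has_weak_grad_componentwise:
  "has_weak_grad \<Omega> f g \<longleftrightarrow> l2_fun \<Omega> f \<and> l2_fun \<Omega> g \<and>
     (\<forall>\<phi>. test_fun \<Omega> \<phi> \<longrightarrow> (\<forall>i. l2_inner \<Omega> f (partial i \<phi>) = - l2_inner \<Omega> (\<lambda>x. g x $ i) \<phi>))"
proof -
  have "(LINT x|lebesgue_on \<Omega>. f x *\<^sub>R grad \<phi> x) = - (LINT x|lebesgue_on \<Omega>. \<phi> x *\<^sub>R g x) \<longleftrightarrow>
     (\<forall>i. l2_inner \<Omega> f (partial i \<phi>) = - l2_inner \<Omega> (\<lambda>x. g x $ i) \<phi>)"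
    if f: "l2_fun \<Omega> f" and g: "l2_fun \<Omega> g" and \<phi>: "test_fun \<Omega> \<phi>" for \<phi>
  proof -
    have "test_fun \<Omega> (grad \<phi>)" unfolding grad_def[abs_def] by (rule test_fun_vec[OF test_fun_partial[OF \<phi>]])
    then have 1: "(LINT x|lebesgue_on \<Omega>. f x *\<^sub>R grad \<phi> x) $ i = l2_inner \<Omega> f (partial i \<phi>)" for i
      using integral_bounded_linear[OF bounded_linear_vec_nth integrable_scaleR_l2[OF f l2_fun_test], of "grad \<phi>" i]
      by (simp add: l2_inner_def grad_def)
    have 2: "(LINT x|lebesgue_on \<Omega>. \<phi> x *\<^sub>R g x) $ i = l2_inner \<Omega> (\<lambda>x. g x $ i) \<phi>" for i
      using integral_bounded_linear[OF bounded_linear_vec_nth integrable_scaleR_l2[OF l2_fun_test[OF \<phi>] g], of i]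
      by (simp add: l2_inner_def mult.commute)
    show ?thesis by (simp add: vec_eq_iff 1 2)
  qed
  then show ?thesis unfolding has_weak_grad_def by blast
qed

lemma has_weak_grad_unique:
  assumes "has_weak_grad \<Omega> f g" "has_weak_grad \<Omega> f g'"
  shows "AE x in lebesgue_on \<Omega>. g x = g' x"
proof (rule AE_vec_eqI, rule weak_unique)
  fix i and \<phi> :: "real^3 \<Rightarrow> real" assume "test_fun \<Omega> \<phi>"
  then have "- l2_inner \<Omega> (\<lambda>x. g x $ i) \<phi> = - l2_inner \<Omega> (\<lambda>x. g' x $ i) \<phi>"
    using assms unfolding has_weak_grad_componentwise by metis
  then show "l2_inner \<Omega> (\<lambda>x. g x $ i) \<phi> = l2_inner \<Omega> (\<lambda>x. g' x $ i) \<phi>" by simp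
qed (use assms in \<open>auto simp: has_weak_grad_def intro: l2_fun_component\<close>)

lemma has_weak_curl_unique:
  "has_weak_curl \<Omega> v w \<Longrightarrow> has_weak_curl \<Omega> v w' \<Longrightarrow> AE x in lebesgue_on \<Omega>. w x = w' x"
  unfolding has_weak_curl_def by (rule weak_unique_vec) auto

lemma has_weak_div_unique:
  assumes "has_weak_div \<Omega> v d" "has_weak_div \<Omega> v d'"
  shows "AE x in lebesgue_on \<Omega>. d x = d' x"
proof (rule weak_unique)
  fix \<phi> :: "real^3 \<Rightarrow> real" assume "test_fun \<Omega> \<phi>"
  then have "- l2_inner \<Omega> d \<phi> = - l2_inner \<Omega> d' \<phi>" using assms unfolding has_weak_div_def by metis
  then show "l2_inner \<Omega> d \<phi> = l2_inner \<Omega> d' \<phi>" by simp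
qed (use assms in \<open>auto simp: has_weak_div_def\<close>)

lemma has_weak_jac_unique:
  "has_weak_jac \<Omega> v J \<Longrightarrow> has_weak_jac \<Omega> v J' \<Longrightarrow> AE x in lebesgue_on \<Omega>. J x = J' x"
  unfolding has_weak_jac_def by (rule AE_vec_eqI) (use has_weak_grad_unique in blast)

lemma test_fun_grad: "test_fun \<Omega> \<phi> \<Longrightarrow> test_fun \<Omega> (grad \<phi>)"
  unfolding grad_def[abs_def] by (rule test_fun_vec[OF test_fun_partial])

lemma has_weak_div_of_jac:
  assumes "has_weak_jac \<Omega> v J"
  shows "has_weak_div \<Omega> v (\<lambda>x. \<Sum>i\<in>UNIV. J x $ i $ i)"
proof -
  have J: "l2_fun \<Omega> (\<lambda>x. v x $ i)" "l2_fun \<Omega> (\<lambda>x. J x $ i)" for i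
    using assms by (auto simp: has_weak_jac_def has_weak_grad_def)
  have v: "l2_fun \<Omega> v" by (rule l2_fun_vec[OF J(1)])
  have tr: "l2_fun \<Omega> (\<lambda>x. \<Sum>i\<in>UNIV. J x $ i $ i)"
    by (intro l2_fun_sum l2_fun_component[OF J(2)]) simp
  have "l2_inner \<Omega> v (grad \<phi>) = - l2_inner \<Omega> (\<lambda>x. \<Sum>i\<in>UNIV. J x $ i $ i) \<phi>" if \<phi>: "test_fun \<Omega> \<phi>" for \<phi>
  proof -
    have "l2_inner \<Omega> v (grad \<phi>) = (\<Sum>i\<in>UNIV. l2_inner \<Omega> (\<lambda>x. v x $ i) (partial i \<phi>))"
      using l2_inner_componentwise[OF v l2_fun_test[OF test_fun_grad[OF \<phi>]]] by (simp add: grad_def)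
    also have "\<dots> = (\<Sum>i\<in>UNIV. - l2_inner \<Omega> (\<lambda>x. J x $ i $ i) \<phi>)"
      using assms \<phi> by (intro sum.cong refl) (simp add: has_weak_jac_def has_weak_grad_componentwise)
    also have "\<dots> = - l2_inner \<Omega> (\<lambda>x. \<Sum>i\<in>UNIV. J x $ i $ i) \<phi>"
      using l2_inner_sum_left[of UNIV \<Omega> "\<lambda>i x. J x $ i $ i" \<phi> "\<lambda>_. 1"] l2_fun_component[OF J(2)] l2_fun_test[OF \<phi>]
      by (simp add: sum_negf)
    finally show ?thesis .
  qed
  then show ?thesis using v tr by (simp add: has_weak_div_def)
qed

lemma curl_component_simps:
  "curl v x $ 1 = partial 2 v x $ 3 - partial 3 v x $ 2"
  "curl v x $ 2 = partial 3 v x $ 1 - partial 1 v x $ 3"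
  "curl v x $ 3 = partial 1 v x $ 2 - partial 2 v x $ 1"
  by (simp_all add: curl_def)

lemma test_fun_curl:
  assumes "test_fun \<Omega> \<phi>" shows "test_fun \<Omega> (curl \<phi>)"
proof -
  have t: "test_fun \<Omega> (\<lambda>x. partial i \<phi> x $ j)" for i j
    by (rule test_fun_component[OF test_fun_partial[OF assms]])
  have d: "test_fun \<Omega> (\<lambda>x. partial i \<phi> x $ j - partial k \<phi> x $ l)" for i j k l
    using test_fun_add[OF t test_fun_bounded_linear[OF bounded_linear_minus[OF bounded_linear_ident] t]] by simp
  have "test_fun \<Omega> (\<lambda>x. curl \<phi> x $ i)" for i
    using exhaust_3[of i] d by (auto simp: curl_component_simps)
  then have "test_fun \<Omega> (\<lambda>x. \<chi> i. curl \<phi> x $ i)" by (rule test_fun_vec)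
  then show ?thesis by simp
qed

text \<open>Test with a gradient: \<open>(w, \<nabla>\<phi>) = (v, curl \<nabla>\<phi>) = 0\<close> by symmetry of second derivatives.\<close>

lemma has_weak_div_curl:
  assumes "has_weak_curl \<Omega> v w" shows "has_weak_div \<Omega> w (\<lambda>x. 0)"
proof -
  have "l2_inner \<Omega> w (grad \<phi>) = 0" if \<phi>: "test_fun \<Omega> \<phi>" for \<phi>
  proof -
    have p: "partial i (grad \<phi>) x $ j = partial i (partial j \<phi>) x" for i j x
    proof -
      have "partial i (\<lambda>x. grad \<phi> x $ j) x = partial i (grad \<phi>) x $ j"
        by (rule partial_component[OF smooth_has_derivative[OF test_fun_smooth[OF test_fun_grad[OF \<phi>]]]])
      moreover have "(\<lambda>x. grad \<phi> x $ j) = partial j \<phi>" by (simp add: grad_def fun_eq_iff)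
      ultimately show ?thesis by simp
    qed
    have "curl (grad \<phi>) x = 0" for x
      by (simp add: vec_eq_iff forall_3 curl_component_simps p partial_commute[OF test_fun_smooth[OF \<phi>], of 1 2]
          partial_commute[OF test_fun_smooth[OF \<phi>], of 1 3] partial_commute[OF test_fun_smooth[OF \<phi>], of 2 3])
    moreover have "l2_inner \<Omega> v (curl (grad \<phi>)) = l2_inner \<Omega> w (grad \<phi>)"
      using assms test_fun_grad[OF \<phi>] by (simp add: has_weak_curl_def)
    ultimately show ?thesis by (simp add: l2_inner_def)
  qed
  then show ?thesis using assms by (simp add: has_weak_div_def has_weak_curl_def l2_fun_zero l2_inner_zero_left)
qed

text \<open>Dual to the previous fact, now using \<open>div curl \<phi> = 0\<close> for the test field.\<close>

lemma has_weak_curl_grad: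
  assumes "has_weak_grad \<Omega> f g" shows "has_weak_curl \<Omega> g (\<lambda>x. 0)"
proof -
  have f: "l2_fun \<Omega> f" and g: "l2_fun \<Omega> g" using assms by (auto simp: has_weak_grad_def)
  have "l2_inner \<Omega> g (curl \<phi>) = 0" if \<phi>: "test_fun \<Omega> \<phi>" for \<phi>
  proof -
    note tc = test_fun_curl[OF \<phi>]
    have s: "smooth \<phi>" by (rule test_fun_smooth[OF \<phi>])
    have p: "partial k (\<lambda>x. partial i \<phi> x $ j - partial i' \<phi> x $ j') x
        = partial k (partial i (\<lambda>x. \<phi> x $ j)) x - partial k (partial i' (\<lambda>x. \<phi> x $ j')) x" for i j i' j' k x
    proof -
      have e: "(\<lambda>x. partial i \<phi> x $ j) = partial i (\<lambda>x. \<phi> x $ j)" for i j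
        using partial_component[OF smooth_has_derivative[OF s]] by (simp add: fun_eq_iff)
      have sm: "smooth (partial i (\<lambda>x. \<phi> x $ j))" for i j by (rule smooth_partial[OF smooth_component[OF s]])
      show ?thesis
        unfolding e[THEN fun_cong] partial_def[of k]
        by (subst dderiv_eqI[OF has_derivative_diff[OF smooth_has_derivative[OF sm] smooth_has_derivative[OF sm]]]) simp
    qed
    have "(\<Sum>i\<in>UNIV. partial i (\<lambda>x. curl \<phi> x $ i) x) = 0" for x
      by (simp add: sum_3 curl_component_simps p partial_commute[OF smooth_component[OF s], of 1 2]
          partial_commute[OF smooth_component[OF s], of 1 3] partial_commute[OF smooth_component[OF s], of 2 3])
    then have z: "(\<lambda>x. \<Sum>i\<in>UNIV. 1 *\<^sub>R partial i (\<lambda>x. curl \<phi> x $ i) x) = (\<lambda>x. 0)" by simp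
    have t: "test_fun \<Omega> (partial i (\<lambda>x. curl \<phi> x $ i))" for i
      by (rule test_fun_partial[OF test_fun_component[OF tc]])
    have "l2_inner \<Omega> g (curl \<phi>) = (\<Sum>i\<in>UNIV. l2_inner \<Omega> (\<lambda>x. g x $ i) (\<lambda>x. curl \<phi> x $ i))"
      by (rule l2_inner_componentwise[OF g l2_fun_test[OF tc]])
    also have "\<dots> = (\<Sum>i\<in>UNIV. - (1 * l2_inner \<Omega> (partial i (\<lambda>x. curl \<phi> x $ i)) f))"
      using assms test_fun_component[OF tc]
      by (intro sum.cong refl) (simp add: has_weak_grad_componentwise l2_inner_commute[of \<Omega> _ f])
    also have "\<dots> = - l2_inner \<Omega> (\<lambda>x. \<Sum>i\<in>UNIV. 1 *\<^sub>R partial i (\<lambda>x. curl \<phi> x $ i) x) f"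
      unfolding sum_negf by (subst l2_inner_sum_left) (auto intro: l2_fun_test t f)
    finally show ?thesis unfolding z by (simp add: l2_inner_zero_left)
  qed
  then show ?thesis using g by (simp add: has_weak_curl_def l2_fun_zero l2_inner_zero_left)
qed

lemma l2_fun_subset:
  fixes f :: "real^3 \<Rightarrow> 'b::euclidean_space"
  assumes "l2_fun \<Omega> f" "S \<subseteq> \<Omega>" "open S" shows "l2_fun S f"
proof -
  have S: "S \<in> sets lebesgue" using assms(3) by simp
  have f: "f \<in> borel_measurable (lebesgue_on \<Omega>)" "integrable (lebesgue_on \<Omega>) (\<lambda>x. (norm (f x))\<^sup>2)"
    using assms(1) by (auto simp: l2_fun_def)
  have m: "f \<in> borel_measurable (lebesgue_on S)"
    by (rule measurable_restrict_mono[OF f(1) assms(2)])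
  have "\<Omega> \<inter> space lebesgue \<in> sets lebesgue" using domain_sets by simp
  from f(2)[unfolded integrable_restrict_space[OF this]]
  have "integrable lebesgue (\<lambda>x. indicator S x *\<^sub>R (indicator \<Omega> x *\<^sub>R (norm (f x))\<^sup>2))"
    by (rule integrable_mult_indicator[OF S])
  also have "(\<lambda>x. indicator S x *\<^sub>R (indicator \<Omega> x *\<^sub>R (norm (f x))\<^sup>2)) = (\<lambda>x. indicator S x *\<^sub>R (norm (f x))\<^sup>2)"
    using assms(2) by (auto simp: indicator_def fun_eq_iff)
  finally show ?thesis using m S by (simp add: l2_fun_def integrable_restrict_space)
qed

lemma bounded_domain_subset: "open S \<Longrightarrow> S \<subseteq> \<Omega> \<Longrightarrow> bounded_domain S"
  by (rule bounded_domain.intro) (auto intro: bounded_subset[OF bounded_domain])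

text \<open>Test functions supported in \<open>S\<close> see only the smooth representative \<open>h\<close>, for which integration by parts is classical;
uniqueness of weak derivatives on \<open>S\<close> gives the claim. This lets weak and classical derivatives be
identified cell by cell.\<close>

lemma weak_grad_on_smooth_piece:
  assumes g: "has_weak_grad \<Omega> f g" and S: "open S" "S \<subseteq> \<Omega>" and h: "smooth h" "\<And>x. x \<in> S \<Longrightarrow> f x = h x"
  shows "AE x in lebesgue_on S. g x = grad h x"
proof (rule AE_vec_eqI)
  fix i
  interpret S: bounded_domain S by (rule bounded_domain_subset[OF S])
  have gl: "l2_fun S (\<lambda>x. g x $ i)"
  proof (rule l2_fun_component[OF l2_fun_subset[OF _ S(2,1)]])
    show "l2_fun \<Omega> g" using g by (simp add: has_weak_grad_def)
  qed
  have "AE x in lebesgue_on S. g x $ i = partial i h x"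
  proof (rule S.weak_unique[OF gl S.l2_fun_smooth[OF smooth_partial[OF h(1)]]])
    fix \<phi> :: "real^3 \<Rightarrow> real" assume \<phi>: "test_fun S \<phi>"
    note \<phi>' = test_fun_mono[OF \<phi> S(2)]
    have r: "l2_inner \<Omega> a b = l2_inner S a b" if "test_fun S b" for a b :: "real^3 \<Rightarrow> real"
      by (rule l2_inner_restrict[OF S(2) S.domain_sets domain_sets test_fun_outside[OF that]])
    have "l2_inner \<Omega> f (partial i \<phi>) = - l2_inner \<Omega> (\<lambda>x. g x $ i) \<phi>"
      using g \<phi>' unfolding has_weak_grad_componentwise by blast
    then have "- l2_inner S (\<lambda>x. g x $ i) \<phi> = l2_inner S f (partial i \<phi>)"
      by (simp only: r[OF \<phi>] r[OF test_fun_partial[OF \<phi>]])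
    also have "\<dots> = l2_inner S h (partial i \<phi>)" by (rule l2_inner_cong) (use h(2) in auto)
    also have "\<dots> = - l2_inner S (partial i h) \<phi>" by (rule integration_by_parts[OF h(1) \<phi> S(1)])
    finally show "l2_inner S (\<lambda>x. g x $ i) \<phi> = l2_inner S (partial i h) \<phi>" by simp
  qed
  then show "AE x in lebesgue_on S. g x $ i = grad h x $ i" by (simp add: grad_def)
qed

lemma weak_curl_on_smooth_piece:
  assumes w: "has_weak_curl \<Omega> v w" and S: "open S" "S \<subseteq> \<Omega>" and h: "smooth h" "\<And>x. x \<in> S \<Longrightarrow> v x = h x"
  shows "AE x in lebesgue_on S. w x = curl h x"
proof -
  interpret S: bounded_domain S by (rule bounded_domain_subset[OF S])
  have sc: "smooth (\<lambda>x. curl h x $ i)" for i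
  proof -
    have t: "smooth (\<lambda>x. partial i h x $ j)" for i j by (rule smooth_component[OF smooth_partial[OF h(1)]])
    have "smooth (\<lambda>x. partial i h x $ j - partial k h x $ l)" for i j k l
      using smooth_add[OF t smooth_bounded_linear[OF bounded_linear_minus[OF bounded_linear_ident] t]] by simp
    then show ?thesis using exhaust_3[of i] by (auto simp: curl_component_simps)
  qed
  have cl: "l2_fun S (curl h)" by (rule l2_fun_vec[OF S.l2_fun_smooth[OF sc]])
  show ?thesis
  proof (rule S.weak_unique_vec[OF _ cl])
    show "l2_fun S w" using l2_fun_subset[OF _ S(2,1), of w] w by (simp add: has_weak_curl_def)
    fix \<phi> :: "real^3 \<Rightarrow> real^3" assume \<phi>: "test_fun S \<phi>"
    have r: "l2_inner \<Omega> a b = l2_inner S a b" if "test_fun S b" for a b :: "real^3 \<Rightarrow> real^3"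
      by (rule l2_inner_restrict[OF S(2) S.domain_sets domain_sets test_fun_outside[OF that]])
    have "l2_inner \<Omega> v (curl \<phi>) = l2_inner \<Omega> w \<phi>"
      using w test_fun_mono[OF \<phi> S(2)] unfolding has_weak_curl_def by blast
    then have "l2_inner S w \<phi> = l2_inner S v (curl \<phi>)"
      by (simp only: r[OF \<phi>] r[OF S.test_fun_curl[OF \<phi>]])
    also have "\<dots> = l2_inner S h (curl \<phi>)" by (rule l2_inner_cong) (use h(2) in auto)
    also have "\<dots> = l2_inner S (curl h) \<phi>"
    proof -
      have sh: "smooth (\<lambda>x. h x $ i)" for i by (rule smooth_component[OF h(1)])
      have t\<phi>: "test_fun S (\<lambda>x. \<phi> x $ i)" for i by (rule test_fun_component[OF \<phi>])
      have e: "partial i (\<lambda>x. h x $ j) = (\<lambda>x. partial i h x $ j)" "partial i (\<lambda>x. \<phi> x $ j) = (\<lambda>x. partial i \<phi> x $ j)" for i j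
        using partial_component[OF smooth_has_derivative[OF h(1)]] partial_component[OF smooth_has_derivative[OF test_fun_smooth[OF \<phi>]]]
        by (simp_all add: fun_eq_iff)
      have ibp: "l2_inner S (\<lambda>x. h x $ i) (\<lambda>x. partial j \<phi> x $ k) = - l2_inner S (\<lambda>x. partial j h x $ i) (\<lambda>x. \<phi> x $ k)" for i j k
        using integration_by_parts[OF sh t\<phi> S(1), of i j k] unfolding e .
      have l: "l2_fun S (\<lambda>x. h x $ i)" "l2_fun S (\<lambda>x. partial j \<phi> x $ k)" "l2_fun S (\<lambda>x. partial j h x $ i)" "l2_fun S (\<lambda>x. \<phi> x $ k)" for i j k
        using S.l2_fun_smooth[OF sh] S.l2_fun_test[OF test_fun_partial[OF t\<phi>]] S.l2_fun_smooth[OF smooth_partial[OF sh]] S.l2_fun_test[OF t\<phi>]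
        unfolding e by auto
      have d1: "l2_inner S (\<lambda>x. h x $ i) (\<lambda>x. partial j \<phi> x $ k - partial j' \<phi> x $ k') =
          l2_inner S (\<lambda>x. h x $ i) (\<lambda>x. partial j \<phi> x $ k) - l2_inner S (\<lambda>x. h x $ i) (\<lambda>x. partial j' \<phi> x $ k')" for i j k j' k'
        unfolding l2_inner_commute[of S "\<lambda>x. h x $ i"] by (rule l2_inner_diff_left) (rule l)+
      have d2: "l2_inner S (\<lambda>x. partial j h x $ k - partial j' h x $ k') (\<lambda>x. \<phi> x $ i) =
          l2_inner S (\<lambda>x. partial j h x $ k) (\<lambda>x. \<phi> x $ i) - l2_inner S (\<lambda>x. partial j' h x $ k') (\<lambda>x. \<phi> x $ i)" for i j k j' k'
        by (rule l2_inner_diff_left) (rule l)+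
      have "l2_inner S h (curl \<phi>) = (\<Sum>i\<in>UNIV. l2_inner S (\<lambda>x. h x $ i) (\<lambda>x. curl \<phi> x $ i))"
        by (rule l2_inner_componentwise[OF S.l2_fun_smooth[OF h(1)] S.l2_fun_test[OF S.test_fun_curl[OF \<phi>]]])
      also have "\<dots> = (\<Sum>i\<in>UNIV. l2_inner S (\<lambda>x. curl h x $ i) (\<lambda>x. \<phi> x $ i))"
        by (simp add: sum_3 curl_component_simps d1 d2 ibp)
      also have "\<dots> = l2_inner S (curl h) \<phi>"
        by (rule l2_inner_componentwise[OF cl S.l2_fun_test[OF \<phi>], symmetric])
      finally show ?thesis .
    qed
    finally show "l2_inner S w \<phi> = l2_inner S (curl h) \<phi>" .
  qed
qed

end

section \<open>Integrals over facets\<close>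

context solid_polytope begin

lemma facet_rel_interior_not_in_other:
  assumes F: "F facet_of K" and x: "x \<in> rel_interior F" and G: "G facet_of K" "G \<noteq> F"
  shows "x \<notin> G"
proof
  assume "x \<in> G"
  have fF: "F face_of K" and fG: "G face_of K" using F G facet_of_imp_face_of by auto
  have "F \<subseteq> G"
    by (rule subset_of_face_of[OF fG face_of_imp_subset[OF fF]]) (use x \<open>x \<in> G\<close> in blast)
  from facet_subset_imp_eq[OF F G(1) this] G(2) show False by simp
qed

lemma facet_rel_interior_strict:
  assumes F: "F facet_of K" and x: "x \<in> rel_interior F" and G: "G facet_of K" "G \<noteq> F"
  shows "facet_normal K G \<bullet> x < facet_offset K G"
proof -
  have "x \<in> K" using x rel_interior_subset[of F] facet_of_imp_subset[OF F] by blast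
  moreover have "x \<notin> G" by (rule facet_rel_interior_not_in_other[OF F x G])
  ultimately show ?thesis using facet_halfspace[OF G(1)] facet_eq[OF G(1)] by (force simp: less_le)
qed

text \<open>Near a relative interior point of a facet only that facet's inequality can become active, so the polytope
coincides there with a half-space.\<close>

lemma facet_local_halfspace:
  assumes F: "F facet_of K" and x: "x \<in> rel_interior F"
  obtains r where "r > 0"
    "\<And>z. z \<in> ball x r \<Longrightarrow> z \<in> K \<longleftrightarrow> facet_normal K F \<bullet> z \<le> facet_offset K F"
    "\<And>z. z \<in> ball x r \<Longrightarrow> z \<in> interior K \<longleftrightarrow> facet_normal K F \<bullet> z < facet_offset K F"
    "\<And>G. G facet_of K \<Longrightarrow> G \<noteq> F \<Longrightarrow> G \<inter> ball x r = {}"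
proof -
  define U where "U = (\<Inter>G\<in>{G. G facet_of K} - {F}. {z. facet_normal K G \<bullet> z < facet_offset K G})"
  have "open U" unfolding U_def
    by (rule open_INT) (use finite_facets open_halfspace_lt in auto)
  moreover have "x \<in> U" unfolding U_def using facet_rel_interior_strict[OF F x] by auto
  ultimately obtain r where r: "r > 0" "ball x r \<subseteq> U" using open_contains_ball by blast
  have U: "facet_normal K G \<bullet> z < facet_offset K G" if "z \<in> ball x r" "G facet_of K" "G \<noteq> F" for z G
    using r(2) that unfolding U_def by auto
  show ?thesis
  proof
    show "r > 0" by (rule r)
    fix z assume z: "z \<in> ball x r"
    show "z \<in> K \<longleftrightarrow> facet_normal K F \<bullet> z \<le> facet_offset K F"
      unfolding mem_iff_halfspaces using U[OF z] F less_imp_le by blast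
    show "z \<in> interior K \<longleftrightarrow> facet_normal K F \<bullet> z < facet_offset K F"
      unfolding interior_iff_halfspaces using U[OF z] F by blast
  next
    show "G \<inter> ball x r = {}" if G: "G facet_of K" "G \<noteq> F" for G
      using U[OF _ G] facet_plane[OF G(1)] by force
  qed
qed

lemma facet_chart:
  assumes F: "F facet_of K"
  shows "continuous_on UNIV (plane_chart F)" "compact (plane_chart F -` F)" "convex (plane_chart F -` F)"
    "dist (plane_chart F y) (plane_chart F z) = dist y z" "range (plane_chart F) = affine hull F"
proof -
  let ?\<phi> = "plane_chart F"
  note n = norm_facet_normal[OF F] and hull = affine_hull_facet[OF F]
  show d: "dist (?\<phi> y) (?\<phi> z) = dist y z" for y z by (rule plane_chart_dist[OF n hull])
  show "range ?\<phi> = affine hull F" by (simp add: plane_chart_range[OF n hull] hull)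
  define L where "L y = ?\<phi> y - ?\<phi> 0" for y
  have L: "linear L" using lborel_plane_chart(4)[OF n hull] by (simp add: L_def[abs_def])
  have cL: "continuous_on UNIV L" using L by (simp add: linear_continuous_on linear_conv_bounded_linear)
  have e: "?\<phi> = (\<lambda>y. L y + ?\<phi> 0)" by (simp add: L_def)
  show c: "continuous_on UNIV ?\<phi>" by (subst e) (intro continuous_on_add cL continuous_on_const)
  have fF: "F face_of K" by (rule facet_of_imp_face_of[OF F])
  have "closed F" by (rule face_of_imp_closed[OF convex closed fF])
  then have cl: "closed (?\<phi> -` F)" using c by (simp add: continuous_on_closed_vimage)
  have "bounded (?\<phi> -` F)"
  proof -
    obtain R where R: "\<And>x. x \<in> F \<Longrightarrow> norm x \<le> R"
      using bounded_subset[OF bounded facet_of_imp_subset[OF F]] unfolding bounded_iff by blast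
    have "norm y \<le> R + norm (?\<phi> 0)" if "y \<in> ?\<phi> -` F" for y
    proof -
      have "norm y = norm (?\<phi> y - ?\<phi> 0)" using d[of y 0] by (simp add: dist_norm)
      also have "\<dots> \<le> norm (?\<phi> y) + norm (?\<phi> 0)" by (rule norm_triangle_ineq4)
      finally show ?thesis using R[of "?\<phi> y"] that by simp
    qed
    then show ?thesis unfolding bounded_iff by blast
  qed
  with cl show "compact (?\<phi> -` F)" by (simp add: compact_eq_bounded_closed)
  have "?\<phi> -` F = L -` ((\<lambda>x. - ?\<phi> 0 + x) ` F)"
    by (subst e) (force simp: image_iff)
  moreover have "convex (L -` ((\<lambda>x. - ?\<phi> 0 + x) ` F))"
    by (intro convex_linear_vimage[OF L] convex_translation face_of_imp_convex[OF fF] )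
  ultimately show "convex (?\<phi> -` F)" by simp
qed

lemma chart_interior:
  assumes F: "F facet_of K" and y: "y \<in> interior (plane_chart F -` F)"
  shows "plane_chart F y \<in> rel_interior F"
proof -
  obtain e where e: "e > 0" "ball y e \<subseteq> plane_chart F -` F" using y mem_interior by blast
  have "ball (plane_chart F y) e \<inter> affine hull F \<subseteq> F"
  proof
    fix z assume z: "z \<in> ball (plane_chart F y) e \<inter> affine hull F"
    then obtain w where w: "z = plane_chart F w" using facet_chart(5)[OF F] by blast
    then have "w \<in> ball y e" using z facet_chart(4)[OF F, of y w] by simp
    then show "z \<in> F" using e(2) w by auto
  qed
  moreover have "plane_chart F y \<in> F" using e centre_in_ball[of y e] by blast
  ultimately show ?thesis using e(1) by (auto simp: mem_rel_interior_ball)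
qed

lemma chart_rel_interior:
  assumes F: "F facet_of K" and x: "x \<in> rel_interior F"
  obtains y where "y \<in> interior (plane_chart F -` F)" "x = plane_chart F y"
proof -
  obtain e where e: "e > 0" "ball x e \<inter> affine hull F \<subseteq> F" "x \<in> F" using x by (auto simp: mem_rel_interior_ball)
  have "x \<in> affine hull F" using e(3) hull_subset[of F affine] by blast
  then obtain y where y: "x = plane_chart F y" using facet_chart(5)[OF F] by blast
  have "ball y e \<subseteq> plane_chart F -` F"
  proof
    fix w assume "w \<in> ball y e"
    then have "plane_chart F w \<in> ball x e" using facet_chart(4)[OF F, of y w] y by simp
    moreover have "plane_chart F w \<in> affine hull F" using facet_chart(5)[OF F] by blast
    ultimately show "w \<in> plane_chart F -` F" using e(2) by blast
  qed
  then have "y \<in> interior (plane_chart F -` F)" using e(1) mem_interior by blast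
  with y show ?thesis by (rule that[rotated])
qed

text \<open>Facet integrals ignore edges and vertices: the chart domain of a facet is convex, and the frontier of a convex set is
negligible.\<close>

lemma AE_chart_rel_interior:
  assumes F: "F facet_of K"
  shows "AE y in lebesgue_on (plane_chart F -` F). plane_chart F y \<in> rel_interior F"
proof -
  let ?C = "plane_chart F -` F"
  have C: "closed ?C" using facet_chart(2)[OF F] compact_imp_closed by blast
  have "AE y in lebesgue. y \<notin> frontier ?C"
    using negligible_convex_frontier[OF facet_chart(3)[OF F]] by (simp add: negligible_iff_null_sets AE_not_in)
  then have "AE y in lebesgue. y \<in> ?C \<longrightarrow> plane_chart F y \<in> rel_interior F"
  proof eventually_elim
    case (elim y)
    then show ?case using chart_interior[OF F, of y] C by (auto simp: frontier_def)
  qed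
  then show ?thesis using C by (simp add: AE_restrict_space_iff)
qed

lemma facet_integral_cong_rel_interior:
  assumes F: "F facet_of K" and f: "continuous_on UNIV f" and eq: "\<And>x. x \<in> rel_interior F \<Longrightarrow> g x = f x"
  shows "facet_integral F g = facet_integral F f"
proof -
  let ?\<phi> = "plane_chart F" and ?C = "plane_chart F -` F"
  have C: "?C \<in> sets lebesgue" using facet_chart(2)[OF F] by (simp add: lmeasurable_compact fmeasurableD)
  have ae: "AE y in lebesgue_on ?C. f (?\<phi> y) = g (?\<phi> y)"
    using AE_chart_rel_interior[OF F] by eventually_elim (simp add: eq)
  then have ae': "AE y in lebesgue. indicator ?C y *\<^sub>R f (?\<phi> y) = indicator ?C y *\<^sub>R g (?\<phi> y)"
    using C by (auto simp: AE_restrict_space_iff elim!: eventually_mono split: split_indicator)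
  have "continuous_on UNIV (\<lambda>y. f (?\<phi> y))"
    by (rule continuous_on_compose2[OF f facet_chart(1)[OF F]]) simp
  from borel_measurable_continuous_onI[OF this] have "(\<lambda>y. f (?\<phi> y)) \<in> borel_measurable lebesgue"
    by (simp add: measurable_completion)
  then have mf: "(\<lambda>y. indicator ?C y *\<^sub>R f (?\<phi> y)) \<in> borel_measurable lebesgue"
    using C by (intro borel_measurable_scaleR borel_measurable_indicator)
  have mg: "(\<lambda>y. indicator ?C y *\<^sub>R g (?\<phi> y)) \<in> borel_measurable lebesgue"
    by (rule borel_measurable_AE[OF mf ae'])
  have "(LINT y|lebesgue. indicator ?C y *\<^sub>R g (?\<phi> y)) = (LINT y|lebesgue. indicator ?C y *\<^sub>R f (?\<phi> y))"
    by (rule integral_cong_AE[OF mg mf AE_symmetric[OF ae']])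
  then show ?thesis unfolding facet_integral_def using C by (simp add: integral_restrict_space)
qed

lemma facet_integrable:
  assumes F: "F facet_of K" and f: "continuous_on UNIV (f :: real^3 \<Rightarrow> real)"
  shows "integrable (lebesgue_on (plane_chart F -` F)) (\<lambda>y. f (plane_chart F y))"
proof -
  let ?C = "plane_chart F -` F"
  have c: "continuous_on ?C (\<lambda>y. f (plane_chart F y))"
    using continuous_on_compose2[OF f facet_chart(1)[OF F]] by (auto intro: continuous_on_subset)
  have "integrable lborel (\<lambda>y. indicator ?C y *\<^sub>R f (plane_chart F y))"
    by (rule borel_integrable_compact[OF facet_chart(2)[OF F] c])
  then have "integrable lebesgue (\<lambda>y. indicator ?C y *\<^sub>R f (plane_chart F y))"
    by (subst integrable_completion) auto
  moreover have "?C \<in> sets lebesgue" using facet_chart(2)[OF F] by (simp add: lmeasurable_compact fmeasurableD)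
  ultimately show ?thesis by (simp add: integrable_restrict_space)
qed

lemma facet_integral_sum:
  assumes F: "F facet_of K" and "\<And>i. i \<in> S \<Longrightarrow> continuous_on UNIV (f i :: real^3 \<Rightarrow> real)"
  shows "facet_integral F (\<lambda>x. \<Sum>i\<in>S. f i x) = (\<Sum>i\<in>S. facet_integral F (f i))"
  unfolding facet_integral_def
  by (rule Bochner_Integration.integral_sum) (rule facet_integrable[OF F assms(2)])

lemma facet_integral_mult: "facet_integral F (\<lambda>x. c * f x) = c * facet_integral F f"
  unfolding facet_integral_def by simp

lemma facet_integral_pos:
  assumes F: "F facet_of K" and f: "continuous_on UNIV (f :: real^3 \<Rightarrow> real)" and nn: "\<And>x. f x \<ge> 0"
    and x: "x \<in> rel_interior F" "f x > 0"
  shows "facet_integral F f > 0"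
proof (rule ccontr)
  let ?\<phi> = "plane_chart F" and ?C = "plane_chart F -` F"
  assume "\<not> ?thesis"
  moreover have "0 \<le> facet_integral F f"
    unfolding facet_integral_def by (rule Bochner_Integration.integral_nonneg) (rule nn)
  ultimately have "(LINT y|lebesgue_on ?C. f (?\<phi> y)) = 0" by (simp add: facet_integral_def)
  then have ae: "AE y in lebesgue_on ?C. f (?\<phi> y) = 0"
    using integral_nonneg_eq_0_iff_AE[OF facet_integrable[OF F f]] nn by simp
  have C: "?C \<in> sets lebesgue" using facet_chart(2)[OF F] by (simp add: lmeasurable_compact fmeasurableD)
  define U where "U = interior ?C \<inter> {y. f (?\<phi> y) > 0}"
  have "continuous_on UNIV (\<lambda>y. f (?\<phi> y))"
    by (rule continuous_on_compose2[OF f facet_chart(1)[OF F]]) simp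
  then have "open U" unfolding U_def by (intro open_Int open_interior open_Collect_less continuous_on_const)
  moreover have "U \<noteq> {}"
  proof -
    obtain y where "y \<in> interior ?C" "x = ?\<phi> y" by (rule chart_rel_interior[OF F x(1)])
    then show ?thesis using x(2) by (auto simp: U_def)
  qed
  ultimately have "\<not> negligible U" using open_not_negligible by blast
  moreover have "negligible U"
  proof -
    have "AE y in lebesgue. y \<notin> U"
      using ae C interior_subset[of ?C] unfolding U_def by (auto simp: AE_restrict_space_iff elim!: eventually_mono)
    moreover have "U \<in> sets lebesgue" using \<open>open U\<close> by simp
    ultimately show ?thesis by (simp add: negligible_iff_null_sets AE_iff_null_sets)
  qed
  ultimately show False by simp
qed

end

section \<open>Meshes\<close>

locale meshed_domain =
  fixes \<Omega> :: "(real^3) set" and \<T> :: "(real^3) set set"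
  assumes domain: "polytopal_domain \<Omega>" and mesh: "mesh_of \<T> \<Omega>"
begin

lemma finite_mesh: "finite \<T>"
  and cells_cover: "\<Union>\<T> = closure \<Omega>"
  and cell_Int_face: "K \<in> \<T> \<Longrightarrow> L \<in> \<T> \<Longrightarrow> K \<inter> L face_of K"
  using mesh by (auto simp: mesh_of_def)

lemma cell: "K \<in> \<T> \<Longrightarrow> solid_polytope K"
  using mesh by (auto simp: mesh_of_def solid_polytope_def)

lemma interior_closure_domain: "interior (closure \<Omega>) = \<Omega>"
  using domain by (simp add: polytopal_domain_def convex_interior_closure interior_open)

lemma interior_cell_subset: "K \<in> \<T> \<Longrightarrow> interior K \<subseteq> \<Omega>"
  using interior_mono[of K "closure \<Omega>"] cells_cover interior_closure_domain by blast

sublocale bounded_domain \<Omega>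
proof
  show "open \<Omega>" using domain by (simp add: polytopal_domain_def)
  have "bounded (closure \<Omega>)" using domain polytope_imp_bounded by (auto simp: polytopal_domain_def)
  then show "bounded \<Omega>" by (rule bounded_subset[OF _ closure_subset])
qed

lemma interior_cell_disjoint:
  assumes K: "K \<in> \<T>" and L: "L \<in> \<T>" and "K \<noteq> L"
  shows "interior K \<inter> L = {}"
proof -
  interpret K: solid_polytope K by (rule cell[OF K])
  have "K \<inter> L \<noteq> K"
  proof
    assume e: "K \<inter> L = K"
    have "K face_of L" using cell_Int_face[OF L K] e by (simp add: Int_commute)
    then have "K \<inter> interior L = {}" using \<open>K \<noteq> L\<close> by (rule face_of_disjoint_interior)
    moreover have "interior K \<subseteq> interior L" using e by (intro interior_mono) blast
    ultimately show False using K.solid interior_subset[of K] by blast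
  qed
  then have "(K \<inter> L) \<inter> interior K = {}" by (rule face_of_disjoint_interior[OF cell_Int_face[OF K L]])
  then show ?thesis using interior_subset[of K] by blast
qed

text \<open>Conformity of the mesh. The common face of the two cells contains a relative interior point of \<open>F\<close>,
so \<open>F\<close> is the only facet of \<open>K\<close> containing it; a proper face is the intersection of the facets containing it, hence the
common face is \<open>F\<close> itself.\<close>

lemma facet_of_touching_cell:
  assumes K: "K \<in> \<T>" and L: "L \<in> \<T>" and "K \<noteq> L" and F: "F facet_of K"
    and x: "x \<in> rel_interior F" "x \<in> L"
  shows "F facet_of L"
proof -
  interpret K: solid_polytope K by (rule cell[OF K])
  interpret L: solid_polytope L by (rule cell[OF L])
  have xF: "x \<in> F" using x(1) rel_interior_subset by blast
  have face: "K \<inter> L face_of K" by (rule cell_Int_face[OF K L])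
  have ne: "K \<inter> L \<noteq> {}" using xF x(2) facet_of_imp_subset[OF F] by blast
  have nK: "K \<inter> L \<noteq> K"
    using interior_cell_disjoint[OF K L \<open>K \<noteq> L\<close>] K.solid interior_subset[of K] by blast
  have only: "G = F" if "G facet_of K" "K \<inter> L \<subseteq> G" for G
    using K.facet_rel_interior_not_in_other[OF F x(1) that(1)] that(2) xF x(2) facet_of_imp_subset[OF F] by blast
  obtain G where G: "G facet_of K" "K \<inter> L \<subseteq> G"
    using face_of_polyhedron_subset_facet[OF K.polyhedron face ne nK] by blast
  then have "{G. G facet_of K \<and> K \<inter> L \<subseteq> G} = {F}" using only by blast
  then have "K \<inter> L = F" using face_of_polyhedron[OF K.polyhedron face ne nK] by simp
  then have "F face_of L" using cell_Int_face[OF L K] by (simp add: Int_commute)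
  moreover have "aff_dim L = 3" using aff_dim_nonempty_interior[OF L.solid] by simp
  ultimately show ?thesis using K.facet_dim[OF F] xF by (auto simp: facet_of_def)
qed

text \<open>Both normals are orthogonal to the same plane; if they were equal, both cells would locally be the same
half-space and their interiors would overlap.\<close>

lemma shared_facet_normals:
  assumes K: "K \<in> \<T>" and L: "L \<in> \<T>" and "K \<noteq> L" and F: "F facet_of K" "F facet_of L"
  shows "facet_normal L F = - facet_normal K F \<and> facet_offset L F = - facet_offset K F"
proof -
  interpret K: solid_polytope K by (rule cell[OF K])
  interpret L: solid_polytope L by (rule cell[OF L])
  let ?n = "facet_normal K F" and ?b = "facet_offset K F"
  have "{x. ?n \<bullet> x = ?b} = {x. facet_normal L F \<bullet> x = facet_offset L F}"
    using K.affine_hull_facet[OF F(1)] L.affine_hull_facet[OF F(2)] by simp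
  then have "facet_normal L F = ?n \<and> facet_offset L F = ?b \<or> facet_normal L F = - ?n \<and> facet_offset L F = - ?b"
    by (intro unit_normals_parallel K.norm_facet_normal L.norm_facet_normal F) simp
  moreover have False if same: "facet_normal L F = ?n" "facet_offset L F = ?b"
  proof -
    have "F \<noteq> {}" "convex F" using F(1) face_of_imp_convex facet_of_imp_face_of by (auto simp: facet_of_def)
    then obtain x where x: "x \<in> rel_interior F" using rel_interior_eq_empty by blast
    obtain r where r: "r > 0" "\<And>z. z \<in> ball x r \<Longrightarrow> z \<in> interior K \<longleftrightarrow> ?n \<bullet> z < ?b"
      by (rule K.facet_local_halfspace[OF F(1) x]) blast
    obtain s where s: "s > 0" "\<And>z. z \<in> ball x s \<Longrightarrow> z \<in> L \<longleftrightarrow> facet_normal L F \<bullet> z \<le> facet_offset L F"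
      by (rule L.facet_local_halfspace[OF F(2) x]) blast
    define d where "d = min r s / 2"
    have d: "d > 0" "d < r" "d < s" using r(1) s(1) by (auto simp: d_def)
    have "?n \<bullet> x = ?b" using K.facet_plane[OF F(1)] x rel_interior_subset by blast
    then have nz: "?n \<bullet> (x - d *\<^sub>R ?n) < ?b"
      using d(1) K.norm_facet_normal[OF F(1)] by (simp add: inner_diff dot_square_norm)
    have "dist x (x - d *\<^sub>R ?n) = d"
      using d(1) K.norm_facet_normal[OF F(1)] by (simp add: dist_norm)
    then have "x - d *\<^sub>R ?n \<in> interior K" "x - d *\<^sub>R ?n \<in> L"
      using r(2)[of "x - d *\<^sub>R ?n"] s(2)[of "x - d *\<^sub>R ?n"] nz d same by auto
    then show False using interior_cell_disjoint[OF K L \<open>K \<noteq> L\<close>] by blast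
  qed
  ultimately show ?thesis by blast
qed

text \<open>Among three cells two would have equal outward normals, since each pair has opposite ones.\<close>

lemma facet_shared_by_two:
  assumes K: "K \<in> \<T>" and L: "L \<in> \<T>" and M: "M \<in> \<T>" and "K \<noteq> L" and F: "F facet_of K" "F facet_of L" "F facet_of M"
  shows "M = K \<or> M = L"
proof (rule ccontr)
  assume n: "\<not> ?thesis"
  interpret K: solid_polytope K by (rule cell[OF K])
  let ?n = "facet_normal K F"
  have "facet_normal L F = - ?n" "facet_normal M F = - ?n" "facet_normal M F = - facet_normal L F"
    using shared_facet_normals[OF K L \<open>K \<noteq> L\<close> F(1,2)] shared_facet_normals[OF K M _ F(1,3)] shared_facet_normals[OF L M _ F(2,3)] n by auto
  then have "- ?n = ?n" by simp
  then have "(- ?n) \<bullet> ?n = ?n \<bullet> ?n" by (simp only:)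
  then show False using K.facet_normal_nz[OF F(1)] by simp
qed

lemma ball_avoiding_other_cells:
  assumes "\<And>M. M \<in> \<T> \<Longrightarrow> x \<in> M \<Longrightarrow> M \<in> \<S>"
  obtains r where "r > 0" "\<And>M. M \<in> \<T> \<Longrightarrow> M \<notin> \<S> \<Longrightarrow> M \<inter> ball x r = {}"
proof -
  have "closed (\<Union>(\<T> - \<S>))"
    using finite_mesh solid_polytope.closed[OF cell] by (intro closed_Union) auto
  then have op: "open (- \<Union>(\<T> - \<S>))" by (rule open_Compl)
  have x: "x \<in> - \<Union>(\<T> - \<S>)" using assms by blast
  obtain r where r: "r > 0" "ball x r \<subseteq> - \<Union>(\<T> - \<S>)" by (rule openE[OF op x])
  show ?thesis by (rule that[OF r(1)]) (use r(2) in blast)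
qed

text \<open>A neighbourhood of a relative interior point of an interior facet that meets no cells and no facets
other than the two cells in question and their common facet; it lies inside the domain because the two half-spaces
fill it. Test functions supported there isolate a single facet integral.\<close>

lemma interior_facet_patch:
  assumes K: "K \<in> \<T>" and L: "L \<in> \<T>" and "K \<noteq> L" and F: "F facet_of K" "F facet_of L" and x: "x \<in> rel_interior F"
  obtains r where "r > 0" "ball x r \<subseteq> \<Omega>"
    "\<And>M. M \<in> \<T> \<Longrightarrow> M \<noteq> K \<Longrightarrow> M \<noteq> L \<Longrightarrow> M \<inter> ball x r = {}"
    "\<And>G. G facet_of K \<Longrightarrow> G \<noteq> F \<Longrightarrow> G \<inter> ball x r = {}"
    "\<And>G. G facet_of L \<Longrightarrow> G \<noteq> F \<Longrightarrow> G \<inter> ball x r = {}"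
proof -
  interpret K: solid_polytope K by (rule cell[OF K])
  interpret L: solid_polytope L by (rule cell[OF L])
  obtain r1 where r1: "r1 > 0" "\<And>z. z \<in> ball x r1 \<Longrightarrow> z \<in> K \<longleftrightarrow> facet_normal K F \<bullet> z \<le> facet_offset K F"
      "\<And>G. G facet_of K \<Longrightarrow> G \<noteq> F \<Longrightarrow> G \<inter> ball x r1 = {}"
    by (rule K.facet_local_halfspace[OF F(1) x]) blast
  obtain r2 where r2: "r2 > 0" "\<And>z. z \<in> ball x r2 \<Longrightarrow> z \<in> L \<longleftrightarrow> facet_normal L F \<bullet> z \<le> facet_offset L F"
      "\<And>G. G facet_of L \<Longrightarrow> G \<noteq> F \<Longrightarrow> G \<inter> ball x r2 = {}"
    by (rule L.facet_local_halfspace[OF F(2) x]) blast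
  obtain r3 where r3: "r3 > 0" "\<And>M. M \<in> \<T> \<Longrightarrow> M \<notin> {K, L} \<Longrightarrow> M \<inter> ball x r3 = {}"
  proof (rule ball_avoiding_other_cells[of x "{K, L}"])
    fix M assume M: "M \<in> \<T>" "x \<in> M"
    show "M \<in> {K, L}"
      using facet_of_touching_cell[OF K M(1) _ F(1) x M(2)] facet_shared_by_two[OF K L M(1) \<open>K \<noteq> L\<close> F] by blast
  qed blast
  define r where "r = min r1 (min r2 r3)"
  have sub: "ball x r \<subseteq> ball x r1" "ball x r \<subseteq> ball x r2" "ball x r \<subseteq> ball x r3" by (auto simp: r_def)
  have "ball x r \<subseteq> closure \<Omega>"
  proof
    fix z assume z: "z \<in> ball x r"
    have nL: "facet_normal L F = - facet_normal K F" "facet_offset L F = - facet_offset K F"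
      using shared_facet_normals[OF K L \<open>K \<noteq> L\<close> F] by auto
    have "z \<in> K \<or> z \<in> L"
      using r1(2)[of z] r2(2)[of z] z sub(1,2) unfolding nL by (auto simp: subset_iff)
    then show "z \<in> closure \<Omega>" using cells_cover K L by blast
  qed
  then have "ball x r \<subseteq> \<Omega>" using interior_maximal[of "ball x r" "closure \<Omega>"] interior_closure_domain by simp
  then show ?thesis using that[of r] r1 r2 r3 sub by (auto simp: r_def disjoint_iff subset_iff)
qed

lemma boundary_facet_patch:
  assumes K: "K \<in> \<T>" and F: "F facet_of K" and only: "\<And>L. L \<in> \<T> \<Longrightarrow> F facet_of L \<Longrightarrow> L = K" and x: "x \<in> rel_interior F"
  obtains r where "r > 0" "\<And>M. M \<in> \<T> \<Longrightarrow> M \<noteq> K \<Longrightarrow> M \<inter> ball x r = {}"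
    "\<And>G. G facet_of K \<Longrightarrow> G \<noteq> F \<Longrightarrow> G \<inter> ball x r = {}"
proof -
  interpret K: solid_polytope K by (rule cell[OF K])
  obtain r1 where r1: "r1 > 0" "\<And>G. G facet_of K \<Longrightarrow> G \<noteq> F \<Longrightarrow> G \<inter> ball x r1 = {}"
    by (rule K.facet_local_halfspace[OF F x]) blast
  obtain r3 where r3: "r3 > 0" "\<And>M. M \<in> \<T> \<Longrightarrow> M \<notin> {K} \<Longrightarrow> M \<inter> ball x r3 = {}"
  proof (rule ball_avoiding_other_cells[of x "{K}"])
    fix M assume M: "M \<in> \<T>" "x \<in> M"
    show "M \<in> {K}" using facet_of_touching_cell[OF K M(1) _ F x M(2)] only[OF M(1)] by blast
  qed blast
  define r where "r = min r1 r3"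
  have sub: "ball x r \<subseteq> ball x r1" "ball x r \<subseteq> ball x r3" by (auto simp: r_def)
  show ?thesis using that[of r] r1 r3 sub by (auto simp: r_def disjoint_iff subset_iff)
qed

lemma AE_interior_cell: "AE x in lebesgue. x \<in> closure \<Omega> \<longrightarrow> (\<exists>K\<in>\<T>. x \<in> interior K)"
proof -
  have "AE x in lebesgue. \<forall>K\<in>\<T>. x \<notin> frontier K"
  proof (rule AE_finite_allI[OF finite_mesh])
    fix K assume "K \<in> \<T>"
    then show "AE x in lebesgue. x \<notin> frontier K"
      using negligible_convex_frontier[OF solid_polytope.convex[OF cell]] by (simp add: negligible_iff_null_sets AE_not_in)
  qed
  then show ?thesis
  proof eventually_elim
    case (elim x)
    have "x \<in> interior K" if "K \<in> \<T>" "x \<in> K" for K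
      using elim that closure_subset[of K] by (auto simp: frontier_def)
    then show ?case using cells_cover by blast
  qed
qed

lemma integral_split_cells:
  fixes f :: "real^3 \<Rightarrow> real"
  assumes m: "f \<in> borel_measurable (lebesgue_on \<Omega>)" and i: "\<And>K. K \<in> \<T> \<Longrightarrow> integrable (lebesgue_on K) f"
  shows "integrable (lebesgue_on \<Omega>) f" "(LINT x|lebesgue_on \<Omega>. f x) = broken_integral \<T> f"
proof -
  have Km: "K \<in> sets lebesgue" if "K \<in> \<T>" for K using solid_polytope.closed[OF cell[OF that]] by simp
  have iK: "integrable lebesgue (\<lambda>x. indicator K x *\<^sub>R f x)" if "K \<in> \<T>" for K
    using i[OF that] Km[OF that] by (simp add: integrable_restrict_space)
  have m': "(\<lambda>x. indicator \<Omega> x *\<^sub>R f x) \<in> borel_measurable lebesgue"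
    using m domain_sets borel_measurable_restrict_space_iff[of \<Omega> lebesgue f] by (simp add: mult.commute)
  have s: "integrable lebesgue (\<lambda>x. \<Sum>K\<in>\<T>. indicator K x *\<^sub>R f x)"
    by (rule Bochner_Integration.integrable_sum) (rule iK)
  have convex: "convex \<Omega>" using domain by (simp add: polytopal_domain_def)
  have "AE x in lebesgue. x \<notin> frontier \<Omega>"
    using negligible_convex_frontier[OF convex] by (simp add: negligible_iff_null_sets AE_not_in)
  with AE_interior_cell have ae: "AE x in lebesgue. (\<Sum>K\<in>\<T>. indicator K x *\<^sub>R f x) = indicator \<Omega> x *\<^sub>R f x"
  proof eventually_elim
    case (elim x)
    show ?case
    proof (cases "x \<in> closure \<Omega>")
      case True
      then have "x \<in> \<Omega>" using elim(2) open_domain by (simp add: frontier_def interior_open)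
      obtain K where K: "K \<in> \<T>" "x \<in> interior K" using elim(1) True by blast
      have ind: "indicator L x = (if L = K then 1 else 0 :: real)" if "L \<in> \<T>" for L
        using interior_cell_disjoint[OF K(1) that] K(2) interior_subset[of K] by (auto simp: indicator_def)
      have "(\<Sum>L\<in>\<T>. indicator L x *\<^sub>R f x) = (\<Sum>L\<in>\<T>. if L = K then f x else 0)"
        by (rule sum.cong) (auto simp: ind)
      then show ?thesis using finite_mesh K(1) \<open>x \<in> \<Omega>\<close> by simp
    next
      case False
      then have "x \<notin> \<Omega>" using closure_subset by blast
      moreover have "x \<notin> K" if "K \<in> \<T>" for K using False cells_cover that by blast
      ultimately show ?thesis by (simp add: indicator_def)
    qed
  qed
  have ms: "(\<lambda>x. \<Sum>K\<in>\<T>. indicator K x *\<^sub>R f x) \<in> borel_measurable lebesgue" using s by blast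
  have "integrable lebesgue (\<lambda>x. indicator \<Omega> x *\<^sub>R f x)"
    using integrable_cong_AE[OF ms m' ae] s by simp
  then show "integrable (lebesgue_on \<Omega>) f" using domain_sets by (simp add: integrable_restrict_space)
  have "(LINT x|lebesgue_on \<Omega>. f x) = (LINT x|lebesgue. indicator \<Omega> x *\<^sub>R f x)"
    using domain_sets by (intro integral_restrict_space) simp
  also have "\<dots> = (LINT x|lebesgue. (\<Sum>K\<in>\<T>. indicator K x *\<^sub>R f x))"
    by (rule integral_cong_AE[OF m' ms AE_symmetric[OF ae]])
  also have "\<dots> = (\<Sum>K\<in>\<T>. (LINT x|lebesgue. indicator K x *\<^sub>R f x))"
    by (rule Bochner_Integration.integral_sum) (rule iK)
  also have "\<dots> = broken_integral \<T> f"
    unfolding broken_integral_def using Km by (intro sum.cong refl integral_restrict_space[symmetric]) simp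
  finally show "(LINT x|lebesgue_on \<Omega>. f x) = broken_integral \<T> f" .
qed

end

section \<open>Traces of piecewise smooth functions\<close>

lemma (in solid_polytope) gauss_partial:
  assumes "smooth h"
  shows "(LINT x|lebesgue_on K. partial i h x) = (\<Sum>F | F facet_of K. facet_normal K F $ i * facet_integral F h)"
  using gauss[OF smooth_has_derivative[OF assms], of "axis i 1"] smooth_continuous[OF smooth_partial[OF assms]]
  unfolding partial_def by (simp add: inner_axis)

lemma (in solid_polytope) AE_cell_of_interior:
  assumes "AE x in lebesgue_on (interior K). Q x" shows "AE x in lebesgue_on K. Q x"
proof -
  have "AE x in lebesgue. x \<notin> frontier K"
    using negligible_convex_frontier[OF convex] by (simp add: negligible_iff_null_sets AE_not_in)
  moreover have "AE x in lebesgue. x \<in> interior K \<longrightarrow> Q x"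
    using assms by (simp add: AE_restrict_space_iff)
  ultimately have "AE x in lebesgue. x \<in> K \<longrightarrow> Q x"
  proof eventually_elim
    case (elim x) then show ?case using closed by (auto simp: frontier_def)
  qed
  then show ?thesis using closed by (simp add: AE_restrict_space_iff)
qed

lemma (in solid_polytope) integrable_continuous_cell:
  assumes "continuous_on UNIV (c :: real^3 \<Rightarrow> real)" shows "integrable (lebesgue_on K) c"
proof -
  have "integrable lborel (\<lambda>x. indicator K x *\<^sub>R c x)"
    by (rule borel_integrable_compact[OF compact continuous_on_subset[OF assms]]) simp
  then have "integrable lebesgue (\<lambda>x. indicator K x *\<^sub>R c x)"
    by (subst integrable_completion) auto
  then show ?thesis using closed by (simp add: integrable_restrict_space)
qed

lemma (in solid_polytope) cell_integral_cong:
  assumes c: "continuous_on UNIV (c :: real^3 \<Rightarrow> real)" and eq: "AE x in lebesgue_on (interior K). f x = c x"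
  shows "integrable (lebesgue_on K) f" "(LINT x|lebesgue_on K. f x) = (LINT x|lebesgue_on K. c x)"
proof -
  have K: "K \<in> sets lebesgue" using closed by simp
  have ae: "AE x in lebesgue. indicator K x *\<^sub>R c x = indicator K x *\<^sub>R f x"
    using AE_cell_of_interior[OF eq] K by (auto simp: AE_restrict_space_iff elim!: eventually_mono split: split_indicator)
  have i: "integrable lebesgue (\<lambda>x. indicator K x *\<^sub>R c x)"
    using integrable_continuous_cell[OF c] K by (simp add: integrable_restrict_space)
  then have mc: "(\<lambda>x. indicator K x *\<^sub>R c x) \<in> borel_measurable lebesgue" by (rule borel_measurable_integrable)
  have mf: "(\<lambda>x. indicator K x *\<^sub>R f x) \<in> borel_measurable lebesgue" by (rule borel_measurable_AE[OF mc ae])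
  show "integrable (lebesgue_on K) f"
    using integrable_cong_AE[OF mc mf ae] i K by (simp add: integrable_restrict_space)
  show "(LINT x|lebesgue_on K. f x) = (LINT x|lebesgue_on K. c x)"
    using integral_cong_AE[OF mf mc AE_symmetric[OF ae]] K by (simp add: integral_restrict_space)
qed

lemma facet_integral_outside_support:
  assumes "G \<inter> B = {}" "\<And>z. z \<notin> B \<Longrightarrow> \<phi> z = 0"
  shows "facet_integral G (\<lambda>x. f x * \<phi> x) = 0"
proof -
  have "f x * \<phi> x = 0" if "x \<in> G" for x
  proof -
    have "x \<notin> B" using that assms(1) by blast
    then show ?thesis by (simp add: assms(2))
  qed
  then have "facet_integral G (\<lambda>x. f x * \<phi> x) = (LINT y|lebesgue_on (plane_chart G -` G). 0)"
    unfolding facet_integral_def by (intro Bochner_Integration.integral_cong refl) simp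
  then show ?thesis by simp
qed

lemma bump_near:
  fixes x :: "real^3"
  assumes "r > 0"
  obtains \<phi> :: "real^3 \<Rightarrow> real" where "smooth \<phi>" "\<And>z. 0 \<le> \<phi> z" "\<phi> x > 0" "\<And>z. z \<notin> ball x r \<Longrightarrow> \<phi> z = 0"
    "\<And>S. ball x r \<subseteq> S \<Longrightarrow> test_fun S \<phi>"
proof -
  have "x \<in> ball x r" using assms by simp
  then obtain a b where ab: "cbox a b \<subseteq> ball x r" "x \<in> box a b"
    by (rule open_contains_cbox[OF open_ball]) blast
  show ?thesis
  proof (rule that[of "bump 0 a b"])
    show "bump 0 a b z = 0" if "z \<notin> ball x r" for z
      using that ab(1) box_subset_cbox[of a b] by (intro bump_eq_0) blast
    show "test_fun S (bump 0 a b)" if "ball x r \<subseteq> S" for S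
      using ab(1) that by (intro test_fun_bump) blast
  qed (use ab in \<open>auto simp: smooth_bump bump_bounds bump_pos_iff\<close>)
qed

text \<open>Localisation on a facet: if \<open>d x \<noteq> 0\<close>, then \<open>d\<close> has constant sign near \<open>x\<close>, and a bump supported there yields a nonzero
facet integral.\<close>

lemma (in solid_polytope) facet_integral_test_zero:
  assumes F: "F facet_of K" and x: "x \<in> rel_interior F" and d: "continuous_on UNIV (d :: real^3 \<Rightarrow> real)" and "r > 0"
    and zero: "\<And>\<phi>. smooth \<phi> \<Longrightarrow> (\<And>z. z \<notin> ball x r \<Longrightarrow> \<phi> z = 0) \<Longrightarrow> (\<And>S. ball x r \<subseteq> S \<Longrightarrow> test_fun S \<phi>) \<Longrightarrow>
        facet_integral F (\<lambda>z. d z * \<phi> z) = 0"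
  shows "d x = 0"
proof (rule ccontr)
  assume nz: "d x \<noteq> 0"
  \<comment> \<open>normalise the sign so that \<open>D x > 0\<close>\<close>
  define D where "D z = sgn (d x) * d z" for z
  have D: "continuous_on UNIV D" unfolding D_def by (intro continuous_on_mult continuous_on_const d)
  have "D x > 0" using nz by (simp add: D_def sgn_if)
  moreover have "open {z. D z > 0}" by (intro open_Collect_less continuous_on_const D)
  ultimately obtain s where s: "s > 0" "ball x s \<subseteq> {z. D z > 0}" by (auto elim: openE)
  define t where "t = min r s"
  have t: "t > 0" "ball x t \<subseteq> ball x r" "ball x t \<subseteq> ball x s" using s(1) \<open>r > 0\<close> by (auto simp: t_def)
  obtain \<phi> :: "real^3 \<Rightarrow> real" where \<phi>: "smooth \<phi>" "\<And>z. 0 \<le> \<phi> z" "\<phi> x > 0" "\<And>z. z \<notin> ball x t \<Longrightarrow> \<phi> z = 0" "\<And>S. ball x t \<subseteq> S \<Longrightarrow> test_fun S \<phi>"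
    by (rule bump_near[OF t(1), of x]) blast
  have "facet_integral F (\<lambda>z. D z * \<phi> z) > 0"
  proof (rule facet_integral_pos[OF F _ _ x])
    show "continuous_on UNIV (\<lambda>z. D z * \<phi> z)" by (intro continuous_on_mult D smooth_continuous[OF \<phi>(1)])
    show "0 \<le> D z * \<phi> z" for z
    proof (cases "z \<in> ball x t")
      case True
      then have "D z > 0" using t(3) s(2) by blast
      then show ?thesis using \<phi>(2)[of z] by simp
    next
      case False then show ?thesis by (simp add: \<phi>(4))
    qed
    show "0 < D x * \<phi> x" using \<open>D x > 0\<close> \<phi>(3) by simp
  qed
  moreover have "facet_integral F (\<lambda>z. d z * \<phi> z) = 0"
    by (rule zero[OF \<phi>(1)]) (use \<phi>(4,5) t(2) in blast)+
  then have "facet_integral F (\<lambda>z. D z * \<phi> z) = 0"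
    using facet_integral_mult[of F "sgn (d x)" "\<lambda>z. d z * \<phi> z"] by (simp add: D_def mult.assoc)
  ultimately show False by simp
qed

lemma has_weak_grad_wgrad: "has_weak_grad \<Omega> f g \<Longrightarrow> has_weak_grad \<Omega> f (wgrad \<Omega> f)"
  unfolding wgrad_def by (rule someI[of "has_weak_grad \<Omega> f"])

lemma has_weak_curl_wcurl: "has_weak_curl \<Omega> v w \<Longrightarrow> has_weak_curl \<Omega> v (wcurl \<Omega> v)"
  unfolding wcurl_def by (rule someI[of "has_weak_curl \<Omega> v"])

lemma has_weak_div_wdiv: "has_weak_div \<Omega> v d \<Longrightarrow> has_weak_div \<Omega> v (wdiv \<Omega> v)"
  unfolding wdiv_def by (rule someI[of "has_weak_div \<Omega> v"])

lemma has_weak_jac_wjac: "has_weak_jac \<Omega> v J \<Longrightarrow> has_weak_jac \<Omega> v (wjac \<Omega> v)"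
  unfolding wjac_def by (rule someI[of "has_weak_jac \<Omega> v"])

text \<open>\<open>fe K\<close> is a smooth function on the whole of space that agrees with \<open>f\<close> inside the cell \<open>K\<close>. Its values on the boundary
of \<open>K\<close> are the one-sided traces of \<open>f\<close>, whereas \<open>f\<close> itself is arbitrary there.\<close>

definition extends_pieces :: "(real^3) set set \<Rightarrow> (real^3 \<Rightarrow> 'b::real_normed_vector) \<Rightarrow> ((real^3) set \<Rightarrow> real^3 \<Rightarrow> 'b) \<Rightarrow> bool" where
  "extends_pieces \<T> f fe \<longleftrightarrow> (\<forall>K\<in>\<T>. smooth (fe K) \<and> (\<forall>x\<in>interior K. f x = fe K x))"

lemma piecewise_smooth_extends: "piecewise_smooth \<T> f \<Longrightarrow> \<exists>fe. extends_pieces \<T> f fe"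
  unfolding piecewise_smooth_def extends_pieces_def by (rule bchoice)

lemma extends_pieces_component: "extends_pieces \<T> f fe \<Longrightarrow> extends_pieces \<T> (\<lambda>x. f x $ i) (\<lambda>K x. fe K x $ i)"
  by (auto simp: extends_pieces_def smooth_component)

context meshed_domain begin

lemma integral_pieces:
  fixes f :: "real^3 \<Rightarrow> real"
  assumes m: "f \<in> borel_measurable (lebesgue_on \<Omega>)"
    and c: "\<And>K. K \<in> \<T> \<Longrightarrow> continuous_on UNIV (c K)" "\<And>K. K \<in> \<T> \<Longrightarrow> AE x in lebesgue_on (interior K). f x = c K x"
  shows "integrable (lebesgue_on \<Omega>) f" "(LINT x|lebesgue_on \<Omega>. f x) = (\<Sum>K\<in>\<T>. LINT x|lebesgue_on K. c K x)"
proof -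
  note cong = solid_polytope.cell_integral_cong[OF cell c]
  show "integrable (lebesgue_on \<Omega>) f" by (rule integral_split_cells(1)[OF m]) (rule cong(1))
  have "(LINT x|lebesgue_on \<Omega>. f x) = broken_integral \<T> f" by (rule integral_split_cells(2)[OF m]) (rule cong(1))
  also have "\<dots> = (\<Sum>K\<in>\<T>. LINT x|lebesgue_on K. c K x)"
    unfolding broken_integral_def by (intro sum.cong refl cong(2))
  finally show "(LINT x|lebesgue_on \<Omega>. f x) = (\<Sum>K\<in>\<T>. LINT x|lebesgue_on K. c K x)" .
qed

lemma AE_open_cell:
  assumes "AE x in lebesgue_on \<Omega>. Q x" "K \<in> \<T>" shows "AE x in lebesgue_on (interior K). Q x"
proof -
  have "AE x in lebesgue. x \<in> \<Omega> \<longrightarrow> Q x" using assms(1) domain_sets by (simp add: AE_restrict_space_iff)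
  then have "AE x in lebesgue. x \<in> interior K \<longrightarrow> Q x"
    by eventually_elim (use interior_cell_subset[OF assms(2)] in blast)
  then show ?thesis by (simp add: AE_restrict_space_iff)
qed

text \<open>Test functions that are nonzero on the boundary are allowed, so that boundary facets contribute too. Inside each cell weak and classical derivatives agree,
so the left-hand side is a sum of cell integrals of \<open>\<partial>\<^sub>i (fe K * \<phi>)\<close>, to which the Gauss theorem applies.\<close>

lemma green_cells:
  assumes g: "has_weak_grad \<Omega> f g" and fe: "extends_pieces \<T> f fe" and \<phi>: "smooth \<phi>"
  shows "l2_inner \<Omega> f (partial i \<phi>) + l2_inner \<Omega> (\<lambda>x. g x $ i) \<phi>
     = (\<Sum>K\<in>\<T>. \<Sum>F | F facet_of K. facet_normal K F $ i * facet_integral F (\<lambda>x. fe K x * \<phi> x))"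
proof -
  have f: "l2_fun \<Omega> f" "l2_fun \<Omega> (\<lambda>x. g x $ i)" using g by (auto simp: has_weak_grad_def intro: l2_fun_component)
  have p: "l2_fun \<Omega> (partial i \<phi>)" "l2_fun \<Omega> \<phi>" using l2_fun_smooth \<phi> smooth_partial by blast+
  have ii: "integrable (lebesgue_on \<Omega>) (\<lambda>x. f x * partial i \<phi> x)" "integrable (lebesgue_on \<Omega>) (\<lambda>x. g x $ i * \<phi> x)"
    using integrable_inner_l2[OF f(1) p(1)] integrable_inner_l2[OF f(2) p(2)] by simp_all
  have "l2_inner \<Omega> f (partial i \<phi>) + l2_inner \<Omega> (\<lambda>x. g x $ i) \<phi> = (LINT x|lebesgue_on \<Omega>. f x * partial i \<phi> x + g x $ i * \<phi> x)"
    using ii by (simp add: l2_inner_def)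
  also have "\<dots> = (\<Sum>K\<in>\<T>. LINT x|lebesgue_on K. partial i (\<lambda>x. fe K x * \<phi> x) x)"
  proof (rule integral_pieces(2))
    show "(\<lambda>x. f x * partial i \<phi> x + g x $ i * \<phi> x) \<in> borel_measurable (lebesgue_on \<Omega>)"
      using ii by (intro borel_measurable_add borel_measurable_integrable)
    fix K assume K: "K \<in> \<T>"
    then have s: "smooth (fe K)" and e: "\<And>x. x \<in> interior K \<Longrightarrow> f x = fe K x" using fe by (auto simp: extends_pieces_def)
    show "continuous_on UNIV (partial i (\<lambda>x. fe K x * \<phi> x))"
      by (rule smooth_continuous[OF smooth_partial[OF smooth_mult[OF s \<phi>]]])
    have "AE x in lebesgue_on (interior K). g x = grad (fe K) x"
      by (rule weak_grad_on_smooth_piece[OF g open_interior interior_cell_subset[OF K] s e])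
    moreover have "AE x in lebesgue_on (interior K). x \<in> interior K" by (rule AE_I2) simp
    ultimately show "AE x in lebesgue_on (interior K). f x * partial i \<phi> x + g x $ i * \<phi> x = partial i (\<lambda>x. fe K x * \<phi> x) x"
      by eventually_elim (simp add: e partial_mult[OF smooth_has_derivative[OF s] smooth_has_derivative[OF \<phi>]] grad_def)
  qed
  also have "\<dots> = (\<Sum>K\<in>\<T>. \<Sum>F | F facet_of K. facet_normal K F $ i * facet_integral F (\<lambda>x. fe K x * \<phi> x))"
    using fe by (intro sum.cong refl solid_polytope.gauss_partial cell smooth_mult \<phi>) (auto simp: extends_pieces_def)
  finally show ?thesis .
qed

text \<open>For a test function supported near a point of the facet the left-hand side of \<open>green_cells\<close> vanishes by
definition of the weak gradient, and only the two contributions of this facet survive on the right. As the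
normals are opposite, the two traces have the same integrals against all such test functions.\<close>

lemma weak_gradient_continuous_across_facets:
  assumes g: "has_weak_grad \<Omega> f g" and fe: "extends_pieces \<T> f fe"
    and K: "K \<in> \<T>" and L: "L \<in> \<T>" and "K \<noteq> L" and F: "F facet_of K" "F facet_of L" and x: "x \<in> rel_interior F"
  shows "fe K x = fe L x"
proof -
  interpret K: solid_polytope K by (rule cell[OF K])
  obtain r where r: "r > 0" "ball x r \<subseteq> \<Omega>"
    "\<And>M. M \<in> \<T> \<Longrightarrow> M \<noteq> K \<Longrightarrow> M \<noteq> L \<Longrightarrow> M \<inter> ball x r = {}"
    "\<And>G. G facet_of K \<Longrightarrow> G \<noteq> F \<Longrightarrow> G \<inter> ball x r = {}"
    "\<And>G. G facet_of L \<Longrightarrow> G \<noteq> F \<Longrightarrow> G \<inter> ball x r = {}"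
    by (rule interior_facet_patch[OF K L \<open>K \<noteq> L\<close> F x]) blast
  have s: "smooth (fe K)" "smooth (fe L)" using fe K L by (auto simp: extends_pieces_def)
  note c = s[THEN smooth_continuous]
  have "(\<lambda>z. fe K z + - 1 * fe L z) x = 0"
  proof (rule K.facet_integral_test_zero[OF F(1) x _ r(1)])
    show "continuous_on UNIV (\<lambda>z. fe K z + - 1 * fe L z)"
      by (intro continuous_on_add continuous_on_mult continuous_on_const c)
    fix \<phi> :: "real^3 \<Rightarrow> real" assume \<phi>: "smooth \<phi>" "\<And>z. z \<notin> ball x r \<Longrightarrow> \<phi> z = 0" "\<And>S. ball x r \<subseteq> S \<Longrightarrow> test_fun S \<phi>"
    note c\<phi> = smooth_continuous[OF \<phi>(1)]
    define T where "T i M G = facet_normal M G $ i * facet_integral G (\<lambda>x. fe M x * \<phi> x)" for i M G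
    have sumM: "(\<Sum>G | G facet_of M. T i M G) = T i M F" if M: "M \<in> \<T>" "F facet_of M" "\<And>G. G facet_of M \<Longrightarrow> G \<noteq> F \<Longrightarrow> G \<inter> ball x r = {}" for M i
    proof -
      have "(\<Sum>G | G facet_of M. T i M G) = (\<Sum>G | G facet_of M. if G = F then T i M F else 0)"
      proof (rule sum.cong[OF refl])
        fix G assume G: "G \<in> {G. G facet_of M}"
        show "T i M G = (if G = F then T i M F else 0)"
        proof (cases "G = F")
          case False
          then have "facet_integral G (\<lambda>x. fe M x * \<phi> x) = 0"
            using M(3)[of G] G by (intro facet_integral_outside_support[OF _ \<phi>(2)]) auto
          then show ?thesis using False by (simp add: T_def)
        qed simp
      qed
      then show ?thesis using solid_polytope.finite_facets[OF cell[OF M(1)]] M(2) by simp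
    qed
    have zero: "T i K F + T i L F = 0" for i
    proof -
      have "(\<Sum>M\<in>\<T>. \<Sum>G | G facet_of M. T i M G) = (\<Sum>M\<in>{K, L}. \<Sum>G | G facet_of M. T i M G)"
      proof (rule sum.mono_neutral_right[OF finite_mesh])
        show "\<forall>M\<in>\<T> - {K, L}. (\<Sum>G | G facet_of M. T i M G) = 0"
        proof (intro ballI sum.neutral)
          fix M G assume M: "M \<in> \<T> - {K, L}" and G: "G \<in> {G. G facet_of M}"
          then have "G \<inter> ball x r = {}" using r(3)[of M] facet_of_imp_subset[of G M] by blast
          then have "facet_integral G (\<lambda>x. fe M x * \<phi> x) = 0"
            by (rule facet_integral_outside_support[OF _ \<phi>(2)])
          then show "T i M G = 0" by (simp add: T_def)
        qed
      qed (use K L in auto)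
      also have "\<dots> = T i K F + T i L F"
        using \<open>K \<noteq> L\<close> sumM[OF K F(1) r(4)] sumM[OF L F(2) r(5)] by simp
      finally have "l2_inner \<Omega> f (partial i \<phi>) + l2_inner \<Omega> (\<lambda>x. g x $ i) \<phi> = T i K F + T i L F"
        using green_cells[OF g fe \<phi>(1), of i] by (simp add: T_def)
      moreover have "l2_inner \<Omega> f (partial i \<phi>) = - l2_inner \<Omega> (\<lambda>x. g x $ i) \<phi>"
        using g \<phi>(3)[OF r(2)] unfolding has_weak_grad_componentwise by blast
      ultimately show ?thesis by simp
    qed
    \<comment> \<open>a component in which the normal does not vanish, so that it can be cancelled\<close>
    obtain i where i: "facet_normal K F $ i \<noteq> 0" using K.facet_normal_nz[OF F(1)] by (auto simp: vec_eq_iff)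
    have "facet_normal L F $ i = - (facet_normal K F $ i)"
      using shared_facet_normals[OF K L \<open>K \<noteq> L\<close> F] by simp
    with zero[of i] have "facet_normal K F $ i * (facet_integral F (\<lambda>x. fe K x * \<phi> x) - facet_integral F (\<lambda>x. fe L x * \<phi> x)) = 0"
      by (simp add: T_def algebra_simps)
    then have eq: "facet_integral F (\<lambda>x. fe K x * \<phi> x) = facet_integral F (\<lambda>x. fe L x * \<phi> x)" using i by simp
    have "facet_integral F (\<lambda>z. (fe K z + - 1 * fe L z) * \<phi> z)
        = facet_integral F (\<lambda>z. fe K z * \<phi> z) - facet_integral F (\<lambda>z. fe L z * \<phi> z)"
      using K.facet_integrable[OF F(1) continuous_on_mult[OF c(1) c\<phi>]] K.facet_integrable[OF F(1) continuous_on_mult[OF c(2) c\<phi>]]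
      by (simp add: facet_integral_def left_diff_distrib)
    then show "facet_integral F (\<lambda>z. (fe K z + - 1 * fe L z) * \<phi> z) = 0" using eq by simp
  qed
  then show ?thesis by simp
qed

text \<open>On a facet belonging to one cell only, the distributional normal trace, which is zero by assumption, is by
\<open>green_cells\<close> the facet integral of \<open>n \<bullet> u\<close> against the test function. The test functions are not
compactly supported in the domain; this is where membership in \<open>H0_div\<close> enters.\<close>

lemma normal_trace_vanishes:
  assumes u: "u \<in> H1_vec \<Omega>" "u \<in> H0_div \<Omega>" and ue: "extends_pieces \<T> u ue"
    and K: "K \<in> \<T>" and F: "F facet_of K" and only: "\<And>L. L \<in> \<T> \<Longrightarrow> F facet_of L \<Longrightarrow> L = K" and x: "x \<in> rel_interior F"
  shows "facet_normal K F \<bullet> ue K x = 0"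
proof -
  interpret K: solid_polytope K by (rule cell[OF K])
  obtain r where r: "r > 0" "\<And>M. M \<in> \<T> \<Longrightarrow> M \<noteq> K \<Longrightarrow> M \<inter> ball x r = {}"
    "\<And>G. G facet_of K \<Longrightarrow> G \<noteq> F \<Longrightarrow> G \<inter> ball x r = {}"
    by (rule boundary_facet_patch[OF K F only x]) blast+
  obtain J where J: "has_weak_jac \<Omega> u J" using u(1) by (auto simp: H1_vec_def)
  have sK: "smooth (ue K)" using ue K by (auto simp: extends_pieces_def)
  note c = smooth_continuous[OF sK]
  have ci: "continuous_on UNIV (\<lambda>z. ue K z $ i)" for i by (rule smooth_continuous[OF smooth_component[OF sK]])
  show ?thesis
  proof (rule K.facet_integral_test_zero[OF F x _ r(1), of "\<lambda>z. facet_normal K F \<bullet> ue K z"])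
    show "continuous_on UNIV (\<lambda>z. facet_normal K F \<bullet> ue K z)" by (intro continuous_on_inner continuous_on_const c)
    fix \<phi> :: "real^3 \<Rightarrow> real" assume \<phi>: "smooth \<phi>" "\<And>z. z \<notin> ball x r \<Longrightarrow> \<phi> z = 0"
    note c\<phi> = smooth_continuous[OF \<phi>(1)]
    define T where "T i M G = facet_normal M G $ i * facet_integral G (\<lambda>x. ue M x $ i * \<phi> x)" for i M G
    have only_F: "(\<Sum>M\<in>\<T>. \<Sum>G | G facet_of M. T i M G) = T i K F" for i
    proof -
      have "(\<Sum>M\<in>\<T>. \<Sum>G | G facet_of M. T i M G) = (\<Sum>M\<in>\<T>. if M = K then T i K F else 0)"
      proof (rule sum.cong[OF refl])
        fix M assume M: "M \<in> \<T>"
        have z: "T i M G = 0" if "G facet_of M" "M \<noteq> K \<or> G \<noteq> F" for G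
        proof -
          have "G \<inter> ball x r = {}"
            using that r(2)[OF M] r(3)[of G] facet_of_imp_subset[OF that(1)] by blast
          then have "facet_integral G (\<lambda>x. ue M x $ i * \<phi> x) = 0" by (rule facet_integral_outside_support[OF _ \<phi>(2)])
          then show ?thesis by (simp add: T_def)
        qed
        have "(\<Sum>G | G facet_of M. T i M G) = (\<Sum>G | G facet_of M. if G = F then (if M = K then T i K F else 0) else 0)"
          by (rule sum.cong[OF refl]) (use z in auto)
        then show "(\<Sum>G | G facet_of M. T i M G) = (if M = K then T i K F else 0)"
          using solid_polytope.finite_facets[OF cell[OF M]] F by (cases "M = K") auto
      qed
      then show ?thesis using finite_mesh K by simp
    qed
    have green: "l2_inner \<Omega> (\<lambda>x. u x $ i) (partial i \<phi>) + l2_inner \<Omega> (\<lambda>x. J x $ i $ i) \<phi> = T i K F" for i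
    proof -
      have "has_weak_grad \<Omega> (\<lambda>x. u x $ i) (\<lambda>x. J x $ i)" using J by (simp add: has_weak_jac_def)
      from green_cells[OF this extends_pieces_component[OF ue] \<phi>(1), of i] only_F[of i]
      show ?thesis by (simp add: T_def)
    qed
    have Jl: "l2_fun \<Omega> (\<lambda>x. u x $ i)" "l2_fun \<Omega> (\<lambda>x. J x $ i)" for i
      using J by (auto simp: has_weak_jac_def has_weak_grad_def)
    have ul: "l2_fun \<Omega> u" by (rule l2_fun_vec[OF Jl(1)])
    have gl: "l2_fun \<Omega> (grad \<phi>)"
      by (rule l2_fun_vec) (use l2_fun_smooth[OF smooth_partial[OF \<phi>(1)]] in \<open>simp add: grad_def\<close>)
    have tr: "l2_inner \<Omega> (wdiv \<Omega> u) \<phi> = l2_inner \<Omega> (\<lambda>x. \<Sum>i\<in>UNIV. J x $ i $ i) \<phi>"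
    proof (rule l2_inner_cong_AE)
      have d: "has_weak_div \<Omega> u (wdiv \<Omega> u)"
        by (rule has_weak_div_wdiv[OF has_weak_div_of_jac[OF J]])
      show "l2_fun \<Omega> (wdiv \<Omega> u)" using d by (simp add: has_weak_div_def)
      show "l2_fun \<Omega> (\<lambda>x. \<Sum>i\<in>UNIV. J x $ i $ i)" using has_weak_div_of_jac[OF J] by (simp add: has_weak_div_def)
      show "l2_fun \<Omega> \<phi>" by (rule l2_fun_smooth[OF \<phi>(1)])
      show "AE x in lebesgue_on \<Omega>. wdiv \<Omega> u x = (\<Sum>i\<in>UNIV. J x $ i $ i)"
        by (rule has_weak_div_unique[OF d has_weak_div_of_jac[OF J]])
    qed
    have "0 = div_trace \<Omega> u \<phi>" using u(2) \<phi>(1) by (simp add: H0_div_def)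
    also have "\<dots> = l2_inner \<Omega> (\<lambda>x. \<Sum>i\<in>UNIV. J x $ i $ i) \<phi> + l2_inner \<Omega> u (grad \<phi>)"
      by (simp add: div_trace_def tr)
    also have "l2_inner \<Omega> u (grad \<phi>) = (\<Sum>i\<in>UNIV. l2_inner \<Omega> (\<lambda>x. u x $ i) (partial i \<phi>))"
      using l2_inner_componentwise[OF ul gl] by (simp add: grad_def)
    also have "l2_inner \<Omega> (\<lambda>x. \<Sum>i\<in>UNIV. J x $ i $ i) \<phi> = (\<Sum>i\<in>UNIV. l2_inner \<Omega> (\<lambda>x. J x $ i $ i) \<phi>)"
      using l2_inner_sum_left[of UNIV \<Omega> "\<lambda>i x. J x $ i $ i" \<phi> "\<lambda>_. 1"] l2_fun_component[OF Jl(2)] l2_fun_smooth[OF \<phi>(1)] by simp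
    finally have "0 = (\<Sum>i\<in>UNIV. T i K F)" using green by (simp add: sum.distrib[symmetric] add.commute)
    also have "\<dots> = facet_integral F (\<lambda>z. \<Sum>i\<in>UNIV. facet_normal K F $ i * (ue K z $ i * \<phi> z))"
      unfolding T_def K.facet_integral_mult[symmetric]
      by (rule K.facet_integral_sum[OF F, symmetric]) (intro continuous_on_mult continuous_on_const ci c\<phi>)
    also have "\<dots> = facet_integral F (\<lambda>z. (facet_normal K F \<bullet> ue K z) * \<phi> z)"
      by (simp add: inner_vec_def sum_distrib_right mult.assoc)
    finally show "facet_integral F (\<lambda>z. (facet_normal K F \<bullet> ue K z) * \<phi> z) = 0" by simp
  qed
qed

lemma at_within_interior_cell:
  assumes "K \<in> \<T>" "x \<in> K" shows "at x within interior K \<noteq> bot"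
proof -
  interpret K: solid_polytope K by (rule cell[OF assms(1)])
  have "x \<in> closure (interior K)"
    using convex_closure_interior[OF K.convex K.solid] assms(2) K.closed by simp
  then have "x islimpt interior K"
    using interior_limit_point[of x "interior K"] by (cases "x \<in> interior K") (auto simp: closure_def)
  then show ?thesis using trivial_limit_within by (auto simp: trivial_limit_def)
qed

lemma tendsto_piece:
  assumes fe: "extends_pieces \<T> f fe" and K: "K \<in> \<T>"
  shows "(f \<longlongrightarrow> fe K x) (at x within interior K)"
proof -
  have "smooth (fe K)" using fe K by (auto simp: extends_pieces_def)
  from smooth_continuous[OF this] have "(fe K \<longlongrightarrow> fe K x) (at x within interior K)"
    by (simp add: continuous_on_def tendsto_within_subset[OF _ subset_UNIV])
  moreover have "eventually (\<lambda>z. fe K z = f z) (at x within interior K)"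
    using fe K by (auto simp: extends_pieces_def eventually_at_filter)
  ultimately show ?thesis by (rule Lim_transform_eventually)
qed

lemma trace_from_cell:
  assumes "extends_pieces \<T> f fe" "K \<in> \<T>" "x \<in> K" shows "trace_from (interior K) f x = fe K x"
  unfolding trace_from_def
  by (rule tendsto_Lim[OF at_within_interior_cell[OF assms(2,3)] tendsto_piece[OF assms(1,2)]])

text \<open>Near the point the union of the cell interiors consists of two pieces, on each of which the function
has the same limit.\<close>

lemma trace_from_all_cells:
  assumes fe: "extends_pieces \<T> f fe" and K: "K \<in> \<T>" and L: "L \<in> \<T>" and "K \<noteq> L" and F: "F facet_of K" "F facet_of L"
    and x: "x \<in> rel_interior F" and eq: "fe K x = fe L x"
  shows "trace_from (\<Union>K\<in>\<T>. interior K) f x = fe K x"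
proof -
  obtain r where r: "r > 0" "\<And>M. M \<in> \<T> \<Longrightarrow> M \<noteq> K \<Longrightarrow> M \<noteq> L \<Longrightarrow> M \<inter> ball x r = {}"
    by (rule interior_facet_patch[OF K L \<open>K \<noteq> L\<close> F x]) blast
  let ?S = "\<Union>K\<in>\<T>. interior K"
  have "?S \<inter> ball x r - {x} = (interior K \<union> interior L) \<inter> ball x r - {x}"
    using r(2) K L interior_subset by fastforce
  then have at: "at x within ?S = at x within (interior K \<union> interior L)"
    by (intro at_within_nhd[of x "ball x r"]) (use r(1) in auto)
  have lim: "(f \<longlongrightarrow> fe K x) (at x within ?S)"
    unfolding at using tendsto_piece[OF fe K, of x] tendsto_piece[OF fe L, of x] eq by (simp add: Lim_within_Un)
  have "x \<in> K" using x rel_interior_subset[of F] facet_of_imp_subset[OF F(1)] by blast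
  then have "at x within interior K \<noteq> bot" by (rule at_within_interior_cell[OF K])
  moreover have "at x within interior K \<le> at x within ?S" using K by (intro at_le) auto
  ultimately have "at x within ?S \<noteq> bot" by (metis bot.extremum_uniqueI)
  then show ?thesis unfolding trace_from_def using lim by (rule tendsto_Lim)
qed

end

section \<open>The nonlinear term\<close>

context bounded_domain begin

lemma l2_fun_sym_grad:
  assumes "v \<in> H1_vec \<Omega>" shows "l2_fun \<Omega> (sym_grad \<Omega> v)"
proof -
  obtain J where "has_weak_jac \<Omega> v J" using assms by (auto simp: H1_vec_def)
  then have J: "has_weak_jac \<Omega> v (wjac \<Omega> v)" by (rule has_weak_jac_wjac)
  then have l: "l2_fun \<Omega> (\<lambda>x. wjac \<Omega> v x $ i $ j)" for i j
    by (intro l2_fun_component[of _ "\<lambda>x. wjac \<Omega> v x $ i"]) (auto simp: has_weak_jac_def has_weak_grad_def)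
  have "l2_fun \<Omega> (\<lambda>x. (1/2) *\<^sub>R (wjac \<Omega> v x $ i $ j + wjac \<Omega> v x $ j $ i))" for i j
    by (intro l2_fun_scaleR l2_fun_add l)
  then have "l2_fun \<Omega> (\<lambda>x. sym_grad \<Omega> v x $ i $ j)" for i j
    by (simp add: sym_grad_def transpose_def)
  then show ?thesis by (intro l2_fun_vec)
qed

end

lemma partial_norm_square:
  fixes w :: "real^3 \<Rightarrow> real^3"
  assumes "smooth w"
  shows "partial i (\<lambda>x. w x \<bullet> w x) x = 2 * (w x \<bullet> partial i w x)"
  unfolding partial_def
  by (subst dderiv_eqI[OF has_derivative_inner[OF smooth_has_derivative[OF assms] smooth_has_derivative[OF assms]]])
     (simp add: inner_commute)

lemma smooth_inner:
  fixes v w :: "real^3 \<Rightarrow> real^3"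
  assumes "smooth v" "smooth w" shows "smooth (\<lambda>x. v x \<bullet> w x)"
proof -
  have "smooth (\<lambda>x. v x $ i * w x $ i)" for i
    by (rule smooth_mult[OF smooth_component[OF assms(1)] smooth_component[OF assms(2)]])
  from smooth_add[OF smooth_add[OF this[of 1] this[of 2]] this[of 3]]
  show ?thesis by (simp add: inner_vec_def sum_3)
qed

lemma partial_inner:
  fixes v w :: "real^3 \<Rightarrow> real^3"
  assumes "smooth v" "smooth w"
  shows "partial i (\<lambda>x. v x \<bullet> w x) x = v x \<bullet> partial i w x + partial i v x \<bullet> w x"
  unfolding partial_def
  by (subst dderiv_eqI[OF has_derivative_inner[OF smooth_has_derivative[OF assms(1)] smooth_has_derivative[OF assms(2)]]]) simp

text \<open>The pointwise identity
\<open>(u \<times> \<omega>) \<bullet> curl \<omega> = \<omega> \<bullet> \<epsilon>u \<omega> - \<omega> \<bullet> \<nabla>(u \<bullet> \<omega>) + 1/2 div(|\<omega>|\<^sup>2 u)\<close>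
for divergence-free \<open>u\<close>, as an identity between numbers: \<open>a\<close> and \<open>w\<close> stand for the values of \<open>u\<close> and \<open>\<omega>\<close>, \<open>A j\<close> and
\<open>B j\<close> for their partial derivatives in direction \<open>j\<close>, \<open>C\<close> for \<open>curl \<omega>\<close> and \<open>g\<close> for \<open>\<nabla>(u \<bullet> \<omega>)\<close>.\<close>

lemma vorticity_identity:
  fixes a w :: "real^3" and A B :: "3 \<Rightarrow> real^3" and S :: "real^3^3"
  assumes S: "\<And>i j. S $ i $ j = (1/2) * (A j $ i + A i $ j)"
    and div: "A 1 $ 1 + A 2 $ 2 + A 3 $ 3 = 0"
    and C: "C $ 1 = B 2 $ 3 - B 3 $ 2" "C $ 2 = B 3 $ 1 - B 1 $ 3" "C $ 3 = B 1 $ 2 - B 2 $ 1"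
    and g: "\<And>j. g $ j = a \<bullet> B j + A j \<bullet> w"
  shows "cross3 a w \<bullet> C = w \<bullet> (S *v w) - w \<bullet> g
     + 1/2 * (\<Sum>i\<in>UNIV. a $ i * (2 * (w \<bullet> B i)) + A i $ i * (w \<bullet> w))"
proof -
  have d: "A 3 $ 3 = - A 1 $ 1 - A 2 $ 2" using div by linarith
  show ?thesis
    by (simp add: inner_vec_def sum_3 cross3_def matrix_vector_mult_def S C g d algebra_simps)
qed

context meshed_domain begin

lemma piece_grad:
  assumes fe: "extends_pieces \<T> f fe" and K: "K \<in> \<T>" and x: "x \<in> interior K"
  shows "frechet_derivative f (at x) = frechet_derivative (fe K) (at x)"
proof -
  have s: "smooth (fe K)" "\<And>y. y \<in> interior K \<Longrightarrow> fe K y = f y" using fe K by (auto simp: extends_pieces_def)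
  have "(f has_derivative frechet_derivative (fe K) (at x)) (at x)"
    by (rule has_derivative_transform_within_open[OF smooth_has_derivative[OF s(1)] open_interior x]) (rule s(2))
  from frechet_derivative_at[OF this] show ?thesis by simp
qed

text \<open>The flux of \<open>|\<omega>|\<^sup>2 u\<close> through \<open>F\<close> out of \<open>K\<close>, computed from the traces within \<open>K\<close>.\<close>

definition facet_flux :: "((real^3) set \<Rightarrow> real^3 \<Rightarrow> real^3) \<Rightarrow> ((real^3) set \<Rightarrow> real^3 \<Rightarrow> real^3) \<Rightarrow> (real^3) set \<Rightarrow> (real^3) set \<Rightarrow> real" where
  "facet_flux ue we K F = facet_integral F (\<lambda>x. (we K x \<bullet> we K x) * (facet_normal K F \<bullet> ue K x))"

text \<open>Regroup the sum over cells by facets. Facets of a single cell carry no flux since the normal trace of \<open>u\<close>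
vanishes there; on a facet of two cells the traces of \<open>u\<close> coincide, so the two fluxes combine to the jump of \<open>|\<omega>|\<^sup>2 n\<close>
against the common value of \<open>u\<close>.\<close>

lemma sum_facet_flux:
  assumes u: "u \<in> H1_vec \<Omega>" "u \<in> H0_div \<Omega>" and ue: "extends_pieces \<T> u ue" and we: "extends_pieces \<T> \<omega> we"
  shows "(\<Sum>K\<in>\<T>. \<Sum>F | F facet_of K. facet_flux ue we K F) = facet_jump_term \<T> \<omega> u"
proof -
  \<comment> \<open>all facets of all cells\<close>
  define AF where "AF = (\<Union>K\<in>\<T>. {F. F facet_of K})"
  have finAF: "finite AF" unfolding AF_def
    by (rule finite_UN_I[OF finite_mesh]) (rule solid_polytope.finite_facets[OF cell])
  have sm: "smooth (ue K)" "smooth (we K)" if "K \<in> \<T>" for K using ue we that by (auto simp: extends_pieces_def)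
  have "(\<Sum>K\<in>\<T>. \<Sum>F | F facet_of K. facet_flux ue we K F) = (\<Sum>K\<in>\<T>. \<Sum>F | F \<in> AF \<and> F facet_of K. facet_flux ue we K F)"
    by (rule sum.cong[OF refl], rule sum.cong) (auto simp: AF_def)
  also have "\<dots> = (\<Sum>F\<in>AF. \<Sum>K | K \<in> \<T> \<and> F facet_of K. facet_flux ue we K F)"
    by (rule sum.swap_restrict[OF finite_mesh finAF])
  also have "\<dots> = (\<Sum>F\<in>interior_facets \<T>. \<Sum>K | K \<in> \<T> \<and> F facet_of K. facet_flux ue we K F)"
  proof (rule sum.mono_neutral_right[OF finAF])
    show "interior_facets \<T> \<subseteq> AF" by (auto simp: interior_facets_def AF_def)
    show "\<forall>F\<in>AF - interior_facets \<T>. (\<Sum>K | K \<in> \<T> \<and> F facet_of K. facet_flux ue we K F) = 0"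
    proof (intro ballI sum.neutral)
      fix F K assume F: "F \<in> AF - interior_facets \<T>" and K: "K \<in> {K. K \<in> \<T> \<and> F facet_of K}"
      interpret K: solid_polytope K using K by (auto intro: cell)
      have only: "L = K" if "L \<in> \<T>" "F facet_of L" for L
        using F K that by (auto simp: interior_facets_def)
      have "facet_flux ue we K F = facet_integral F (\<lambda>x. 0)"
        unfolding facet_flux_def
      proof (rule K.facet_integral_cong_rel_interior)
        show "(we K x \<bullet> we K x) * (facet_normal K F \<bullet> ue K x) = 0" if "x \<in> rel_interior F" for x
          using normal_trace_vanishes[OF u ue _ _ only that] K by simp
      qed (use K in auto)
      then show "facet_flux ue we K F = 0" by (simp add: facet_integral_def)
    qed
  qed
  also have "\<dots> = facet_jump_term \<T> \<omega> u"
    unfolding facet_jump_term_def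
  proof (rule sum.cong[OF refl])
    fix F assume "F \<in> interior_facets \<T>"
    then obtain K L where KL: "K \<in> \<T>" "L \<in> \<T>" "K \<noteq> L" "F facet_of K" "F facet_of L" by (auto simp: interior_facets_def)
    interpret K: solid_polytope K by (rule cell[OF KL(1)])
    let ?S = "{K. K \<in> \<T> \<and> F facet_of K}"
    let ?h = "\<lambda>M x. (we M x \<bullet> we M x) * (facet_normal M F \<bullet> ue M x)"
    have hc: "continuous_on UNIV (?h M)" if "M \<in> ?S" for M
    proof -
      have "continuous_on UNIV (we M)" "continuous_on UNIV (ue M)" using that sm smooth_continuous by auto
      then show ?thesis by (intro continuous_on_mult continuous_on_inner continuous_on_const)
    qed
    have "facet_integral F (\<lambda>x. normal_jump \<T> (\<lambda>K y. (norm (trace_from (interior K) \<omega> y))\<^sup>2) F x \<bullet> trace_from (\<Union>K\<in>\<T>. interior K) u x)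
        = facet_integral F (\<lambda>x. \<Sum>M\<in>?S. ?h M x)"
    proof (rule K.facet_integral_cong_rel_interior[OF KL(4)])
      show "continuous_on UNIV (\<lambda>x. \<Sum>M\<in>?S. ?h M x)" by (rule continuous_on_sum) (rule hc)
      fix x assume x: "x \<in> rel_interior F"
      obtain J where J: "has_weak_jac \<Omega> u J" using u(1) by (auto simp: H1_vec_def)
      have cont: "ue M x = ue N x" if "M \<in> ?S" "N \<in> ?S" for M N
      proof (cases "M = N")
        case False
        have "ue M x $ i = ue N x $ i" for i
          using weak_gradient_continuous_across_facets[OF _ extends_pieces_component[OF ue, of i], where K = M and L = N and F = F and x = x]
            J that False x by (auto simp: has_weak_jac_def)
        then show ?thesis by (simp add: vec_eq_iff)
      qed simp
      have tu: "trace_from (\<Union>K\<in>\<T>. interior K) u x = ue K x"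
        by (rule trace_from_all_cells[OF ue KL x]) (rule cont; use KL in simp)
      have tw: "trace_from (interior M) \<omega> x = we M x" if "M \<in> ?S" for M
      proof (rule trace_from_cell[OF we])
        show "M \<in> \<T>" using that by simp
        have "F \<subseteq> M" using that facet_of_imp_subset by blast
        then show "x \<in> M" using x rel_interior_subset by blast
      qed
      have "normal_jump \<T> (\<lambda>K y. (norm (trace_from (interior K) \<omega> y))\<^sup>2) F x \<bullet> ue K x
         = (\<Sum>M\<in>?S. (norm (trace_from (interior M) \<omega> x))\<^sup>2 * (facet_normal M F \<bullet> ue K x))"
        by (simp add: normal_jump_def inner_sum_left)
      also have "\<dots> = (\<Sum>M\<in>?S. ?h M x)"
      proof (rule sum.cong[OF refl])
        fix M assume M: "M \<in> ?S"
        show "(norm (trace_from (interior M) \<omega> x))\<^sup>2 * (facet_normal M F \<bullet> ue K x) = ?h M x"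
          using tw[OF M] cont[OF M, of K] KL by (simp add: power2_norm_eq_inner)
      qed
      finally show "normal_jump \<T> (\<lambda>K y. (norm (trace_from (interior K) \<omega> y))\<^sup>2) F x \<bullet> trace_from (\<Union>K\<in>\<T>. interior K) u x
         = (\<Sum>M\<in>?S. ?h M x)" by (simp add: tu)
    qed
    also have "\<dots> = (\<Sum>M\<in>?S. facet_flux ue we M F)"
      unfolding facet_flux_def by (rule K.facet_integral_sum[OF KL(4) hc])
    finally show "(\<Sum>K\<in>?S. facet_flux ue we K F) = facet_integral F (\<lambda>x. normal_jump \<T> (\<lambda>K y. (norm (trace_from (interior K) \<omega> y))\<^sup>2) F x \<bullet> trace_from (\<Union>K\<in>\<T>. interior K) u x)"
      by simp
  qed
  finally show ?thesis .
qed

lemma cell_flux: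
  assumes K: "K \<in> \<T>" and s: "smooth (ue K)" "smooth (we K)"
  shows "(\<Sum>i\<in>UNIV. LINT x|lebesgue_on K. partial i (\<lambda>x. ue K x $ i * (we K x \<bullet> we K x)) x)
     = (\<Sum>F | F facet_of K. facet_flux ue we K F)"
proof -
  interpret K: solid_polytope K by (rule cell[OF K])
  have q: "smooth (\<lambda>x. ue K x $ i * (we K x \<bullet> we K x))" for i
    by (rule smooth_mult[OF smooth_component[OF s(1)] smooth_inner[OF s(2) s(2)]])
  have "(\<Sum>i\<in>UNIV. LINT x|lebesgue_on K. partial i (\<lambda>x. ue K x $ i * (we K x \<bullet> we K x)) x)
     = (\<Sum>i\<in>UNIV. \<Sum>F | F facet_of K. facet_normal K F $ i * facet_integral F (\<lambda>x. ue K x $ i * (we K x \<bullet> we K x)))"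
    by (rule sum.cong[OF refl]) (rule K.gauss_partial[OF q])
  also have "\<dots> = (\<Sum>F | F facet_of K. \<Sum>i\<in>UNIV. facet_normal K F $ i * facet_integral F (\<lambda>x. ue K x $ i * (we K x \<bullet> we K x)))"
    by (rule sum.swap)
  also have "\<dots> = (\<Sum>F | F facet_of K. facet_flux ue we K F)"
  proof (rule sum.cong[OF refl])
    fix F assume "F \<in> {F. F facet_of K}"
    then have F: "F facet_of K" by simp
    have "(\<Sum>i\<in>UNIV. facet_normal K F $ i * facet_integral F (\<lambda>x. ue K x $ i * (we K x \<bullet> we K x)))
       = facet_integral F (\<lambda>x. \<Sum>i\<in>UNIV. facet_normal K F $ i * (ue K x $ i * (we K x \<bullet> we K x)))"
      unfolding K.facet_integral_mult[symmetric]
      by (rule K.facet_integral_sum[OF F, symmetric]) (intro continuous_on_mult continuous_on_const smooth_continuous[OF smooth_component[OF s(1)]] smooth_continuous[OF smooth_inner[OF s(2) s(2)]])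
    also have "(\<lambda>x. \<Sum>i\<in>UNIV. facet_normal K F $ i * (ue K x $ i * (we K x \<bullet> we K x))) = (\<lambda>x. (we K x \<bullet> we K x) * (facet_normal K F \<bullet> ue K x))"
      by (rule ext) (simp add: inner_vec_def[of "facet_normal K F"] sum_distrib_left mult_ac)
    finally show "(\<Sum>i\<in>UNIV. facet_normal K F $ i * facet_integral F (\<lambda>x. ue K x $ i * (we K x \<bullet> we K x))) = facet_flux ue we K F"
      by (simp add: facet_flux_def)
  qed
  finally show ?thesis .
qed

text \<open>Integrate the pointwise identity over each cell and turn the divergence term into facet fluxes.\<close>

theorem nonlinear_term:
  assumes u: "u \<in> H1_vec \<Omega>" "u \<in> H0_div \<Omega>" and div: "AE x in lebesgue_on \<Omega>. wdiv \<Omega> u x = 0"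
    and pu: "piecewise_smooth \<T> u" and pw: "piecewise_smooth \<T> \<omega>" and \<omega>: "has_weak_curl \<Omega> \<omega> w"
  shows "l2_inner \<Omega> (\<lambda>x. cross3 (u x) (\<omega> x)) w =
      (LINT x|lebesgue_on \<Omega>. \<omega> x \<bullet> (sym_grad \<Omega> u x *v \<omega> x)) + 1/2 * facet_jump_term \<T> \<omega> u
        - broken_integral \<T> (\<lambda>x. \<omega> x \<bullet> grad (\<lambda>y. u y \<bullet> \<omega> y) x)"
proof -
  obtain ue where ue: "extends_pieces \<T> u ue" using piecewise_smooth_extends[OF pu] by blast
  obtain we where we: "extends_pieces \<T> \<omega> we" using piecewise_smooth_extends[OF pw] by blast
  obtain J0 where "has_weak_jac \<Omega> u J0" using u(1) by (auto simp: H1_vec_def)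
  then have J: "has_weak_jac \<Omega> u (wjac \<Omega> u)" by (rule has_weak_jac_wjac)
  have l: "l2_fun \<Omega> u" "l2_fun \<Omega> \<omega>" "l2_fun \<Omega> w" "l2_fun \<Omega> (sym_grad \<Omega> u)"
    using J \<omega> l2_fun_sym_grad[OF u(1)] by (auto simp: has_weak_curl_def has_weak_jac_def has_weak_grad_def intro: l2_fun_vec)
  have m: "u \<in> borel_measurable (lebesgue_on \<Omega>)" "\<omega> \<in> borel_measurable (lebesgue_on \<Omega>)"
     "w \<in> borel_measurable (lebesgue_on \<Omega>)" "sym_grad \<Omega> u \<in> borel_measurable (lebesgue_on \<Omega>)"
    using l by (auto simp: l2_fun_def)
  have mc: "(\<lambda>x. f x $ i) \<in> borel_measurable (lebesgue_on \<Omega>)" if "f \<in> borel_measurable (lebesgue_on \<Omega>)"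
    for f :: "real^3 \<Rightarrow> ('b::euclidean_space)^3" and i
    by (rule measurable_compose[OF that borel_measurable_continuous_onI]) (intro continuous_intros)
  \<comment> \<open>classical symmetric gradient of the representative of \<open>u\<close> on \<open>K\<close>\<close>
  define S where "S K x = (1/2) *\<^sub>R ((\<chi> i. grad (\<lambda>x. ue K x $ i) x) + transpose (\<chi> i. grad (\<lambda>x. ue K x $ i) x))" for K x
  \<comment> \<open>smooth representatives on \<open>K\<close> of the terms of the pointwise identity: the product with the curl, the strain term, the gradient term and the divergence\<close>
  define C1 where "C1 K x = cross3 (ue K x) (we K x) \<bullet> curl (we K) x" for K x
  define C2 where "C2 K x = we K x \<bullet> (S K x *v we K x)" for K x
  define C3 where "C3 K x = we K x \<bullet> grad (\<lambda>y. ue K y \<bullet> we K y) x" for K x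
  define C4 where "C4 K x = (\<Sum>i\<in>UNIV. partial i (\<lambda>x. ue K x $ i * (we K x \<bullet> we K x)) x)" for K x
  have sm: "smooth (ue K)" "smooth (we K)" if "K \<in> \<T>" for K using ue we that by (auto simp: extends_pieces_def)
  have e: "u x = ue K x" "\<omega> x = we K x" if "K \<in> \<T>" "x \<in> interior K" for K x using ue we that by (auto simp: extends_pieces_def)
  have pc: "partial j (\<lambda>x. ue K x $ i) x = partial j (ue K) x $ i" if "K \<in> \<T>" for K x i j
    by (rule partial_component[OF smooth_has_derivative[OF sm(1)[OF that]]])
  have Sij: "S K x $ i $ j = (1/2) * (partial j (ue K) x $ i + partial i (ue K) x $ j)" if "K \<in> \<T>" for K x i j
    by (simp add: S_def transpose_def grad_def pc[OF that])
  have gr: "grad (\<lambda>y. ue K y \<bullet> we K y) x $ j = ue K x \<bullet> partial j (we K) x + partial j (ue K) x \<bullet> we K x" if "K \<in> \<T>" for K x j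
    by (simp add: grad_def partial_inner[OF sm[OF that]])
  have C4eq: "C4 K x = (\<Sum>i\<in>UNIV. ue K x $ i * (2 * (we K x \<bullet> partial i (we K) x)) + partial i (ue K) x $ i * (we K x \<bullet> we K x))" if K: "K \<in> \<T>" for K x
    unfolding C4_def
    by (rule sum.cong[OF refl])
       (simp add: partial_mult[OF smooth_has_derivative[OF smooth_component[OF sm(1)[OF K]]] smooth_has_derivative[OF smooth_inner[OF sm(2)[OF K] sm(2)[OF K]]]]
         partial_norm_square[OF sm(2)[OF K]] pc[OF K])
  have cts: "continuous_on UNIV (\<lambda>x. partial j (ue K) x $ i)" "continuous_on UNIV (\<lambda>x. partial j (we K) x $ i)"
     "continuous_on UNIV (\<lambda>x. ue K x $ i)" "continuous_on UNIV (\<lambda>x. we K x $ i)" if "K \<in> \<T>" for K i j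
    using sm[OF that] by (auto intro!: smooth_continuous[OF smooth_component] smooth_partial)
  have ctv: "continuous_on UNIV (ue K)" "continuous_on UNIV (we K)" "continuous_on UNIV (partial j (ue K))" "continuous_on UNIV (partial j (we K))" if "K \<in> \<T>" for K j
    using sm[OF that] by (auto intro!: smooth_continuous smooth_partial)
  have C1c: "continuous_on UNIV (C1 K)" if K: "K \<in> \<T>" for K
    unfolding C1_def inner_vec_def sum_3 cross3_def
    by (simp add: curl_component_simps)
       (intro continuous_on_add continuous_on_mult continuous_on_diff cts[OF K])
  have cS: "continuous_on UNIV (\<lambda>x. S K x $ i $ j)" if K: "K \<in> \<T>" for K i j
    unfolding Sij[OF K] by (intro continuous_on_add continuous_on_mult continuous_on_const cts[OF K])
  have C2c: "continuous_on UNIV (C2 K)" if K: "K \<in> \<T>" for K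
    unfolding C2_def inner_vec_def sum_3 matrix_vector_mult_def
    by (simp add: sum_3) (intro continuous_on_add continuous_on_mult cS[OF K] cts[OF K])
  have C3eq: "C3 K x = (\<Sum>j\<in>UNIV. we K x $ j * (ue K x \<bullet> partial j (we K) x + partial j (ue K) x \<bullet> we K x))" if K: "K \<in> \<T>" for K x
    unfolding C3_def by (subst inner_vec_def) (simp add: gr[OF K])
  have C3c: "continuous_on UNIV (C3 K)" if K: "K \<in> \<T>" for K
    unfolding C3eq[OF K, abs_def] by (intro continuous_on_sum continuous_on_add continuous_on_mult continuous_on_inner ctv[OF K] cts[OF K])
  have C4c: "continuous_on UNIV (C4 K)" if K: "K \<in> \<T>" for K
    unfolding C4eq[OF K, abs_def] by (intro continuous_on_sum continuous_on_add continuous_on_mult continuous_on_inner continuous_on_const ctv[OF K] cts[OF K])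
  have aeJ: "AE x in lebesgue_on (interior K). sym_grad \<Omega> u x = S K x \<and> (\<Sum>i\<in>UNIV. partial i (ue K) x $ i) = 0" if K: "K \<in> \<T>" for K
  proof -
    have "AE x in lebesgue_on (interior K). wjac \<Omega> u x = (\<chi> i. grad (\<lambda>x. ue K x $ i) x)"
    proof (rule AE_vec_eqI)
      fix i
      have "AE x in lebesgue_on (interior K). wjac \<Omega> u x $ i = grad (\<lambda>x. ue K x $ i) x"
      proof (rule weak_grad_on_smooth_piece[OF _ open_interior interior_cell_subset[OF K]])
        show "has_weak_grad \<Omega> (\<lambda>x. u x $ i) (\<lambda>x. wjac \<Omega> u x $ i)" using J by (simp add: has_weak_jac_def)
        show "smooth (\<lambda>x. ue K x $ i)" by (rule smooth_component[OF sm(1)[OF K]])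
        show "u x $ i = ue K x $ i" if "x \<in> interior K" for x using e(1)[OF K that] by simp
      qed
      then show "AE x in lebesgue_on (interior K). wjac \<Omega> u x $ i = (\<chi> i. grad (\<lambda>x. ue K x $ i) x) $ i" by simp
    qed
    moreover have "AE x in lebesgue_on (interior K). (\<Sum>i\<in>UNIV. wjac \<Omega> u x $ i $ i) = 0"
    proof (rule AE_open_cell[OF _ K])
      show "AE x in lebesgue_on \<Omega>. (\<Sum>i\<in>UNIV. wjac \<Omega> u x $ i $ i) = 0"
        using has_weak_div_unique[OF has_weak_div_of_jac[OF J] has_weak_div_wdiv[OF has_weak_div_of_jac[OF J]]] div
        by eventually_elim simp
    qed
    ultimately show ?thesis
      by eventually_elim (simp add: sym_grad_def S_def grad_def pc[OF K])
  qed
  have aeint: "AE x in lebesgue_on (interior K). x \<in> interior K" for K by (rule AE_I2) simp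
  have ae1: "AE x in lebesgue_on (interior K). cross3 (u x) (\<omega> x) \<bullet> w x = C1 K x" if K: "K \<in> \<T>" for K
  proof -
    have "AE x in lebesgue_on (interior K). w x = curl (we K) x"
      by (rule weak_curl_on_smooth_piece[OF \<omega> open_interior interior_cell_subset[OF K] sm(2)[OF K] e(2)[OF K]])
    with aeint show ?thesis by eventually_elim (simp add: C1_def e[OF K])
  qed
  have ae2: "AE x in lebesgue_on (interior K). \<omega> x \<bullet> (sym_grad \<Omega> u x *v \<omega> x) = C2 K x" if K: "K \<in> \<T>" for K
    using aeJ[OF K] aeint by eventually_elim (simp add: C2_def e[OF K])
  have ue_we: "extends_pieces \<T> (\<lambda>y. u y \<bullet> \<omega> y) (\<lambda>K y. ue K y \<bullet> we K y)"
    using ue we by (auto simp: extends_pieces_def smooth_inner)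
  have ae3: "AE x in lebesgue_on (interior K). \<omega> x \<bullet> grad (\<lambda>y. u y \<bullet> \<omega> y) x = C3 K x" if K: "K \<in> \<T>" for K
  proof (rule AE_I2)
    fix x assume "x \<in> space (lebesgue_on (interior K))"
    then have x: "x \<in> interior K" by simp
    have "grad (\<lambda>y. u y \<bullet> \<omega> y) x = grad (\<lambda>y. ue K y \<bullet> we K y) x"
      unfolding grad_def partial_def piece_grad[OF ue_we K x] ..
    then show "\<omega> x \<bullet> grad (\<lambda>y. u y \<bullet> \<omega> y) x = C3 K x" by (simp add: C3_def e[OF K x])
  qed
  have ae4: "AE x in lebesgue_on (interior K). cross3 (u x) (\<omega> x) \<bullet> w x = C2 K x - C3 K x + 1/2 * C4 K x" if K: "K \<in> \<T>" for K
    using aeJ[OF K] ae1[OF K]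
  proof eventually_elim
    case (elim x)
    have "C1 K x = C2 K x - C3 K x + 1/2 * C4 K x"
      unfolding C1_def C2_def C3_def C4eq[OF K]
      by (rule vorticity_identity) (use elim in \<open>simp_all add: Sij[OF K] gr[OF K] curl_component_simps sum_3\<close>)
    then show ?case using elim by simp
  qed
  have mcross: "(\<lambda>x. cross3 (u x) (\<omega> x) \<bullet> w x) \<in> borel_measurable (lebesgue_on \<Omega>)"
    unfolding inner_vec_def sum_3 cross3_def
    by (simp) (intro borel_measurable_add borel_measurable_times borel_measurable_diff mc m)
  have msym: "(\<lambda>x. \<omega> x \<bullet> (sym_grad \<Omega> u x *v \<omega> x)) \<in> borel_measurable (lebesgue_on \<Omega>)"
    unfolding inner_vec_def sum_3 matrix_vector_mult_def
    by (simp add: sum_3) (intro borel_measurable_add borel_measurable_times mc m)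
  have cc: "continuous_on UNIV (\<lambda>x. C2 K x - C3 K x + 1/2 * C4 K x)" if K: "K \<in> \<T>" for K
    by (intro continuous_on_add continuous_on_diff continuous_on_mult continuous_on_const C2c C3c C4c K)
  have I: "l2_inner \<Omega> (\<lambda>x. cross3 (u x) (\<omega> x)) w = (\<Sum>K\<in>\<T>. LINT x|lebesgue_on K. C2 K x - C3 K x + 1/2 * C4 K x)"
    unfolding l2_inner_def by (rule integral_pieces(2)[OF mcross cc ae4])
  have I2: "(LINT x|lebesgue_on \<Omega>. \<omega> x \<bullet> (sym_grad \<Omega> u x *v \<omega> x)) = (\<Sum>K\<in>\<T>. LINT x|lebesgue_on K. C2 K x)"
    by (rule integral_pieces(2)[OF msym C2c ae2])
  have I3: "broken_integral \<T> (\<lambda>x. \<omega> x \<bullet> grad (\<lambda>y. u y \<bullet> \<omega> y) x) = (\<Sum>K\<in>\<T>. LINT x|lebesgue_on K. C3 K x)"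
    unfolding broken_integral_def by (intro sum.cong refl solid_polytope.cell_integral_cong(2)[OF cell C3c ae3])
  have I4: "(\<Sum>K\<in>\<T>. LINT x|lebesgue_on K. C4 K x) = facet_jump_term \<T> \<omega> u"
  proof -
    have "(LINT x|lebesgue_on K. C4 K x) = (\<Sum>F | F facet_of K. facet_flux ue we K F)" if K: "K \<in> \<T>" for K
    proof -
      have s: "smooth (\<lambda>x. ue K x $ i * (we K x \<bullet> we K x))" for i
        by (rule smooth_mult[OF smooth_component[OF sm(1)[OF K]] smooth_inner[OF sm(2)[OF K] sm(2)[OF K]]])
      have "(LINT x|lebesgue_on K. C4 K x) = (\<Sum>i\<in>UNIV. LINT x|lebesgue_on K. partial i (\<lambda>x. ue K x $ i * (we K x \<bullet> we K x)) x)"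
        unfolding C4_def
        by (rule Bochner_Integration.integral_sum) (rule solid_polytope.integrable_continuous_cell[OF cell[OF K] smooth_continuous[OF smooth_partial[OF s]]])
      then show ?thesis using cell_flux[of K ue we, OF K sm[OF K]] by simp
    qed
    then show ?thesis using sum_facet_flux[OF u ue we] by simp
  qed
  have "(LINT x|lebesgue_on K. C2 K x - C3 K x + 1/2 * C4 K x)
     = (LINT x|lebesgue_on K. C2 K x) - (LINT x|lebesgue_on K. C3 K x) + 1/2 * (LINT x|lebesgue_on K. C4 K x)" if K: "K \<in> \<T>" for K
    using solid_polytope.integrable_continuous_cell[OF cell[OF K]] C2c[OF K] C3c[OF K] C4c[OF K] by simp
  then have "l2_inner \<Omega> (\<lambda>x. cross3 (u x) (\<omega> x)) w = (\<Sum>K\<in>\<T>. (LINT x|lebesgue_on K. C2 K x) - (LINT x|lebesgue_on K. C3 K x) + 1/2 * (LINT x|lebesgue_on K. C4 K x))"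
    unfolding I by simp
  also have "\<dots> = (\<Sum>K\<in>\<T>. LINT x|lebesgue_on K. C2 K x) - (\<Sum>K\<in>\<T>. LINT x|lebesgue_on K. C3 K x) + 1/2 * (\<Sum>K\<in>\<T>. LINT x|lebesgue_on K. C4 K x)"
    by (simp add: sum.distrib sum_subtractf sum_divide_distrib)
  finally show ?thesis by (simp add: I2 I3 I4)
qed

end

section \<open>Finite-dimensional function spaces\<close>

lemma fun_subspace_add: "fun_subspace V \<Longrightarrow> f \<in> V \<Longrightarrow> g \<in> V \<Longrightarrow> (\<lambda>x. f x + g x) \<in> V"
  and fun_subspace_scaleR: "fun_subspace V \<Longrightarrow> f \<in> V \<Longrightarrow> (\<lambda>x. c *\<^sub>R f x) \<in> V"
  by (simp_all add: fun_subspace_def)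

lemma fun_subspace_diff: "fun_subspace V \<Longrightarrow> f \<in> V \<Longrightarrow> g \<in> V \<Longrightarrow> (\<lambda>x. f x - g x) \<in> V"
  using fun_subspace_add[of V f "\<lambda>x. (- 1) *\<^sub>R g x"] fun_subspace_scaleR[of V g "- 1"] by simp

lemma fun_subspace_sum:
  assumes "fun_subspace V" "finite I" "\<And>i. i \<in> I \<Longrightarrow> b i \<in> V"
  shows "(\<lambda>x. \<Sum>i\<in>I. c i *\<^sub>R b i x) \<in> V"
  using assms(2,3)
proof (induction rule: finite_induct)
  case empty then show ?case using assms(1) by (simp add: fun_subspace_def)
next
  case (insert i I)
  have "(\<lambda>x. c i *\<^sub>R b i x) \<in> V" by (rule fun_subspace_scaleR[OF assms(1)]) (simp add: insert.prems)
  moreover have "(\<lambda>x. \<Sum>i\<in>I. c i *\<^sub>R b i x) \<in> V" using insert by simp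
  ultimately have "(\<lambda>x. c i *\<^sub>R b i x + (\<Sum>i\<in>I. c i *\<^sub>R b i x)) \<in> V" by (rule fun_subspace_add[OF assms(1)])
  then show ?case using insert.hyps by simp
qed

lemma AE_sum_cong:
  assumes "finite I" "\<And>i. i \<in> I \<Longrightarrow> AE x in M. f i x = g i x"
  shows "AE x in M. (\<Sum>i\<in>I. c i *\<^sub>R f i x) = (\<Sum>i\<in>I. c i *\<^sub>R g i x)"
proof -
  have "AE x in M. \<forall>i\<in>I. f i x = g i x" by (rule AE_finite_allI[OF assms])
  then show ?thesis by eventually_elim simp
qed

definition l2_orthonormal :: "(real^3) set \<Rightarrow> (real^3 \<Rightarrow> 'b::euclidean_space) set \<Rightarrow> bool" where
  "l2_orthonormal \<Omega> E \<longleftrightarrow> (\<forall>e\<in>E. \<forall>e'\<in>E. l2_inner \<Omega> e e' = (if e = e' then 1 else 0))"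

lemma l2_inner_orthonormal_sum:
  assumes "finite E" "\<And>e. e \<in> E \<Longrightarrow> l2_fun \<Omega> e" "l2_orthonormal \<Omega> E" "e' \<in> E"
  shows "l2_inner \<Omega> (\<lambda>x. \<Sum>e\<in>E. c e *\<^sub>R e x) e' = c e'"
proof -
  have "l2_inner \<Omega> (\<lambda>x. \<Sum>e\<in>E. c e *\<^sub>R e x) e' = (\<Sum>e\<in>E. c e * l2_inner \<Omega> e e')"
    by (rule l2_inner_sum_left[OF assms(1,2)]) (use assms in auto)
  also have "\<dots> = (\<Sum>e\<in>E. if e = e' then c e else 0)"
    using assms(3,4) by (intro sum.cong refl) (auto simp: l2_orthonormal_def)
  also have "\<dots> = c e'" using assms(1,4) by simp
  finally show ?thesis .
qed

text \<open>By induction on the generators: each new generator is replaced by its residual after projection, normalised, unless the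
residual is zero almost everywhere, in which case nothing is added.\<close>

lemma gram_schmidt:
  fixes b :: "'i \<Rightarrow> real^3 \<Rightarrow> 'b::euclidean_space"
  assumes V: "fun_subspace V" "\<And>f. f \<in> V \<Longrightarrow> l2_fun \<Omega> f"
  shows "finite I \<Longrightarrow> (\<And>i. i \<in> I \<Longrightarrow> b i \<in> V) \<Longrightarrow> \<exists>E. finite E \<and> E \<subseteq> V \<and> l2_orthonormal \<Omega> E \<and>
      (\<forall>i\<in>I. AE x in lebesgue_on \<Omega>. b i x = (\<Sum>e\<in>E. l2_inner \<Omega> (b i) e *\<^sub>R e x))"
proof (induction rule: finite_induct)
  case empty
  show ?case by (rule exI[of _ "{}"]) (simp add: l2_orthonormal_def)
next
  case (insert k I)
  then obtain E where E: "finite E" "E \<subseteq> V" "l2_orthonormal \<Omega> E"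
    and span: "\<And>i. i \<in> I \<Longrightarrow> AE x in lebesgue_on \<Omega>. b i x = (\<Sum>e\<in>E. l2_inner \<Omega> (b i) e *\<^sub>R e x)"
    by auto
  have bk: "b k \<in> V" and bi: "\<And>i. i \<in> I \<Longrightarrow> b i \<in> V" using insert.prems by auto
  have El: "l2_fun \<Omega> e" if "e \<in> E" for e using V(2) E(2) that by blast
  define P where "P x = (\<Sum>e\<in>E. l2_inner \<Omega> (b k) e *\<^sub>R e x)" for x
  have PV: "P \<in> V" unfolding P_def[abs_def] by (rule fun_subspace_sum[OF V(1) E(1)]) (use E(2) in blast)
  define r where "r x = b k x - P x" for x
  have rV: "r \<in> V" unfolding r_def[abs_def] by (rule fun_subspace_diff[OF V(1) bk PV])
  note rl = V(2)[OF rV] and Pl = V(2)[OF PV] and bl = V(2)[OF bk]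
  have r_orth: "l2_inner \<Omega> r e = 0" if "e \<in> E" for e
  proof -
    have "l2_inner \<Omega> P e = l2_inner \<Omega> (b k) e"
      unfolding P_def[abs_def] by (rule l2_inner_orthonormal_sum[OF E(1) El E(3) that])
    then show ?thesis unfolding r_def[abs_def] using l2_inner_diff_left[OF bl Pl El[OF that]] by simp
  qed
  \<comment> \<open>squared norm of the residual\<close>
  define \<rho> where "\<rho> = l2_inner \<Omega> r r"
  show ?case
  proof (cases "\<rho> = 0")
    case True
    then have "AE x in lebesgue_on \<Omega>. r x = 0" by (intro l2_inner_self_eq_0[OF rl]) (simp add: \<rho>_def)
    then have "AE x in lebesgue_on \<Omega>. b k x = (\<Sum>e\<in>E. l2_inner \<Omega> (b k) e *\<^sub>R e x)"
      by eventually_elim (simp add: r_def P_def)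
    then show ?thesis using E span by (intro exI[of _ E]) auto
  next
    case False
    then have \<rho>: "\<rho> > 0" using l2_inner_self_nonneg[of \<Omega> r] by (simp add: \<rho>_def)
    define z where "z x = (1 / sqrt \<rho>) *\<^sub>R r x" for x
    have zV: "z \<in> V" unfolding z_def[abs_def] by (rule fun_subspace_scaleR[OF V(1) rV])
    note zl = V(2)[OF zV]
    have ze: "l2_inner \<Omega> z e = 0" if "e \<in> E" for e
      using r_orth[OF that] by (simp add: z_def[abs_def] l2_inner_scaleR_left)
    have rz: "l2_inner \<Omega> r z = sqrt \<rho>"
    proof -
      have "l2_inner \<Omega> r z = (1 / sqrt \<rho>) * \<rho>"
        by (subst l2_inner_commute) (simp add: z_def[abs_def] l2_inner_scaleR_left \<rho>_def)
      then show ?thesis using \<rho> by (simp add: real_div_sqrt)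
    qed
    have zz: "l2_inner \<Omega> z z = 1"
    proof -
      have "l2_inner \<Omega> z z = (1 / sqrt \<rho>) * l2_inner \<Omega> r z"
        unfolding z_def[abs_def] by (rule l2_inner_scaleR_left)
      then show ?thesis using rz \<rho> by simp
    qed
    have zE: "z \<notin> E" using ze zz by force
    have ez: "l2_inner \<Omega> e z = 0" if "e \<in> E" for e
      using ze[OF that] l2_inner_commute[of \<Omega> e z] by (rule trans[rotated])
    have on: "l2_orthonormal \<Omega> (insert z E)"
      using E(3) ze ez zz zE unfolding l2_orthonormal_def by auto
    have old: "AE x in lebesgue_on \<Omega>. b i x = (\<Sum>e\<in>insert z E. l2_inner \<Omega> (b i) e *\<^sub>R e x)" if i: "i \<in> I" for i
    proof -
      have Sl: "l2_fun \<Omega> (\<lambda>x. \<Sum>e\<in>E. l2_inner \<Omega> (b i) e *\<^sub>R e x)"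
        by (intro l2_fun_sum[OF E(1)] l2_fun_scaleR El)
      have "l2_inner \<Omega> (b i) z = l2_inner \<Omega> (\<lambda>x. \<Sum>e\<in>E. l2_inner \<Omega> (b i) e *\<^sub>R e x) z"
        by (rule l2_inner_cong_AE[OF V(2)[OF bi[OF i]] Sl zl span[OF i]])
      also have "\<dots> = (\<Sum>e\<in>E. l2_inner \<Omega> (b i) e * l2_inner \<Omega> e z)" by (rule l2_inner_sum_left[OF E(1) El zl])
      also have "\<dots> = 0" by (rule sum.neutral) (simp add: ez)
      finally show ?thesis using span[OF i] E(1) zE by simp
    qed
    have new: "b k x = (\<Sum>e\<in>insert z E. l2_inner \<Omega> (b k) e *\<^sub>R e x)" for x
    proof -
      have e: "b k = (\<lambda>x. r x + P x)" by (simp add: r_def)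
      have "l2_inner \<Omega> P z = (\<Sum>e\<in>E. l2_inner \<Omega> (b k) e * l2_inner \<Omega> e z)"
        unfolding P_def[abs_def] by (rule l2_inner_sum_left[OF E(1) El zl])
      also have "\<dots> = 0" by (rule sum.neutral) (simp add: ez)
      finally have "l2_inner \<Omega> (b k) z = sqrt \<rho>"
        using l2_inner_add_left[OF rl Pl zl] rz by (subst e) simp
      then have "(\<Sum>e\<in>insert z E. l2_inner \<Omega> (b k) e *\<^sub>R e x) = sqrt \<rho> *\<^sub>R z x + P x"
        using E(1) zE by (simp add: P_def)
      also have "\<dots> = b k x" using \<rho> by (simp add: z_def r_def)
      finally show ?thesis by simp
    qed
    show ?thesis
      by (rule exI[of _ "insert z E"]) (use E zV on old new in auto)
  qed
qed

text \<open>Finite-dimensionality of the discrete spaces is used in the form of such a basis: it provides orthogonal projections and reduces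
time derivatives in the function space to those of finitely many real coefficients.\<close>

lemma orthonormal_basis:
  fixes V :: "(real^3 \<Rightarrow> 'b::euclidean_space) set" and b :: "'i \<Rightarrow> real^3 \<Rightarrow> 'b"
  assumes V: "fun_subspace V" "\<And>f. f \<in> V \<Longrightarrow> l2_fun \<Omega> f"
    and I: "finite I" "\<And>i. i \<in> I \<Longrightarrow> b i \<in> V"
    and span: "\<And>f. f \<in> V \<Longrightarrow> \<exists>c. AE x in lebesgue_on \<Omega>. f x = (\<Sum>i\<in>I. c i *\<^sub>R b i x)"
  obtains E where "finite E" "E \<subseteq> V" "l2_orthonormal \<Omega> E"
    "\<And>f. f \<in> V \<Longrightarrow> AE x in lebesgue_on \<Omega>. f x = (\<Sum>e\<in>E. l2_inner \<Omega> f e *\<^sub>R e x)"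
proof -
  obtain E where E: "finite E" "E \<subseteq> V" "l2_orthonormal \<Omega> E"
    and bs: "\<And>i. i \<in> I \<Longrightarrow> AE x in lebesgue_on \<Omega>. b i x = (\<Sum>e\<in>E. l2_inner \<Omega> (b i) e *\<^sub>R e x)"
    using gram_schmidt[where b = b and V = V and \<Omega> = \<Omega>, OF V I] by blast
  have El: "l2_fun \<Omega> e" if "e \<in> E" for e using V(2) E(2) that by blast
  have "AE x in lebesgue_on \<Omega>. f x = (\<Sum>e\<in>E. l2_inner \<Omega> f e *\<^sub>R e x)" if f: "f \<in> V" for f
  proof -
    obtain c where c: "AE x in lebesgue_on \<Omega>. f x = (\<Sum>i\<in>I. c i *\<^sub>R b i x)" using span[OF f] by blast
    define d where "d e = (\<Sum>i\<in>I. c i * l2_inner \<Omega> (b i) e)" for e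
    have sc: "AE x in lebesgue_on \<Omega>. (\<Sum>i\<in>I. c i *\<^sub>R b i x) = (\<Sum>i\<in>I. c i *\<^sub>R (\<Sum>e\<in>E. l2_inner \<Omega> (b i) e *\<^sub>R e x))"
      by (rule AE_sum_cong[OF I(1)]) (rule bs)
    have ae: "AE x in lebesgue_on \<Omega>. f x = (\<Sum>e\<in>E. d e *\<^sub>R e x)"
      using c sc
    proof eventually_elim
      case (elim x)
      have "f x = (\<Sum>i\<in>I. \<Sum>e\<in>E. (c i * l2_inner \<Omega> (b i) e) *\<^sub>R e x)"
        using elim by (simp add: scaleR_sum_right)
      also have "\<dots> = (\<Sum>e\<in>E. d e *\<^sub>R e x)"
        unfolding d_def scaleR_sum_left by (rule sum.swap)
      finally show ?case .
    qed
    have d: "l2_inner \<Omega> f e = d e" if "e \<in> E" for e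
    proof -
      have "l2_inner \<Omega> f e = l2_inner \<Omega> (\<lambda>x. \<Sum>i\<in>I. c i *\<^sub>R b i x) e"
        by (rule l2_inner_cong_AE[OF V(2)[OF f] _ El[OF that] c]) (intro l2_fun_sum[OF I(1)] l2_fun_scaleR V(2) I(2))
      also have "\<dots> = d e" unfolding d_def by (rule l2_inner_sum_left[OF I(1) V(2)[OF I(2)] El[OF that]])
      finally show ?thesis .
    qed
    have "(\<Sum>e\<in>E. l2_inner \<Omega> f e *\<^sub>R e x) = (\<Sum>e\<in>E. d e *\<^sub>R e x)" for x
      by (rule sum.cong[OF refl]) (simp only: d)
    with ae show ?thesis by (simp only:)
  qed
  with E show ?thesis by (rule that)
qed

context bounded_domain begin

lemma has_weak_div_sum:
  assumes "finite E" "\<And>e. e \<in> E \<Longrightarrow> has_weak_div \<Omega> (f e) (d e)"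
  shows "has_weak_div \<Omega> (\<lambda>x. \<Sum>e\<in>E. c e *\<^sub>R f e x) (\<lambda>x. \<Sum>e\<in>E. c e *\<^sub>R d e x)"
proof -
  have l: "l2_fun \<Omega> (f e)" "l2_fun \<Omega> (d e)" if "e \<in> E" for e using assms(2)[OF that] by (auto simp: has_weak_div_def)
  have "l2_inner \<Omega> (\<lambda>x. \<Sum>e\<in>E. c e *\<^sub>R f e x) (grad \<phi>) = - l2_inner \<Omega> (\<lambda>x. \<Sum>e\<in>E. c e *\<^sub>R d e x) \<phi>"
    if \<phi>: "test_fun \<Omega> \<phi>" for \<phi>
  proof -
    have "l2_inner \<Omega> (\<lambda>x. \<Sum>e\<in>E. c e *\<^sub>R f e x) (grad \<phi>) = (\<Sum>e\<in>E. c e * l2_inner \<Omega> (f e) (grad \<phi>))"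
      by (rule l2_inner_sum_left[OF assms(1) l(1) l2_fun_test[OF test_fun_grad[OF \<phi>]]])
    also have "\<dots> = (\<Sum>e\<in>E. - (c e * l2_inner \<Omega> (d e) \<phi>))"
      using assms(2) \<phi> by (intro sum.cong refl) (simp add: has_weak_div_def)
    also have "\<dots> = - l2_inner \<Omega> (\<lambda>x. \<Sum>e\<in>E. c e *\<^sub>R d e x) \<phi>"
      unfolding sum_negf by (simp only: l2_inner_sum_left[OF assms(1) l(2) l2_fun_test[OF \<phi>]])
    finally show ?thesis .
  qed
  then show ?thesis unfolding has_weak_div_def by (intro conjI l2_fun_sum[OF assms(1)] l2_fun_scaleR l) auto
qed

lemma has_weak_curl_sum:
  assumes "finite E" "\<And>e. e \<in> E \<Longrightarrow> has_weak_curl \<Omega> (f e) (d e)"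
  shows "has_weak_curl \<Omega> (\<lambda>x. \<Sum>e\<in>E. c e *\<^sub>R f e x) (\<lambda>x. \<Sum>e\<in>E. c e *\<^sub>R d e x)"
proof -
  have l: "l2_fun \<Omega> (f e)" "l2_fun \<Omega> (d e)" if "e \<in> E" for e using assms(2)[OF that] by (auto simp: has_weak_curl_def)
  have "l2_inner \<Omega> (\<lambda>x. \<Sum>e\<in>E. c e *\<^sub>R f e x) (curl \<phi>) = l2_inner \<Omega> (\<lambda>x. \<Sum>e\<in>E. c e *\<^sub>R d e x) \<phi>"
    if \<phi>: "test_fun \<Omega> \<phi>" for \<phi>
  proof -
    have "l2_inner \<Omega> (\<lambda>x. \<Sum>e\<in>E. c e *\<^sub>R f e x) (curl \<phi>) = (\<Sum>e\<in>E. c e * l2_inner \<Omega> (f e) (curl \<phi>))"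
      by (rule l2_inner_sum_left[OF assms(1) l(1) l2_fun_test[OF test_fun_curl[OF \<phi>]]])
    also have "\<dots> = (\<Sum>e\<in>E. c e * l2_inner \<Omega> (d e) \<phi>)"
      using assms(2) \<phi> by (intro sum.cong refl) (simp add: has_weak_curl_def)
    also have "\<dots> = l2_inner \<Omega> (\<lambda>x. \<Sum>e\<in>E. c e *\<^sub>R d e x) \<phi>"
      by (simp only: l2_inner_sum_left[OF assms(1) l(2) l2_fun_test[OF \<phi>]])
    finally show ?thesis .
  qed
  then show ?thesis unfolding has_weak_curl_def by (intro conjI l2_fun_sum[OF assms(1)] l2_fun_scaleR l) auto
qed

lemma has_weak_grad_sum:
  assumes "finite E" "\<And>e. e \<in> E \<Longrightarrow> has_weak_grad \<Omega> (f e) (d e)"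
  shows "has_weak_grad \<Omega> (\<lambda>x. \<Sum>e\<in>E. c e *\<^sub>R f e x) (\<lambda>x. \<Sum>e\<in>E. c e *\<^sub>R d e x)"
proof -
  have l: "l2_fun \<Omega> (f e)" "l2_fun \<Omega> (d e)" if "e \<in> E" for e using assms(2)[OF that] by (auto simp: has_weak_grad_def)
  have "l2_inner \<Omega> (\<lambda>x. \<Sum>e\<in>E. c e *\<^sub>R f e x) (partial i \<phi>) = - l2_inner \<Omega> (\<lambda>x. (\<Sum>e\<in>E. c e *\<^sub>R d e x) $ i) \<phi>"
    if \<phi>: "test_fun \<Omega> \<phi>" for \<phi> i
  proof -
    have "l2_inner \<Omega> (\<lambda>x. \<Sum>e\<in>E. c e *\<^sub>R f e x) (partial i \<phi>) = (\<Sum>e\<in>E. c e * l2_inner \<Omega> (f e) (partial i \<phi>))"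
      by (rule l2_inner_sum_left[OF assms(1) l(1) l2_fun_test[OF test_fun_partial[OF \<phi>]]])
    also have "\<dots> = (\<Sum>e\<in>E. - (c e * l2_inner \<Omega> (\<lambda>x. d e x $ i) \<phi>))"
      using assms(2) \<phi> by (intro sum.cong refl) (simp add: has_weak_grad_componentwise)
    also have "\<dots> = - l2_inner \<Omega> (\<lambda>x. \<Sum>e\<in>E. c e *\<^sub>R (d e x $ i)) \<phi>"
      unfolding sum_negf by (simp only: l2_inner_sum_left[OF assms(1) l2_fun_component[OF l(2)] l2_fun_test[OF \<phi>]])
    finally show ?thesis by simp
  qed
  then show ?thesis unfolding has_weak_grad_componentwise by (intro conjI l2_fun_sum[OF assms(1)] l2_fun_scaleR l) auto
qed

lemma has_weak_jac_sum:
  assumes "finite E" "\<And>e. e \<in> E \<Longrightarrow> has_weak_jac \<Omega> (f e) (d e)"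
  shows "has_weak_jac \<Omega> (\<lambda>x. \<Sum>e\<in>E. c e *\<^sub>R f e x) (\<lambda>x. \<Sum>e\<in>E. c e *\<^sub>R d e x)"
  unfolding has_weak_jac_def
proof
  fix i
  have "has_weak_grad \<Omega> (\<lambda>x. \<Sum>e\<in>E. c e *\<^sub>R (f e x $ i)) (\<lambda>x. \<Sum>e\<in>E. c e *\<^sub>R (d e x $ i))"
    using assms by (intro has_weak_grad_sum) (auto simp: has_weak_jac_def)
  then show "has_weak_grad \<Omega> (\<lambda>x. (\<Sum>e\<in>E. c e *\<^sub>R f e x) $ i) (\<lambda>x. (\<Sum>e\<in>E. c e *\<^sub>R d e x) $ i)" by simp
qed

lemma has_weak_div_cong:
  assumes "has_weak_div \<Omega> v d" "l2_fun \<Omega> v'" "AE x in lebesgue_on \<Omega>. v x = v' x"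
  shows "has_weak_div \<Omega> v' d"
proof -
  have l: "l2_fun \<Omega> v" using assms(1) by (simp add: has_weak_div_def)
  have "l2_inner \<Omega> v' (grad \<phi>) = l2_inner \<Omega> v (grad \<phi>)" if "test_fun \<Omega> \<phi>" for \<phi>
    by (rule l2_inner_cong_AE[OF l assms(2) l2_fun_test[OF test_fun_grad[OF that]] assms(3), symmetric])
  then show ?thesis using assms(1,2) by (simp add: has_weak_div_def)
qed

lemma has_weak_curl_cong:
  assumes "has_weak_curl \<Omega> v d" "l2_fun \<Omega> v'" "AE x in lebesgue_on \<Omega>. v x = v' x"
  shows "has_weak_curl \<Omega> v' d"
proof -
  have l: "l2_fun \<Omega> v" using assms(1) by (simp add: has_weak_curl_def)
  have "l2_inner \<Omega> v' (curl \<phi>) = l2_inner \<Omega> v (curl \<phi>)" if "test_fun \<Omega> \<phi>" for \<phi>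
    by (rule l2_inner_cong_AE[OF l assms(2) l2_fun_test[OF test_fun_curl[OF that]] assms(3), symmetric])
  then show ?thesis using assms(1,2) by (simp add: has_weak_curl_def)
qed

lemma has_weak_jac_cong:
  assumes "has_weak_jac \<Omega> v J" "l2_fun \<Omega> v'" "AE x in lebesgue_on \<Omega>. v x = v' x"
  shows "has_weak_jac \<Omega> v' J"
  unfolding has_weak_jac_def
proof
  fix i
  have g: "has_weak_grad \<Omega> (\<lambda>x. v x $ i) (\<lambda>x. J x $ i)" using assms(1) by (simp add: has_weak_jac_def)
  then have l: "l2_fun \<Omega> (\<lambda>x. v x $ i)" by (simp add: has_weak_grad_def)
  have l': "l2_fun \<Omega> (\<lambda>x. v' x $ i)" by (rule l2_fun_component[OF assms(2)])
  have ae: "AE x in lebesgue_on \<Omega>. v x $ i = v' x $ i" using assms(3) by eventually_elim simp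
  have "l2_inner \<Omega> (\<lambda>x. v' x $ i) (partial j \<phi>) = l2_inner \<Omega> (\<lambda>x. v x $ i) (partial j \<phi>)" if "test_fun \<Omega> \<phi>" for \<phi> j
    by (rule l2_inner_cong_AE[OF l l' l2_fun_test[OF test_fun_partial[OF that]] ae, symmetric])
  then show "has_weak_grad \<Omega> (\<lambda>x. v' x $ i) (\<lambda>x. J x $ i)" using g l' by (simp add: has_weak_grad_componentwise)
qed

lemma sym_grad_AE:
  assumes "has_weak_jac \<Omega> v J"
  shows "AE x in lebesgue_on \<Omega>. sym_grad \<Omega> v x = (1/2) *\<^sub>R (J x + transpose (J x))"
  using has_weak_jac_unique[OF has_weak_jac_wjac[OF assms] assms] by eventually_elim (simp add: sym_grad_def)

lemma sym_grad_cong: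
  assumes "has_weak_jac \<Omega> v J" "l2_fun \<Omega> v'" "AE x in lebesgue_on \<Omega>. v x = v' x"
  shows "AE x in lebesgue_on \<Omega>. sym_grad \<Omega> v x = sym_grad \<Omega> v' x"
  using sym_grad_AE[OF assms(1)] sym_grad_AE[OF has_weak_jac_cong[OF assms]] by eventually_elim simp

lemma sym_grad_sum:
  assumes E: "finite E" "E \<subseteq> H1_vec \<Omega>" and v: "l2_fun \<Omega> v"
    and eq: "AE x in lebesgue_on \<Omega>. v x = (\<Sum>e\<in>E. c e *\<^sub>R e x)"
  shows "AE x in lebesgue_on \<Omega>. sym_grad \<Omega> v x = (\<Sum>e\<in>E. c e *\<^sub>R sym_grad \<Omega> e x)"
proof -
  have j: "has_weak_jac \<Omega> e (wjac \<Omega> e)" if "e \<in> E" for e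
    using E(2) that has_weak_jac_wjac by (auto simp: H1_vec_def)
  have "has_weak_jac \<Omega> (\<lambda>x. \<Sum>e\<in>E. c e *\<^sub>R e x) (\<lambda>x. \<Sum>e\<in>E. c e *\<^sub>R wjac \<Omega> e x)"
    by (rule has_weak_jac_sum[OF E(1) j])
  then have "has_weak_jac \<Omega> v (\<lambda>x. \<Sum>e\<in>E. c e *\<^sub>R wjac \<Omega> e x)"
    by (rule has_weak_jac_cong[OF _ v AE_symmetric[OF eq]])
  from sym_grad_AE[OF this] show ?thesis
  proof eventually_elim
    case (elim x)
    have "transpose (\<Sum>e\<in>E. c e *\<^sub>R wjac \<Omega> e x) = (\<Sum>e\<in>E. c e *\<^sub>R transpose (wjac \<Omega> e x))"
      by (simp add: vec_eq_iff transpose_def)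
    then show ?case using elim
      by (simp add: sym_grad_def scaleR_sum_right sum.distrib[symmetric] scaleR_add_right mult.commute)
  qed
qed

end

section \<open>Discrete Stokes complexes\<close>

text \<open>The homology of a contractible space is trivial in positive degrees, so a family of \<open>n > 0\<close> elements satisfies the relation
with all coefficients 1 and cannot be independent.\<close>

lemma betti_contractible:
  assumes "contractible_space X" "k \<noteq> 0" shows "betti k X = 0"
proof -
  let ?H = "homology_group (int k) X"
  have tr: "carrier ?H = {\<one>\<^bsub>?H\<^esub>}"
    using trivial_reduced_homology_group_contractible_space[OF assms(1), of "int k"] assms(2)
    by (simp add: un_reduced_homology_group trivial_group_def)
  have cm: "comm_monoid ?H" by (rule comm_group.axioms(1)[OF abelian_homology_group])
  have gr: "group ?H" by (rule comm_group.axioms(2)[OF abelian_homology_group])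
  let ?P = "\<lambda>n. \<exists>g. (\<forall>i<n. g i \<in> carrier ?H) \<and>
       (\<forall>c::nat \<Rightarrow> int. finprod ?H (\<lambda>i. g i [^]\<^bsub>?H\<^esub> c i) {..<n} = \<one>\<^bsub>?H\<^esub> \<longrightarrow> (\<forall>i<n. c i = 0))"
  have "n = 0" if Pn: "?P n" for n
  proof (rule ccontr)
    assume n: "n \<noteq> 0"
    obtain g where g: "\<forall>i<n. g i \<in> carrier ?H"
      "\<forall>c::nat \<Rightarrow> int. finprod ?H (\<lambda>i. g i [^]\<^bsub>?H\<^esub> c i) {..<n} = \<one>\<^bsub>?H\<^esub> \<longrightarrow> (\<forall>i<n. c i = 0)"
      using Pn by blast
    have "finprod ?H (\<lambda>i. g i [^]\<^bsub>?H\<^esub> (1::int)) {..<n} = \<one>\<^bsub>?H\<^esub>"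
    proof (rule comm_monoid.finprod_one_eqI[OF cm])
      fix i assume "i \<in> {..<n}"
      then have "g i = \<one>\<^bsub>?H\<^esub>" using g(1) tr by blast
      then show "g i [^]\<^bsub>?H\<^esub> (1::int) = \<one>\<^bsub>?H\<^esub>" by (simp only: group.int_pow_one[OF gr])
    qed
    with g(2)[THEN spec, of "\<lambda>_. 1"] have "\<forall>i<n. (1::int) = 0" by (rule mp)
    then show False using n by auto
  qed
  moreover have "?P 0" by simp
  ultimately have "Greatest ?P = 0" by (intro Greatest_equality) (assumption, simp)
  then show ?thesis unfolding betti_def Let_def .
qed

context bounded_domain begin

lemma has_weak_curl_add:
  assumes "has_weak_curl \<Omega> v w" "has_weak_curl \<Omega> v' w'"
  shows "has_weak_curl \<Omega> (\<lambda>x. v x + v' x) (\<lambda>x. w x + w' x)"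
proof -
  have l: "l2_fun \<Omega> v" "l2_fun \<Omega> w" "l2_fun \<Omega> v'" "l2_fun \<Omega> w'" using assms by (auto simp: has_weak_curl_def)
  have "l2_inner \<Omega> (\<lambda>x. v x + v' x) (curl \<phi>) = l2_inner \<Omega> (\<lambda>x. w x + w' x) \<phi>" if \<phi>: "test_fun \<Omega> \<phi>" for \<phi>
    using assms \<phi> l2_inner_add_left[OF l(1,3) l2_fun_test[OF test_fun_curl[OF \<phi>]]] l2_inner_add_left[OF l(2,4) l2_fun_test[OF \<phi>]]
    by (simp add: has_weak_curl_def)
  then show ?thesis using l by (simp add: has_weak_curl_def l2_fun_add)
qed

lemma has_weak_curl_scaleR:
  assumes "has_weak_curl \<Omega> v w" shows "has_weak_curl \<Omega> (\<lambda>x. c *\<^sub>R v x) (\<lambda>x. c *\<^sub>R w x)"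
  using assms unfolding has_weak_curl_def by (simp add: l2_inner_scaleR_left l2_fun_scaleR)

lemma has_weak_div_diff:
  assumes "has_weak_div \<Omega> v d" "has_weak_div \<Omega> v' d'"
  shows "has_weak_div \<Omega> (\<lambda>x. v x - v' x) (\<lambda>x. d x - d' x)"
proof -
  have l: "l2_fun \<Omega> v" "l2_fun \<Omega> d" "l2_fun \<Omega> v'" "l2_fun \<Omega> d'" using assms by (auto simp: has_weak_div_def)
  have "l2_inner \<Omega> (\<lambda>x. v x - v' x) (grad \<phi>) = - l2_inner \<Omega> (\<lambda>x. d x - d' x) \<phi>" if \<phi>: "test_fun \<Omega> \<phi>" for \<phi>
    using assms \<phi> l2_inner_diff_left[OF l(1,3) l2_fun_test[OF test_fun_grad[OF \<phi>]]] l2_inner_diff_left[OF l(2,4) l2_fun_test[OF \<phi>]]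
    by (simp add: has_weak_div_def)
  then show ?thesis using l by (simp add: has_weak_div_def l2_fun_diff)
qed

end

lemma has_l2_dim_spanning:
  assumes "has_l2_dim \<Omega> V n"
  shows "\<exists>B. finite B \<and> card B = n \<and> B \<subseteq> V \<and> (\<forall>f\<in>V. \<exists>c. AE x in lebesgue_on \<Omega>. f x = (\<Sum>b\<in>B. c b *\<^sub>R b x))"
  using assms unfolding has_l2_dim_def by (elim exE conjE) (intro exI conjI)

locale stokes_discretisation = meshed_domain +
  fixes A W U P
  assumes stokes: "stokes_complex \<Omega> \<T> A W U P"
begin

lemma subspace_U: "fun_subspace U" and subspace_W: "fun_subspace W"
  and piecewise_U: "u \<in> U \<Longrightarrow> piecewise_smooth \<T> u" and piecewise_W: "w \<in> W \<Longrightarrow> piecewise_smooth \<T> w"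
  and U_H1: "u \<in> U \<Longrightarrow> u \<in> H1_vec \<Omega>" and U_H0_div: "u \<in> U \<Longrightarrow> u \<in> H0_div \<Omega>"
  and grad_into_W: "\<beta> \<in> A \<Longrightarrow> \<exists>w\<in>W. has_weak_grad \<Omega> \<beta> w"
  and curl_into_U: "w \<in> W \<Longrightarrow> \<exists>v\<in>U. has_weak_curl \<Omega> w v"
  and div_into_P: "v \<in> U \<Longrightarrow> \<exists>q\<in>P. has_weak_div \<Omega> v q"
  and l2_P: "q \<in> P \<Longrightarrow> l2_fun \<Omega> q"
  using stokes unfolding stokes_complex_def fe_space_def by blast+

lemma l2_U: "u \<in> U \<Longrightarrow> l2_fun \<Omega> u"
  using U_H0_div[of u] by (auto simp: H0_div_def H_div_def has_weak_div_def)

lemma l2_W: "w \<in> W \<Longrightarrow> l2_fun \<Omega> w"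
  using curl_into_U[of w] by (auto simp: has_weak_curl_def)

lemma jac_U: "u \<in> U \<Longrightarrow> has_weak_jac \<Omega> u (wjac \<Omega> u)"
  using U_H1[of u] has_weak_jac_wjac by (auto simp: H1_vec_def)

lemma div_U: "u \<in> U \<Longrightarrow> has_weak_div \<Omega> u (wdiv \<Omega> u)"
  using div_into_P[of u] has_weak_div_wdiv by blast

lemma curl_W: "w \<in> W \<Longrightarrow> has_weak_curl \<Omega> w (wcurl \<Omega> w)"
  using curl_into_U[of w] has_weak_curl_wcurl by blast

lemma finite_spanning_U:
  obtains B where "finite B" "B \<subseteq> U" "\<And>f. f \<in> U \<Longrightarrow> \<exists>c. AE x in lebesgue_on \<Omega>. f x = (\<Sum>b\<in>B. c b *\<^sub>R b x)"
proof -
  obtain n where "has_l2_dim \<Omega> U n" using stokes unfolding stokes_complex_def fe_space_def by blast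
  from has_l2_dim_spanning[OF this] show ?thesis by (elim exE conjE) (rule that, assumption+, erule (1) bspec)
qed

lemma finite_spanning_W:
  obtains B where "finite B" "B \<subseteq> W" "\<And>f. f \<in> W \<Longrightarrow> \<exists>c. AE x in lebesgue_on \<Omega>. f x = (\<Sum>b\<in>B. c b *\<^sub>R b x)"
proof -
  obtain n where "has_l2_dim \<Omega> W n" using stokes unfolding stokes_complex_def fe_space_def by blast
  from has_l2_dim_spanning[OF this] show ?thesis by (elim exE conjE) (rule that, assumption+, erule (1) bspec)
qed

lemma basis_U:
  obtains E where "finite E" "E \<subseteq> U" "l2_orthonormal \<Omega> E"
    "\<And>f. f \<in> U \<Longrightarrow> AE x in lebesgue_on \<Omega>. f x = (\<Sum>e\<in>E. l2_inner \<Omega> f e *\<^sub>R e x)"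
proof -
  obtain B where B: "finite B" "B \<subseteq> U" "\<And>f. f \<in> U \<Longrightarrow> \<exists>c. AE x in lebesgue_on \<Omega>. f x = (\<Sum>b\<in>B. c b *\<^sub>R b x)"
    by (rule finite_spanning_U) blast
  show ?thesis
  proof (rule orthonormal_basis[OF subspace_U l2_U B(1), where b = "\<lambda>b. b"])
    show "b \<in> U" if "b \<in> B" for b using that B(2) by blast
    show "\<exists>c. AE x in lebesgue_on \<Omega>. f x = (\<Sum>b\<in>B. c b *\<^sub>R b x)" if "f \<in> U" for f by (rule B(3)[OF that])
  next
    fix E assume "finite E" "E \<subseteq> U" "l2_orthonormal \<Omega> E"
      "\<And>f. f \<in> U \<Longrightarrow> AE x in lebesgue_on \<Omega>. f x = (\<Sum>e\<in>E. l2_inner \<Omega> f e *\<^sub>R e x)"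
    then show thesis by (rule that)
  qed assumption
qed

definition curls :: "(real^3 \<Rightarrow> real^3) set" where
  "curls = {v\<in>U. \<exists>w\<in>W. has_weak_curl \<Omega> w v}"

lemma subspace_curls: "fun_subspace curls"
  unfolding fun_subspace_def
proof (intro conjI ballI allI)
  have "has_weak_curl \<Omega> (\<lambda>x. 0) (\<lambda>x. 0)" by (simp add: has_weak_curl_def l2_fun_zero l2_inner_zero_left)
  then show "(\<lambda>_. 0) \<in> curls" using subspace_U subspace_W unfolding curls_def fun_subspace_def by blast
next
  fix f g assume "f \<in> curls" "g \<in> curls"
  then obtain v w where vw: "f \<in> U" "g \<in> U" "v \<in> W" "w \<in> W" "has_weak_curl \<Omega> v f" "has_weak_curl \<Omega> w g"
    unfolding curls_def by blast
  show "(\<lambda>x. f x + g x) \<in> curls"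
    unfolding curls_def
    using fun_subspace_add[OF subspace_U vw(1,2)] fun_subspace_add[OF subspace_W vw(3,4)] has_weak_curl_add[OF vw(5,6)] by blast
next
  fix c f assume "f \<in> curls"
  then obtain v where v: "f \<in> U" "v \<in> W" "has_weak_curl \<Omega> v f" unfolding curls_def by blast
  show "(\<lambda>x. c *\<^sub>R f x) \<in> curls"
    unfolding curls_def
    using fun_subspace_scaleR[OF subspace_U v(1)] fun_subspace_scaleR[OF subspace_W v(2)] has_weak_curl_scaleR[OF v(3)] by blast
qed

lemma basis_curls:
  obtains E where "finite E" "E \<subseteq> curls" "l2_orthonormal \<Omega> E"
    "\<And>f. f \<in> curls \<Longrightarrow> AE x in lebesgue_on \<Omega>. f x = (\<Sum>e\<in>E. l2_inner \<Omega> f e *\<^sub>R e x)"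
proof -
  obtain B where B: "finite B" "B \<subseteq> W" "\<And>f. f \<in> W \<Longrightarrow> \<exists>c. AE x in lebesgue_on \<Omega>. f x = (\<Sum>b\<in>B. c b *\<^sub>R b x)"
    by (rule finite_spanning_W) blast
  have "\<forall>b\<in>B. \<exists>v\<in>U. has_weak_curl \<Omega> b v" using B(2) curl_into_U by blast
  then obtain cr where cr: "\<And>b. b \<in> B \<Longrightarrow> cr b \<in> U" "\<And>b. b \<in> B \<Longrightarrow> has_weak_curl \<Omega> b (cr b)" by metis
  have crc: "cr b \<in> curls" if "b \<in> B" for b using cr[OF that] B(2) that unfolding curls_def by blast
  have l2c: "l2_fun \<Omega> f" if "f \<in> curls" for f using that l2_U unfolding curls_def by blast
  have span: "\<exists>c. AE x in lebesgue_on \<Omega>. f x = (\<Sum>b\<in>B. c b *\<^sub>R cr b x)" if fc: "f \<in> curls" for f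
  proof -
    obtain w where w: "w \<in> W" "has_weak_curl \<Omega> w f" using fc unfolding curls_def by blast
    obtain c where c: "AE x in lebesgue_on \<Omega>. w x = (\<Sum>b\<in>B. c b *\<^sub>R b x)" using B(3)[OF w(1)] by blast
    have "has_weak_curl \<Omega> (\<lambda>x. \<Sum>b\<in>B. c b *\<^sub>R b x) (\<lambda>x. \<Sum>b\<in>B. c b *\<^sub>R cr b x)"
      by (rule has_weak_curl_sum[OF B(1) cr(2)])
    then have "has_weak_curl \<Omega> w (\<lambda>x. \<Sum>b\<in>B. c b *\<^sub>R cr b x)"
      by (rule has_weak_curl_cong[OF _ l2_W[OF w(1)] AE_symmetric[OF c]])
    from has_weak_curl_unique[OF w(2) this] show ?thesis by blast
  qed
  show ?thesis
  proof (rule orthonormal_basis[OF subspace_curls l2c B(1) crc span])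
    fix E assume "finite E" "E \<subseteq> curls" "l2_orthonormal \<Omega> E"
      "\<And>f. f \<in> curls \<Longrightarrow> AE x in lebesgue_on \<Omega>. f x = (\<Sum>e\<in>E. l2_inner \<Omega> f e *\<^sub>R e x)"
    then show thesis by (rule that)
  qed assumption+
qed

text \<open>A convex domain is contractible, so the space of discrete harmonic 2-forms has dimension zero and its spanning set is empty.\<close>

lemma harmonic2_trivial:
  assumes "r \<in> harmonic2 \<Omega> W U" shows "AE x in lebesgue_on \<Omega>. r x = 0"
proof -
  have "convex \<Omega>" using domain by (simp add: polytopal_domain_def)
  then have "contractible_space (top_of_set \<Omega>)" by (simp add: convex_imp_contractible)
  then have "betti 1 (top_of_set \<Omega>) = 0" by (rule betti_contractible) simp
  then have "has_l2_dim \<Omega> (harmonic2 \<Omega> W U) 0" using stokes unfolding stokes_complex_def by simp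
  from has_l2_dim_spanning[OF this]
  have "\<exists>c. AE x in lebesgue_on \<Omega>. r x = (\<Sum>b\<in>{}. c b *\<^sub>R b x)"
    by (elim exE conjE) (use assms in simp)
  then show ?thesis by simp
qed

text \<open>Project \<open>v\<close> orthogonally onto the curls of \<open>W\<close>. The residual is divergence free and orthogonal to all curls, hence
harmonic, hence zero almost everywhere; thus \<open>v\<close> is its own projection.\<close>

lemma divergence_free_imp_curl:
  assumes v: "v \<in> U" and div: "AE x in lebesgue_on \<Omega>. wdiv \<Omega> v x = 0"
  obtains \<psi> where "\<psi> \<in> W" "has_weak_curl \<Omega> \<psi> v"
proof -
  obtain E where E: "finite E" "E \<subseteq> curls" "l2_orthonormal \<Omega> E"
    "\<And>f. f \<in> curls \<Longrightarrow> AE x in lebesgue_on \<Omega>. f x = (\<Sum>e\<in>E. l2_inner \<Omega> f e *\<^sub>R e x)"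
    by (rule basis_curls) blast
  have El: "l2_fun \<Omega> e" if "e \<in> E" for e using E(2) that l2_U unfolding curls_def by blast
  define p where "p x = (\<Sum>e\<in>E. l2_inner \<Omega> v e *\<^sub>R e x)" for x
  have "p \<in> curls" unfolding p_def[abs_def] by (rule fun_subspace_sum[OF subspace_curls E(1)]) (use E(2) in blast)
  then obtain \<psi> where \<psi>: "p \<in> U" "\<psi> \<in> W" "has_weak_curl \<Omega> \<psi> p" unfolding curls_def by blast
  define r where "r x = v x - p x" for x
  have rU: "r \<in> U" unfolding r_def[abs_def] by (rule fun_subspace_diff[OF subspace_U v \<psi>(1)])
  note vl = l2_U[OF v] and pl = l2_U[OF \<psi>(1)] and rl = l2_U[OF rU]
  have re: "l2_inner \<Omega> r e = 0" if "e \<in> E" for e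
    using l2_inner_diff_left[OF vl pl El[OF that]] l2_inner_orthonormal_sum[OF E(1) El E(3) that, of "l2_inner \<Omega> v"]
    unfolding r_def[abs_def] p_def[abs_def] by simp
  have "AE x in lebesgue_on \<Omega>. wdiv \<Omega> r x = wdiv \<Omega> v x - 0"
    by (rule has_weak_div_unique[OF div_U[OF rU]])
       (unfold r_def[abs_def], rule has_weak_div_diff[OF div_U[OF v] has_weak_div_curl[OF \<psi>(3)]])
  with div have "AE x in lebesgue_on \<Omega>. wdiv \<Omega> r x = 0" by eventually_elim simp
  moreover have "l2_inner \<Omega> r (wcurl \<Omega> w) = 0" if w: "w \<in> W" for w
  proof -
    obtain c where c: "c \<in> U" "has_weak_curl \<Omega> w c" using curl_into_U[OF w] by blast
    then have cc: "c \<in> curls" using w unfolding curls_def by blast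
    have wl: "l2_fun \<Omega> (wcurl \<Omega> w)" using curl_W[OF w] by (simp add: has_weak_curl_def)
    have Sl: "l2_fun \<Omega> (\<lambda>x. \<Sum>e\<in>E. l2_inner \<Omega> c e *\<^sub>R e x)" by (intro l2_fun_sum[OF E(1)] l2_fun_scaleR El)
    have "AE x in lebesgue_on \<Omega>. wcurl \<Omega> w x = (\<Sum>e\<in>E. l2_inner \<Omega> c e *\<^sub>R e x)"
      using has_weak_curl_unique[OF curl_W[OF w] c(2)] E(4)[OF cc] by eventually_elim simp
    from l2_inner_cong_AE[OF wl Sl rl this]
    have "l2_inner \<Omega> (wcurl \<Omega> w) r = (\<Sum>e\<in>E. l2_inner \<Omega> c e * l2_inner \<Omega> e r)"
      using l2_inner_sum_left[OF E(1) El rl] by simp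
    also have "\<dots> = 0" by (rule sum.neutral) (simp add: re l2_inner_commute[of \<Omega> _ r])
    finally show ?thesis by (simp add: l2_inner_commute[of \<Omega> r])
  qed
  ultimately have "r \<in> harmonic2 \<Omega> W U" using rU unfolding harmonic2_def by blast
  from harmonic2_trivial[OF this] have "AE x in lebesgue_on \<Omega>. p x = v x"
    by eventually_elim (simp add: r_def)
  then have "l2_inner \<Omega> p \<phi> = l2_inner \<Omega> v \<phi>" if "test_fun \<Omega> \<phi>" for \<phi>
    by (intro l2_inner_cong_AE pl vl l2_fun_test that)
  then have "has_weak_curl \<Omega> \<psi> v" using \<psi>(3) vl by (simp add: has_weak_curl_def)
  with \<psi>(2) show ?thesis by (rule that)
qed

lemma sym_grad_zero:
  assumes "l2_fun \<Omega> v" "AE x in lebesgue_on \<Omega>. v x = 0" shows "AE x in lebesgue_on \<Omega>. sym_grad \<Omega> v x = 0"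
proof -
  have z: "has_weak_jac \<Omega> (\<lambda>x. 0) (\<lambda>x. 0)"
    unfolding has_weak_jac_def has_weak_grad_componentwise by (simp add: l2_fun_zero l2_inner_zero_left)
  have "has_weak_jac \<Omega> v (\<lambda>x. 0)" by (rule has_weak_jac_cong[OF z assms(1) AE_symmetric[OF assms(2)]])
  from sym_grad_AE[OF this] show ?thesis by eventually_elim (simp add: transpose_def vec_eq_iff)
qed

text \<open>Test the vorticity equation with \<open>\<nabla>\<alpha>\<close>, which belongs to \<open>W\<close> and has zero curl: all terms but \<open>(\<nabla>\<alpha>, \<nabla>\<alpha>)\<close> drop out.\<close>

lemma multiplier_gradient_zero:
  assumes \<alpha>: "\<alpha> \<in> A" and u: "u \<in> U"
    and eq: "\<And>\<eta>. \<eta> \<in> W \<Longrightarrow> l2_inner \<Omega> (wcurl \<Omega> \<omega>) (wcurl \<Omega> \<eta>) =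
          2 * l2_inner \<Omega> (sym_grad \<Omega> u) (sym_grad \<Omega> (wcurl \<Omega> \<eta>)) - l2_inner \<Omega> (wgrad \<Omega> \<alpha>) \<eta>"
    and \<omega>: "\<omega> \<in> W" and \<eta>: "l2_fun \<Omega> \<eta>"
  shows "l2_inner \<Omega> (wgrad \<Omega> \<alpha>) \<eta> = 0"
proof -
  obtain g where g: "g \<in> W" "has_weak_grad \<Omega> \<alpha> g" using grad_into_W[OF \<alpha>] by blast
  have gg: "AE x in lebesgue_on \<Omega>. wgrad \<Omega> \<alpha> x = g x" by (rule has_weak_grad_unique[OF has_weak_grad_wgrad[OF g(2)] g(2)])
  have gl: "l2_fun \<Omega> g" "l2_fun \<Omega> (wgrad \<Omega> \<alpha>)" using g(2) has_weak_grad_wgrad[OF g(2)] by (auto simp: has_weak_grad_def)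
  have c0: "AE x in lebesgue_on \<Omega>. wcurl \<Omega> g x = 0" by (rule has_weak_curl_unique[OF curl_W[OF g(1)] has_weak_curl_grad[OF g(2)]])
  have cl: "l2_fun \<Omega> (wcurl \<Omega> g)" using curl_W[OF g(1)] by (simp add: has_weak_curl_def)
  have ol: "l2_fun \<Omega> (wcurl \<Omega> \<omega>)" using curl_W[OF \<omega>] by (simp add: has_weak_curl_def)
  have "l2_inner \<Omega> (wcurl \<Omega> g) (wcurl \<Omega> \<omega>) = l2_inner \<Omega> (\<lambda>x. 0) (wcurl \<Omega> \<omega>)"
    by (rule l2_inner_cong_AE[OF cl l2_fun_zero ol c0])
  then have 1: "l2_inner \<Omega> (wcurl \<Omega> \<omega>) (wcurl \<Omega> g) = 0" by (simp add: l2_inner_zero_left l2_inner_commute[of \<Omega> "wcurl \<Omega> \<omega>"])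
  have s0: "AE x in lebesgue_on \<Omega>. sym_grad \<Omega> (wcurl \<Omega> g) x = 0" by (rule sym_grad_zero[OF cl c0])
  have "has_weak_jac \<Omega> (wcurl \<Omega> g) (\<lambda>x. 0)"
  proof (rule has_weak_jac_cong[OF _ cl AE_symmetric[OF c0]])
    show "has_weak_jac \<Omega> (\<lambda>x. 0) (\<lambda>x. 0)"
      unfolding has_weak_jac_def has_weak_grad_componentwise by (simp add: l2_fun_zero l2_inner_zero_left)
  qed
  then have "wcurl \<Omega> g \<in> H1_vec \<Omega>" by (auto simp: H1_vec_def)
  then have sl: "l2_fun \<Omega> (sym_grad \<Omega> (wcurl \<Omega> g))" by (rule l2_fun_sym_grad)
  have "l2_inner \<Omega> (sym_grad \<Omega> (wcurl \<Omega> g)) (sym_grad \<Omega> u) = l2_inner \<Omega> (\<lambda>x. 0) (sym_grad \<Omega> u)"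
    by (rule l2_inner_cong_AE[OF sl l2_fun_zero l2_fun_sym_grad[OF U_H1[OF u]] s0])
  then have 2: "l2_inner \<Omega> (sym_grad \<Omega> u) (sym_grad \<Omega> (wcurl \<Omega> g)) = 0" by (simp add: l2_inner_zero_left l2_inner_commute[of \<Omega> "sym_grad \<Omega> u"])
  have "l2_inner \<Omega> (wgrad \<Omega> \<alpha>) g = 0" using eq[OF g(1)] 1 2 by simp
  moreover have "l2_inner \<Omega> (wgrad \<Omega> \<alpha>) g = l2_inner \<Omega> g g" by (rule l2_inner_cong_AE[OF gl(2,1,1) gg])
  ultimately have "AE x in lebesgue_on \<Omega>. g x = 0" by (intro l2_inner_self_eq_0[OF gl(1)]) simp
  with gg have "AE x in lebesgue_on \<Omega>. wgrad \<Omega> \<alpha> x = 0" by eventually_elim simp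
  from l2_inner_cong_AE[OF gl(2) l2_fun_zero \<eta> this] show ?thesis by (simp add: l2_inner_zero_left)
qed

section \<open>The enstrophy balance\<close>

text \<open>Cauchy--Schwarz transfers differentiability in the \<open>L\<^sup>2\<close> norm to the inner product with a fixed function.\<close>

lemma coefficient_derivative:
  assumes C1: "C1_in_time \<Omega> I u u'" and t: "t \<in> I" and uU: "\<And>s. s \<in> I \<Longrightarrow> u s \<in> U" and e: "l2_fun \<Omega> e"
  shows "((\<lambda>s. l2_inner \<Omega> (u s) e) has_real_derivative l2_inner \<Omega> (u' t) e) (at t within I)"
proof -
  have u'l: "l2_fun \<Omega> (u' t)" using C1 t by (simp add: C1_in_time_def)
  define d where "d s x = (u s x - u t x) /\<^sub>R (s - t) - u' t x" for s x
  have lim: "((\<lambda>s. l2_norm \<Omega> (d s)) \<longlongrightarrow> 0) (at t within I)" using C1 t by (simp add: C1_in_time_def d_def[abs_def])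
  have id: "l2_inner \<Omega> (d s) e = (l2_inner \<Omega> (u s) e - l2_inner \<Omega> (u t) e) / (s - t) - l2_inner \<Omega> (u' t) e"
    and dl: "l2_fun \<Omega> (d s)" if s: "s \<in> I" for s
  proof -
    note us = l2_U[OF uU[OF s]] and ut = l2_U[OF uU[OF t]]
    have q: "l2_fun \<Omega> (\<lambda>x. (u s x - u t x) /\<^sub>R (s - t))" by (rule l2_fun_scaleR[OF l2_fun_diff[OF us ut]])
    show "l2_fun \<Omega> (d s)" unfolding d_def[abs_def] by (rule l2_fun_diff[OF q u'l])
    show "l2_inner \<Omega> (d s) e = (l2_inner \<Omega> (u s) e - l2_inner \<Omega> (u t) e) / (s - t) - l2_inner \<Omega> (u' t) e"
      unfolding d_def[abs_def] l2_inner_diff_left[OF q u'l e]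
      by (simp add: l2_inner_scaleR_left l2_inner_diff_left[OF us ut e] divide_inverse mult.commute)
  qed
  have lim': "((\<lambda>s. l2_norm \<Omega> (d s) * l2_norm \<Omega> e) \<longlongrightarrow> 0) (at t within I)"
    by (rule tendsto_mult_left_zero[OF lim])
  have "eventually (\<lambda>s. norm ((l2_inner \<Omega> (u s) e - l2_inner \<Omega> (u t) e) / (s - t) - l2_inner \<Omega> (u' t) e) \<le> l2_norm \<Omega> (d s) * l2_norm \<Omega> e) (at t within I)"
    unfolding eventually_at_filter
  proof (rule always_eventually, intro allI impI)
    fix s assume s: "s \<in> I"
    show "norm ((l2_inner \<Omega> (u s) e - l2_inner \<Omega> (u t) e) / (s - t) - l2_inner \<Omega> (u' t) e) \<le> l2_norm \<Omega> (d s) * l2_norm \<Omega> e"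
      unfolding id[OF s, symmetric] real_norm_def by (rule l2_Cauchy_Schwarz[OF dl[OF s] e])
  qed
  from Lim_null_comparison[OF this lim']
  have "((\<lambda>s. (l2_inner \<Omega> (u s) e - l2_inner \<Omega> (u t) e) / (s - t) - l2_inner \<Omega> (u' t) e) \<longlongrightarrow> 0) (at t within I)" .
  then have "((\<lambda>s. (l2_inner \<Omega> (u s) e - l2_inner \<Omega> (u t) e) / (s - t)) \<longlongrightarrow> l2_inner \<Omega> (u' t) e) (at t within I)"
    by (rule Lim_null[THEN iffD2])
  then show ?thesis by (simp add: has_field_derivative_iff)
qed

lemma sym_grad_inner_expansion:
  assumes E: "finite E" "E \<subseteq> U" and v: "v \<in> U" "AE x in lebesgue_on \<Omega>. v x = (\<Sum>e\<in>E. c e *\<^sub>R e x)"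
    and w: "l2_fun \<Omega> w"
  shows "l2_inner \<Omega> (sym_grad \<Omega> v) w = (\<Sum>e\<in>E. c e * l2_inner \<Omega> (sym_grad \<Omega> e) w)"
proof -
  have sl: "l2_fun \<Omega> (sym_grad \<Omega> e)" if "e \<in> E" for e using E(2) that by (intro l2_fun_sym_grad U_H1) blast
  have S: "AE x in lebesgue_on \<Omega>. sym_grad \<Omega> v x = (\<Sum>e\<in>E. c e *\<^sub>R sym_grad \<Omega> e x)"
    using E U_H1 by (intro sym_grad_sum l2_U v) auto
  have Sl: "l2_fun \<Omega> (\<lambda>x. \<Sum>e\<in>E. c e *\<^sub>R sym_grad \<Omega> e x)" by (intro l2_fun_sum[OF E(1)] l2_fun_scaleR sl)
  have "l2_inner \<Omega> (sym_grad \<Omega> v) w = l2_inner \<Omega> (\<lambda>x. \<Sum>e\<in>E. c e *\<^sub>R sym_grad \<Omega> e x) w"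
    by (rule l2_inner_cong_AE[OF l2_fun_sym_grad[OF U_H1[OF v(1)]] Sl w S])
  also have "\<dots> = (\<Sum>e\<in>E. c e * l2_inner \<Omega> (sym_grad \<Omega> e) w)" by (rule l2_inner_sum_left[OF E(1) sl w])
  finally show ?thesis .
qed

lemma enstrophy_eq: "enstrophy \<Omega> v = l2_inner \<Omega> (sym_grad \<Omega> v) (sym_grad \<Omega> v)"
  by (simp add: enstrophy_def l2_norm_square)

text \<open>In terms of the coefficients of \<open>u\<close> the enstrophy is a quadratic form. Its derivative involves only the coefficients of
\<open>u'\<close>, that is, the projection \<open>v\<close> of \<open>u'\<close> onto \<open>U\<close>; of \<open>u'\<close> itself only square integrability is known.\<close>

lemma enstrophy_derivative:
  assumes E: "finite E" "E \<subseteq> U"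
    and ex: "\<And>f. f \<in> U \<Longrightarrow> AE x in lebesgue_on \<Omega>. f x = (\<Sum>e\<in>E. l2_inner \<Omega> f e *\<^sub>R e x)"
    and C1: "C1_in_time \<Omega> I u u'" and t: "t \<in> I" and uU: "\<And>s. s \<in> I \<Longrightarrow> u s \<in> U"
    and v: "v \<in> U" "AE x in lebesgue_on \<Omega>. v x = (\<Sum>e\<in>E. l2_inner \<Omega> (u' t) e *\<^sub>R e x)"
  shows "((\<lambda>s. enstrophy \<Omega> (u s)) has_real_derivative 2 * l2_inner \<Omega> (sym_grad \<Omega> (u t)) (sym_grad \<Omega> v)) (at t within I)"
proof -
  define a where "a e e' = l2_inner \<Omega> (sym_grad \<Omega> e) (sym_grad \<Omega> e')" for e e'
  define c where "c s e = l2_inner \<Omega> (u s) e" for s e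
  define D where "D e = l2_inner \<Omega> (u' t) e" for e
  have sl: "l2_fun \<Omega> (sym_grad \<Omega> w)" if "w \<in> U" for w by (rule l2_fun_sym_grad[OF U_H1[OF that]])
  have EU: "e \<in> U" if "e \<in> E" for e using E(2) that by blast
  have bil: "l2_inner \<Omega> (sym_grad \<Omega> f) (sym_grad \<Omega> g) = (\<Sum>e\<in>E. \<Sum>e'\<in>E. k e * m e' * a e e')"
    if f: "f \<in> U" "AE x in lebesgue_on \<Omega>. f x = (\<Sum>e\<in>E. k e *\<^sub>R e x)"
      and g: "g \<in> U" "AE x in lebesgue_on \<Omega>. g x = (\<Sum>e\<in>E. m e *\<^sub>R e x)" for f g k m
  proof -
    have "l2_inner \<Omega> (sym_grad \<Omega> f) (sym_grad \<Omega> g) = (\<Sum>e\<in>E. k e * l2_inner \<Omega> (sym_grad \<Omega> g) (sym_grad \<Omega> e))"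
      using sym_grad_inner_expansion[OF E f sl[OF g(1)]] by (simp add: l2_inner_commute)
    also have "\<dots> = (\<Sum>e\<in>E. k e * (\<Sum>e'\<in>E. m e' * l2_inner \<Omega> (sym_grad \<Omega> e') (sym_grad \<Omega> e)))"
      by (rule sum.cong[OF refl]) (simp only: sym_grad_inner_expansion[OF E g sl[OF EU]])
    also have "\<dots> = (\<Sum>e\<in>E. \<Sum>e'\<in>E. k e * m e' * a e e')"
      unfolding sum_distrib_left a_def
      by (intro sum.cong refl) (simp only: mult.assoc l2_inner_commute)
    finally show ?thesis .
  qed
  have exu: "AE x in lebesgue_on \<Omega>. u s x = (\<Sum>e\<in>E. c s e *\<^sub>R e x)" if "s \<in> I" for s
    unfolding c_def by (rule ex[OF uU[OF that]])
  have cd: "((\<lambda>s. c s e) has_real_derivative D e) (at t within I)" if "e \<in> E" for e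
    unfolding c_def D_def by (rule coefficient_derivative[OF C1 t uU l2_U[OF EU[OF that]]])
  have "((\<lambda>s. \<Sum>e\<in>E. \<Sum>e'\<in>E. c s e * c s e' * a e e') has_real_derivative
      (\<Sum>e\<in>E. \<Sum>e'\<in>E. (D e * c t e' + D e' * c t e) * a e e')) (at t within I)"
    by (intro DERIV_sum DERIV_cmult_right DERIV_mult cd)
  moreover have "(\<Sum>e\<in>E. \<Sum>e'\<in>E. (D e * c t e' + D e' * c t e) * a e e')
      = 2 * l2_inner \<Omega> (sym_grad \<Omega> (u t)) (sym_grad \<Omega> v)"
  proof -
    have 1: "(\<Sum>e\<in>E. \<Sum>e'\<in>E. D e * c t e' * a e e') = l2_inner \<Omega> (sym_grad \<Omega> (u t)) (sym_grad \<Omega> v)"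
      using bil[OF v(1) v(2)[folded D_def] uU[OF t] exu[OF t]] l2_inner_commute[of \<Omega> "sym_grad \<Omega> v" "sym_grad \<Omega> (u t)"] by simp
    have 2: "(\<Sum>e\<in>E. \<Sum>e'\<in>E. D e' * c t e * a e e') = l2_inner \<Omega> (sym_grad \<Omega> (u t)) (sym_grad \<Omega> v)"
      using bil[OF uU[OF t] exu[OF t] v(1) v(2)[folded D_def]] by (simp only: mult.commute[of "D _"])
    show ?thesis unfolding distrib_right sum.distrib 1 2 by simp
  qed
  ultimately have "((\<lambda>s. \<Sum>e\<in>E. \<Sum>e'\<in>E. c s e * c s e' * a e e') has_real_derivative
      2 * l2_inner \<Omega> (sym_grad \<Omega> (u t)) (sym_grad \<Omega> v)) (at t within I)" by simp
  then show ?thesis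
  proof (rule has_field_derivative_transform_within[OF _ zero_less_one t])
    fix s assume "s \<in> I"
    then show "(\<Sum>e\<in>E. \<Sum>e'\<in>E. c s e * c s e' * a e e') = enstrophy \<Omega> (u s)"
      unfolding enstrophy_eq using bil[OF uU exu uU exu] by simp
  qed
qed

text \<open>Testing \<open>div u = 0\<close> with the divergence \<open>d\<close> of the projected derivative gives a linear combination of the coefficients that
vanishes at all times. Differentiating it in time gives \<open>(d, d) = 0\<close>. The time must be a limit point of
the interval, since otherwise nothing relates \<open>u'\<close> to \<open>u\<close>.\<close>

lemma velocity_derivative_divergence_free:
  assumes E: "finite E" "E \<subseteq> U"
    and ex: "\<And>f. f \<in> U \<Longrightarrow> AE x in lebesgue_on \<Omega>. f x = (\<Sum>e\<in>E. l2_inner \<Omega> f e *\<^sub>R e x)"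
    and C1: "C1_in_time \<Omega> I u u'" and t: "t \<in> I" "at t within I \<noteq> bot" and uU: "\<And>s. s \<in> I \<Longrightarrow> u s \<in> U"
    and div: "\<And>s. s \<in> I \<Longrightarrow> AE x in lebesgue_on \<Omega>. wdiv \<Omega> (u s) x = 0"
  shows "AE x in lebesgue_on \<Omega>. wdiv \<Omega> (\<lambda>x. \<Sum>e\<in>E. l2_inner \<Omega> (u' t) e *\<^sub>R e x) x = 0"
proof -
  have EU: "e \<in> U" if "e \<in> E" for e using E(2) that by blast
  have dE: "has_weak_div \<Omega> e (wdiv \<Omega> e)" if "e \<in> E" for e by (rule div_U[OF EU[OF that]])
  then have dl: "l2_fun \<Omega> (wdiv \<Omega> e)" if "e \<in> E" for e using that by (auto simp: has_weak_div_def)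
  define D where "D e = l2_inner \<Omega> (u' t) e" for e
  define d where "d x = (\<Sum>e\<in>E. D e *\<^sub>R wdiv \<Omega> e x)" for x
  have hd: "has_weak_div \<Omega> (\<lambda>x. \<Sum>e\<in>E. D e *\<^sub>R e x) d"
    unfolding d_def[abs_def] by (rule has_weak_div_sum[OF E(1) dE])
  then have l: "l2_fun \<Omega> d" by (simp add: has_weak_div_def)
  have zero: "(\<Sum>e\<in>E. l2_inner \<Omega> (u s) e * l2_inner \<Omega> (wdiv \<Omega> e) d) = 0" if s: "s \<in> I" for s
  proof -
    have h: "has_weak_div \<Omega> (\<lambda>x. \<Sum>e\<in>E. l2_inner \<Omega> (u s) e *\<^sub>R e x) (\<lambda>x. \<Sum>e\<in>E. l2_inner \<Omega> (u s) e *\<^sub>R wdiv \<Omega> e x)"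
      by (rule has_weak_div_sum[OF E(1) dE])
    have "has_weak_div \<Omega> (u s) (\<lambda>x. \<Sum>e\<in>E. l2_inner \<Omega> (u s) e *\<^sub>R wdiv \<Omega> e x)"
      by (rule has_weak_div_cong[OF h l2_U[OF uU[OF s]] AE_symmetric[OF ex[OF uU[OF s]]]])
    from has_weak_div_unique[OF div_U[OF uU[OF s]] this] div[OF s]
    have z: "AE x in lebesgue_on \<Omega>. (\<Sum>e\<in>E. l2_inner \<Omega> (u s) e *\<^sub>R wdiv \<Omega> e x) = 0" by eventually_elim simp
    have "l2_inner \<Omega> (\<lambda>x. \<Sum>e\<in>E. l2_inner \<Omega> (u s) e *\<^sub>R wdiv \<Omega> e x) d = l2_inner \<Omega> (\<lambda>x. 0) d"
      by (rule l2_inner_cong_AE[OF _ l2_fun_zero l z]) (intro l2_fun_sum[OF E(1)] l2_fun_scaleR dl)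
    then show ?thesis using l2_inner_sum_left[OF E(1) dl l, where c = "l2_inner \<Omega> (u s)"] by (simp add: l2_inner_zero_left)
  qed
  have "((\<lambda>s. \<Sum>e\<in>E. l2_inner \<Omega> (u s) e * l2_inner \<Omega> (wdiv \<Omega> e) d) has_real_derivative
      (\<Sum>e\<in>E. D e * l2_inner \<Omega> (wdiv \<Omega> e) d)) (at t within I)"
    unfolding D_def by (intro DERIV_sum DERIV_cmult_right coefficient_derivative[OF C1 t(1) uU] l2_U EU)
  then have "((\<lambda>s. 0) has_real_derivative (\<Sum>e\<in>E. D e * l2_inner \<Omega> (wdiv \<Omega> e) d)) (at t within I)"
    by (rule has_field_derivative_transform_within[OF _ zero_less_one t(1)]) (rule zero)
  then have "((\<lambda>s. 0) \<longlongrightarrow> (\<Sum>e\<in>E. D e * l2_inner \<Omega> (wdiv \<Omega> e) d)) (at t within I)"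
    by (simp add: has_field_derivative_iff)
  from tendsto_unique[OF t(2) this tendsto_const] have "(\<Sum>e\<in>E. D e * l2_inner \<Omega> (wdiv \<Omega> e) d) = 0" .
  moreover have "l2_inner \<Omega> d d = (\<Sum>e\<in>E. D e * l2_inner \<Omega> (wdiv \<Omega> e) d)"
  proof -
    have "l2_inner \<Omega> (\<lambda>x. \<Sum>e\<in>E. D e *\<^sub>R wdiv \<Omega> e x) d = (\<Sum>e\<in>E. D e * l2_inner \<Omega> (wdiv \<Omega> e) d)"
      by (rule l2_inner_sum_left[OF E(1) dl l])
    then show ?thesis unfolding d_def[abs_def, symmetric] .
  qed
  ultimately have "AE x in lebesgue_on \<Omega>. d x = 0" by (intro l2_inner_self_eq_0[OF l]) simp
  with has_weak_div_unique[OF has_weak_div_wdiv[OF hd] hd] show ?thesis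
    unfolding D_def by eventually_elim simp
qed

text \<open>At an isolated time every value is a derivative. Otherwise let \<open>v\<close> be the projection of \<open>u'\<close> onto \<open>U\<close>, and \<open>w = curl \<omega>\<close>.
Since \<open>v\<close> is a curl, the vorticity equation gives \<open>2(\<epsilon>u, \<epsilon>v) = (w, v) = (u', w)\<close>, and the momentum equation
evaluates the last expression; in its viscous term the vorticity equation is used once more, for \<open>w\<close>.\<close>

theorem enstrophy_balance:
  assumes sol: "scheme_solution \<Omega> Rey I A W U P \<alpha> \<omega> u u' p" and t: "t \<in> I"
  shows "((\<lambda>s. enstrophy \<Omega> (u s)) has_real_derivative
      ((LINT x|lebesgue_on \<Omega>. \<omega> t x \<bullet> (sym_grad \<Omega> (u t) x *v \<omega> t x))
        + 1/2 * facet_jump_term \<T> (\<omega> t) (u t)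
        - broken_integral \<T> (\<lambda>x. \<omega> t x \<bullet> grad (\<lambda>y. u t y \<bullet> \<omega> t y) x))
      - 1 / Rey * (l2_norm \<Omega> (wcurl \<Omega> (\<omega> t)))\<^sup>2) (at t within I)"
proof (cases "at t within I = bot")
  case True
  then show ?thesis by (simp add: has_field_derivative_iff)
next
  case False
  have C1: "C1_in_time \<Omega> I u u'" and \<alpha>A: "\<alpha> t \<in> A" and \<omega>W: "\<omega> t \<in> W" and pP: "p t \<in> P"
    and uU: "\<And>s. s \<in> I \<Longrightarrow> u s \<in> U"
    and vort: "\<And>\<eta>. \<eta> \<in> W \<Longrightarrow> l2_inner \<Omega> (wcurl \<Omega> (\<omega> t)) (wcurl \<Omega> \<eta>) =
          2 * l2_inner \<Omega> (sym_grad \<Omega> (u t)) (sym_grad \<Omega> (wcurl \<Omega> \<eta>)) - l2_inner \<Omega> (wgrad \<Omega> (\<alpha> t)) \<eta>"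
    and mom: "\<And>v. v \<in> U \<Longrightarrow> l2_inner \<Omega> (u' t) v =
          l2_inner \<Omega> (\<lambda>x. cross3 (u t x) (\<omega> t x)) v
          + l2_inner \<Omega> (\<lambda>x. (norm (u t x))\<^sup>2 / 2 + p t x) (wdiv \<Omega> v)
          - 2 / Rey * l2_inner \<Omega> (sym_grad \<Omega> (u t)) (sym_grad \<Omega> v)"
    and mass: "\<And>s q. s \<in> I \<Longrightarrow> q \<in> P \<Longrightarrow> 0 = l2_inner \<Omega> (wdiv \<Omega> (u s)) q"
    using sol t unfolding scheme_solution_def by simp_all
  have ut: "u t \<in> U" by (rule uU[OF t])
  have u'l: "l2_fun \<Omega> (u' t)" using C1 t by (simp add: C1_in_time_def)
  have div: "AE x in lebesgue_on \<Omega>. wdiv \<Omega> (u s) x = 0" if s: "s \<in> I" for s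
  proof -
    obtain q where q: "q \<in> P" "has_weak_div \<Omega> (u s) q" using div_into_P[OF uU[OF s]] by blast
    have ql: "l2_fun \<Omega> q" by (rule l2_P[OF q(1)])
    have eq: "AE x in lebesgue_on \<Omega>. wdiv \<Omega> (u s) x = q x" by (rule has_weak_div_unique[OF div_U[OF uU[OF s]] q(2)])
    have dl: "l2_fun \<Omega> (wdiv \<Omega> (u s))" using div_U[OF uU[OF s]] by (simp add: has_weak_div_def)
    have "l2_inner \<Omega> q q = 0" using mass[OF s q(1)] l2_inner_cong_AE[OF dl ql ql eq] by simp
    from l2_inner_self_eq_0[OF ql this] eq show ?thesis by eventually_elim simp
  qed
  obtain E where E: "finite E" "E \<subseteq> U" "l2_orthonormal \<Omega> E"
    and ex: "\<And>f. f \<in> U \<Longrightarrow> AE x in lebesgue_on \<Omega>. f x = (\<Sum>e\<in>E. l2_inner \<Omega> f e *\<^sub>R e x)"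
    by (rule basis_U) blast
  have El: "l2_fun \<Omega> e" if "e \<in> E" for e using E(2) that l2_U by blast
  \<comment> \<open>the orthogonal projection of the time derivative onto the velocity space\<close>
  define v where "v x = (\<Sum>e\<in>E. l2_inner \<Omega> (u' t) e *\<^sub>R e x)" for x
  have vU: "v \<in> U" unfolding v_def[abs_def] by (rule fun_subspace_sum[OF subspace_U E(1)]) (use E(2) in blast)
  note vl = l2_U[OF vU]
  have vdiv: "AE x in lebesgue_on \<Omega>. wdiv \<Omega> v x = 0"
    unfolding v_def[abs_def] by (rule velocity_derivative_divergence_free[OF E(1,2) ex C1 t False uU div])
  obtain \<psi> where \<psi>: "\<psi> \<in> W" "has_weak_curl \<Omega> \<psi> v" by (rule divergence_free_imp_curl[OF vU vdiv])
  obtain w where w: "w \<in> U" "has_weak_curl \<Omega> (\<omega> t) w" using curl_into_U[OF \<omega>W] by blast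
  note wl = l2_U[OF w(1)]
  have grad0: "l2_inner \<Omega> (wgrad \<Omega> (\<alpha> t)) \<eta> = 0" if "l2_fun \<Omega> \<eta>" for \<eta>
    by (rule multiplier_gradient_zero[OF \<alpha>A ut vort \<omega>W that])
  have sU: "l2_fun \<Omega> (sym_grad \<Omega> f)" if "f \<in> U" for f by (rule l2_fun_sym_grad[OF U_H1[OF that]])
  \<comment> \<open>the vorticity equation read as a relation on the curls of \<open>W\<close>\<close>
  have strain_curl: "2 * l2_inner \<Omega> (sym_grad \<Omega> (u t)) (sym_grad \<Omega> f) = l2_inner \<Omega> w f"
    if \<eta>: "\<eta> \<in> W" "has_weak_curl \<Omega> \<eta> f" and f: "f \<in> U" for \<eta> f
  proof -
    have c: "AE x in lebesgue_on \<Omega>. f x = wcurl \<Omega> \<eta> x" by (rule has_weak_curl_unique[OF \<eta>(2) curl_W[OF \<eta>(1)]])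
    have cl: "l2_fun \<Omega> (wcurl \<Omega> \<eta>)" using curl_W[OF \<eta>(1)] by (simp add: has_weak_curl_def)
    have ol: "l2_fun \<Omega> (wcurl \<Omega> (\<omega> t))" using curl_W[OF \<omega>W] by (simp add: has_weak_curl_def)
    have oc: "AE x in lebesgue_on \<Omega>. wcurl \<Omega> (\<omega> t) x = w x" by (rule has_weak_curl_unique[OF curl_W[OF \<omega>W] w(2)])
    have "wcurl \<Omega> \<eta> \<in> H1_vec \<Omega>" using has_weak_jac_cong[OF jac_U[OF f] cl c] by (auto simp: H1_vec_def)
    then have csl: "l2_fun \<Omega> (sym_grad \<Omega> (wcurl \<Omega> \<eta>))" by (rule l2_fun_sym_grad)
    have "l2_inner \<Omega> (sym_grad \<Omega> f) (sym_grad \<Omega> (u t)) = l2_inner \<Omega> (sym_grad \<Omega> (wcurl \<Omega> \<eta>)) (sym_grad \<Omega> (u t))"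
      by (rule l2_inner_cong_AE[OF sU[OF f] csl sU[OF ut] sym_grad_cong[OF jac_U[OF f] cl c]])
    then have "2 * l2_inner \<Omega> (sym_grad \<Omega> (u t)) (sym_grad \<Omega> f) = l2_inner \<Omega> (wcurl \<Omega> (\<omega> t)) (wcurl \<Omega> \<eta>)"
      using vort[OF \<eta>(1)] grad0[OF l2_W[OF \<eta>(1)]]
      by (simp add: l2_inner_commute[of \<Omega> "sym_grad \<Omega> (u t)"])
    also have "\<dots> = l2_inner \<Omega> w (wcurl \<Omega> \<eta>)" by (rule l2_inner_cong_AE[OF ol wl cl oc])
    also have "\<dots> = l2_inner \<Omega> (wcurl \<Omega> \<eta>) w" by (rule l2_inner_commute)
    also have "\<dots> = l2_inner \<Omega> f w" by (rule l2_inner_cong_AE[OF cl l2_U[OF f] wl AE_symmetric[OF c]])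
    also have "\<dots> = l2_inner \<Omega> w f" by (rule l2_inner_commute)
    finally show ?thesis .
  qed
  \<comment> \<open>the projection does not change products with elements of \<open>U\<close>\<close>
  have proj: "l2_inner \<Omega> w v = l2_inner \<Omega> (u' t) w"
  proof -
    have Sl: "l2_fun \<Omega> (\<lambda>x. \<Sum>e\<in>E. l2_inner \<Omega> w e *\<^sub>R e x)" by (intro l2_fun_sum[OF E(1)] l2_fun_scaleR El)
    have "l2_inner \<Omega> w (u' t) = l2_inner \<Omega> (\<lambda>x. \<Sum>e\<in>E. l2_inner \<Omega> w e *\<^sub>R e x) (u' t)"
      by (rule l2_inner_cong_AE[OF wl Sl u'l ex[OF w(1)]])
    also have "\<dots> = (\<Sum>e\<in>E. l2_inner \<Omega> w e * l2_inner \<Omega> e (u' t))" by (rule l2_inner_sum_left[OF E(1) El u'l])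
    also have "\<dots> = (\<Sum>e\<in>E. l2_inner \<Omega> (u' t) e * l2_inner \<Omega> e w)"
      by (rule sum.cong[OF refl]) (simp only: l2_inner_commute[of \<Omega> w] l2_inner_commute[of \<Omega> "u' t"] mult.commute)
    also have "\<dots> = l2_inner \<Omega> v w" unfolding v_def[abs_def] by (rule l2_inner_sum_left[OF E(1) El wl, symmetric])
    finally show ?thesis using l2_inner_commute[of \<Omega> w v] l2_inner_commute[of \<Omega> w "u' t"] by simp
  qed
  have rate: "2 * l2_inner \<Omega> (sym_grad \<Omega> (u t)) (sym_grad \<Omega> v) = l2_inner \<Omega> w v"
    by (rule strain_curl[OF \<psi> vU])
  \<comment> \<open>the Bernoulli pressure drops out because \<open>w\<close>, being a curl, is divergence free\<close>
  have pressure: "l2_inner \<Omega> (\<lambda>x. (norm (u t x))\<^sup>2 / 2 + p t x) (wdiv \<Omega> w) = 0"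
  proof -
    have d0: "AE x in lebesgue_on \<Omega>. wdiv \<Omega> w x = 0"
      by (rule has_weak_div_unique[OF div_U[OF w(1)] has_weak_div_curl[OF w(2)]])
    have mw: "wdiv \<Omega> w \<in> borel_measurable (lebesgue_on \<Omega>)" using div_U[OF w(1)] by (simp add: has_weak_div_def l2_fun_def)
    have mu: "u t \<in> borel_measurable (lebesgue_on \<Omega>)" using l2_U[OF ut] by (simp add: l2_fun_def)
    have mp: "p t \<in> borel_measurable (lebesgue_on \<Omega>)" using l2_P[OF pP] by (simp add: l2_fun_def)
    have "l2_inner \<Omega> (\<lambda>x. (norm (u t x))\<^sup>2 / 2 + p t x) (wdiv \<Omega> w) = (LINT x|lebesgue_on \<Omega>. 0)"
      unfolding l2_inner_def
    proof (rule integral_cong_AE)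
      show "(\<lambda>x. ((norm (u t x))\<^sup>2 / 2 + p t x) \<bullet> wdiv \<Omega> w x) \<in> borel_measurable (lebesgue_on \<Omega>)"
        using mw mu mp by simp
      show "AE x in lebesgue_on \<Omega>. ((norm (u t x))\<^sup>2 / 2 + p t x) \<bullet> wdiv \<Omega> w x = 0"
        using d0 by eventually_elim simp
    qed simp
    then show ?thesis by simp
  qed
  have diss: "2 * l2_inner \<Omega> (sym_grad \<Omega> (u t)) (sym_grad \<Omega> w) = (l2_norm \<Omega> (wcurl \<Omega> (\<omega> t)))\<^sup>2"
  proof -
    have ol: "l2_fun \<Omega> (wcurl \<Omega> (\<omega> t))" using curl_W[OF \<omega>W] by (simp add: has_weak_curl_def)
    have oc: "AE x in lebesgue_on \<Omega>. wcurl \<Omega> (\<omega> t) x = w x" by (rule has_weak_curl_unique[OF curl_W[OF \<omega>W] w(2)])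
    have "l2_inner \<Omega> w w = l2_inner \<Omega> (wcurl \<Omega> (\<omega> t)) w" by (rule l2_inner_cong_AE[OF ol wl wl oc, symmetric])
    also have "\<dots> = l2_inner \<Omega> w (wcurl \<Omega> (\<omega> t))" by (rule l2_inner_commute)
    also have "\<dots> = l2_inner \<Omega> (wcurl \<Omega> (\<omega> t)) (wcurl \<Omega> (\<omega> t))" by (rule l2_inner_cong_AE[OF ol wl ol oc, symmetric])
    finally show ?thesis using strain_curl[OF \<omega>W w(2,1)] by (simp add: l2_norm_square)
  qed
  have visc: "2 / Rey * l2_inner \<Omega> (sym_grad \<Omega> (u t)) (sym_grad \<Omega> w) = 1 / Rey * (l2_norm \<Omega> (wcurl \<Omega> (\<omega> t)))\<^sup>2"
    unfolding diss[symmetric] by simp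
  note nonlin = nonlinear_term[OF U_H1[OF ut] U_H0_div[OF ut] div[OF t] piecewise_U[OF ut] piecewise_W[OF \<omega>W] w(2)]
  have "2 * l2_inner \<Omega> (sym_grad \<Omega> (u t)) (sym_grad \<Omega> v) =
      ((LINT x|lebesgue_on \<Omega>. \<omega> t x \<bullet> (sym_grad \<Omega> (u t) x *v \<omega> t x))
        + 1/2 * facet_jump_term \<T> (\<omega> t) (u t)
        - broken_integral \<T> (\<lambda>x. \<omega> t x \<bullet> grad (\<lambda>y. u t y \<bullet> \<omega> t y) x))
      - 1 / Rey * (l2_norm \<Omega> (wcurl \<Omega> (\<omega> t)))\<^sup>2"
    unfolding rate proj mom[OF w(1)] pressure visc nonlin by (simp only: add_0_right)
  moreover have "AE x in lebesgue_on \<Omega>. v x = (\<Sum>e\<in>E. l2_inner \<Omega> (u' t) e *\<^sub>R e x)" by (simp add: v_def)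
  ultimately show ?thesis
    using enstrophy_derivative[OF E(1,2) ex C1 t uU vU] by (simp only:)
qed

end

theorem theorem2p6:
  fixes \<Omega> :: "(real^3) set" and \<T> :: "(real^3) set set" and Rey :: real and I :: "real set"
    and A :: "(real^3 \<Rightarrow> real) set" and W U :: "(real^3 \<Rightarrow> real^3) set"
    and P :: "(real^3 \<Rightarrow> real) set"
    and \<alpha> p :: "real \<Rightarrow> real^3 \<Rightarrow> real" and \<omega> u u' :: "real \<Rightarrow> real^3 \<Rightarrow> real^3"
  assumes "polytopal_domain \<Omega>" and "mesh_of \<T> \<Omega>" and "Rey > 0" and "is_interval I"
    and "stokes_complex \<Omega> \<T> A W U P"
    and "scheme_solution \<Omega> Rey I A W U P \<alpha> \<omega> u u' p"
  shows "\<forall>t\<in>I. ((\<lambda>s. enstrophy \<Omega> (u s)) has_real_derivative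
      ((LINT x|lebesgue_on \<Omega>. \<omega> t x \<bullet> (sym_grad \<Omega> (u t) x *v \<omega> t x))
        + 1/2 * facet_jump_term \<T> (\<omega> t) (u t)
        - broken_integral \<T> (\<lambda>x. \<omega> t x \<bullet> grad (\<lambda>y. u t y \<bullet> \<omega> t y) x))
      - 1 / Rey * (l2_norm \<Omega> (wcurl \<Omega> (\<omega> t)))\<^sup>2) (at t within I)"
proof -
  have "meshed_domain \<Omega> \<T>" using assms(1,2) by (rule meshed_domain.intro)
  moreover have "stokes_discretisation_axioms \<Omega> \<T> A W U P"
    using assms(5) by (rule stokes_discretisation_axioms.intro)
  ultimately interpret stokes_discretisation \<Omega> \<T> A W U P by (rule stokes_discretisation.intro)
  show ?thesis using enstrophy_balance[OF assms(6)] by blast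
qed

end
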